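(* For each integer $m\ge 3$ let $\mathcal{F}_2^m$ be the set of $2$-element subsets of $[m]$ with the symmetric difference metric, let $4\le r<8$, and let $\Delta_m=\mathrm{\check{C}ech}(\mathcal{F}_2^m;r)$. For distinct $x,y\in[m]$ let $\sigma_{x,y}=\{e\in\mathcal{F}_2^m : e\cap\{x,y\}\ne\emptyset\}$, and let $$K_1=\langle \sigma_{i,m} : i\in[m-1]\rangle,\qquad K_2=\langle\sigma_{x,y} : x\neq y,\ m\notin\{x,y\}\rangle,$$ so that $\Delta_m=K_1\cup K_2$. Suppose that for every $m\ge 3$ the inclusion $K_1\cap K_2\hookrightarrow K_2$ is null-homotopic. Then for every $m\ge 3$ and $4\le r<8$, $$\mathrm{\check{C}ech}(\mathcal{F}_2^m;r)\simeq\left(\bigvee_{\binom{m-1}{4}}\mathbb{S}^3\right)\vee\left(\bigvee_{\binom{m}{4}}\mathbb{S}^4\right).$$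
   Context: $[m]=\{1,\dots,m\}$. The symmetric difference metric is $d(A,B)=|(A\setminus B)\cup(B\setminus A)|$. For a finite metric space $S$ and $r\ge0$, $\mathrm{\check{C}ech}(S;r)$ is the abstract simplicial complex with vertex set $S$ in which a nonempty $\sigma\subseteq S$ is a simplex if and only if $\bigcap_{x\in\sigma}B[x,\tfrac r2]\ne\emptyset$, where $B[x,\tfrac r2]$ is the closed ball of radius $\tfrac r2$ around $x$ in $S$. For $4\le r<8$ the closed ball around $\{x,y\}$ in $\mathcal{F}_2^m$ is $\sigma_{x,y}$. $\langle\sigma_1,\sigma_2,\dots\rangle$ denotes the simplicial complex generated by the listed sets, i.e. the complex of all nonempty subsets of the $\sigma_i$. A wedge of zero spheres is a point. *)

theory Defs
  imports "HOL-Analysis.Analysis"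
begin

section \<open>Abstract simplicial complexes\<close>

text \<open>An abstract simplicial complex is given by the set of its nonempty simplices.\<close>

definition generated_complex :: "'a set set \<Rightarrow> 'a set set" where
  "generated_complex A = {\<tau>. \<tau> \<noteq> {} \<and> (\<exists>\<sigma>\<in>A. \<tau> \<subseteq> \<sigma>)}"

text \<open>
  Geometric realization by barycentric coordinates. Points carry the product topology,
  which for a finite complex (the only case used here) is the usual weak topology.
\<close>

definition realization :: "'a set set \<Rightarrow> ('a \<Rightarrow> real) topology" where
  "realization K = subtopology (powertop_real UNIV)
     {f. (\<forall>v. 0 \<le> f v) \<and> {v. f v \<noteq> 0} \<in> K \<and> (\<Sum>v | f v \<noteq> 0. f v) = 1}"

text \<open>The simplices are finite only because the metric space is assumed to be finite.\<close>

definition cech_complex :: "'a set \<Rightarrow> ('a \<Rightarrow> 'a \<Rightarrow> real) \<Rightarrow> real \<Rightarrow> 'a set set" where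
  "cech_complex S d r =
     {\<sigma>. \<sigma> \<noteq> {} \<and> \<sigma> \<subseteq> S \<and> (\<Inter>x\<in>\<sigma>. Metric_space.mcball S d x (r / 2)) \<noteq> {}}"


section \<open>Null-homotopic maps, wedges of spheres\<close>

definition null_homotopic :: "'a topology \<Rightarrow> 'b topology \<Rightarrow> ('a \<Rightarrow> 'b) \<Rightarrow> bool" where
  "null_homotopic X Y f \<longleftrightarrow>
     (\<exists>c\<in>topspace Y. homotopic_with (\<lambda>_. True) X Y f (\<lambda>_. c))"

text \<open>
  The wedge of pointed spaces \<open>(X i, p i)\<close>, \<open>i \<in> I\<close>: \<open>None\<close> is the common
  base point, and the topology is the final one for the maps \<open>wedge_in p i\<close>, that is, the
  quotient topology of the disjoint union. The empty wedge is the point \<open>{None}\<close>.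
\<close>

definition wedge_in :: "('i \<Rightarrow> 'a) \<Rightarrow> 'i \<Rightarrow> 'a \<Rightarrow> ('i \<times> 'a) option" where
  "wedge_in p i x = (if x = p i then None else Some (i, x))"

definition wedge :: "'i set \<Rightarrow> ('i \<Rightarrow> 'a topology) \<Rightarrow> ('i \<Rightarrow> 'a) \<Rightarrow> ('i \<times> 'a) option topology" where
  "wedge I X p = topology (\<lambda>U.
     U \<subseteq> insert None (\<Union>i\<in>I. wedge_in p i ` topspace (X i)) \<and>
     (\<forall>i\<in>I. openin (X i) {x \<in> topspace (X i). wedge_in p i x \<in> U}))"

lemma openin_wedge:
  "openin (wedge I X p) U \<longleftrightarrow>
     U \<subseteq> insert None (\<Union>i\<in>I. wedge_in p i ` topspace (X i)) \<and>
     (\<forall>i\<in>I. openin (X i) {x \<in> topspace (X i). wedge_in p i x \<in> U})"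
proof -
  have "istopology (\<lambda>U.
     U \<subseteq> insert None (\<Union>i\<in>I. wedge_in p i ` topspace (X i)) \<and>
     (\<forall>i\<in>I. openin (X i) {x \<in> topspace (X i). wedge_in p i x \<in> U}))" (is "istopology ?P")
    unfolding istopology_def
  proof (intro conjI allI impI)
    fix S T assume "?P S" "?P T"
    moreover have "{x \<in> topspace (X i). wedge_in p i x \<in> S \<inter> T} =
        {x \<in> topspace (X i). wedge_in p i x \<in> S} \<inter> {x \<in> topspace (X i). wedge_in p i x \<in> T}" for i
      by blast
    ultimately show "S \<inter> T \<subseteq> insert None (\<Union>i\<in>I. wedge_in p i ` topspace (X i))"
      and "\<forall>i\<in>I. openin (X i) {x \<in> topspace (X i). wedge_in p i x \<in> S \<inter> T}"
      by (blast, simp only:, blast)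
  next
    fix \<K> assume *: "\<forall>K\<in>\<K>. ?P K"
    then show "\<Union>\<K> \<subseteq> insert None (\<Union>i\<in>I. wedge_in p i ` topspace (X i))"
      by blast
    have "{x \<in> topspace (X i). wedge_in p i x \<in> \<Union>\<K>} =
        \<Union>((\<lambda>K. {x \<in> topspace (X i). wedge_in p i x \<in> K}) ` \<K>)" for i
      by blast
    with * show "\<forall>i\<in>I. openin (X i) {x \<in> topspace (X i). wedge_in p i x \<in> \<Union>\<K>}"
      by (simp only:) blast
  qed
  then show ?thesis
    by (simp add: wedge_def)
qed

lemma topspace_wedge:
  "topspace (wedge I X p) = insert None (\<Union>i\<in>I. wedge_in p i ` topspace (X i))" (is "_ = ?S")
proof -
  have "{x \<in> topspace (X i). wedge_in p i x \<in> ?S} = topspace (X i)" if "i \<in> I" for i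
    using that by blast
  then have "openin (wedge I X p) ?S"
    by (simp only: openin_wedge) auto
  then have "?S \<subseteq> topspace (wedge I X p)"
    by (rule openin_subset)
  moreover have "topspace (wedge I X p) \<subseteq> ?S"
    using openin_topspace[of "wedge I X p"] by (simp only: openin_wedge)
  ultimately show ?thesis
    by (rule subset_antisym[rotated])
qed

text \<open>The wedge of two pointed spaces, as a wedge indexed by the booleans.\<close>

definition wedge2 :: "'a topology \<Rightarrow> 'a \<Rightarrow> 'a topology \<Rightarrow> 'a \<Rightarrow> (bool \<times> 'a) option topology" where
  "wedge2 X p Y q = wedge UNIV (\<lambda>b. if b then X else Y) (\<lambda>b. if b then p else q)"

definition sphere_base :: "nat \<Rightarrow> real" where
  "sphere_base = (\<lambda>i. if i = 0 then 1 else 0)"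

lemma sphere_base_in_nsphere: "sphere_base \<in> topspace (nsphere n)"
proof -
  have "(\<Sum>i\<le>n. (sphere_base i)\<^sup>2) = (\<Sum>i\<in>{0}. (sphere_base i)\<^sup>2)"
    by (rule sum.mono_neutral_right) (auto simp: sphere_base_def)
  then show ?thesis
    by (simp add: nsphere topspace_subtopology sphere_base_def)
qed

text \<open>The wedge of \<open>k\<close> copies of the \<open>n\<close>-sphere; its base point is \<open>None\<close>.\<close>

definition sphere_wedge :: "nat \<Rightarrow> nat \<Rightarrow> (nat \<times> (nat \<Rightarrow> real)) option topology" where
  "sphere_wedge n k = wedge {..<k} (\<lambda>_. nsphere n) (\<lambda>_. sphere_base)"


section \<open>Two-element subsets with the symmetric difference metric\<close>

definition symdiff_dist :: "'a set \<Rightarrow> 'a set \<Rightarrow> real" where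
  "symdiff_dist A B = real (card ((A - B) \<union> (B - A)))"

definition F2 :: "nat \<Rightarrow> nat set set" where
  "F2 m = {e. e \<subseteq> {1..m} \<and> card e = 2}"

definition star_set :: "nat \<Rightarrow> nat \<Rightarrow> nat \<Rightarrow> nat set set" where
  "star_set m x y = {e \<in> F2 m. e \<inter> {x, y} \<noteq> {}}"

definition K1 :: "nat \<Rightarrow> nat set set set" where
  "K1 m = generated_complex {star_set m i m | i. i \<in> {1..m - 1}}"

definition K2 :: "nat \<Rightarrow> nat set set set" where
  "K2 m = generated_complex
     {star_set m x y | x y. x \<in> {1..m} \<and> y \<in> {1..m} \<and> x \<noteq> y \<and> m \<notin> {x, y}}"

lemma Metric_space_F2: "Metric_space (F2 m) symdiff_dist"
proof
  fix x y z assume x: "x \<in> F2 m" and y: "y \<in> F2 m" and z: "z \<in> F2 m"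
  have fin: "finite a" if "a \<in> F2 m" for a
    using that finite_subset[of a "{1..m}"] by (auto simp: F2_def)
  show "symdiff_dist x y = 0 \<longleftrightarrow> x = y"
    using fin[OF x] fin[OF y] by (auto simp: symdiff_dist_def)
  have "card (sym_diff x z) \<le> card (sym_diff x y \<union> sym_diff y z)"
    using fin[OF x] fin[OF y] fin[OF z] by (intro card_mono) auto
  also have "\<dots> \<le> card (sym_diff x y) + card (sym_diff y z)"
    by (rule card_Un_le)
  finally show "symdiff_dist x z \<le> symdiff_dist x y + symdiff_dist y z"
    by (simp add: symdiff_dist_def)
qed (auto simp: symdiff_dist_def Un_commute)

lemma mcball_F2:
  assumes "x \<noteq> y" "x \<in> {1..m}" "y \<in> {1..m}" "4 \<le> r" "r < 8"
  shows "Metric_space.mcball (F2 m) symdiff_dist {x, y} (r / 2) = star_set m x y"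
proof -
  have *: "symdiff_dist {x, y} e \<le> r / 2 \<longleftrightarrow> e \<inter> {x, y} \<noteq> {}" if "e \<in> F2 m" for e
  proof -
    have "\<exists>a b. e = {a, b} \<and> a \<noteq> b"
      using that by (simp add: F2_def card_2_iff)
    then obtain a b where e: "e = {a, b}" "a \<noteq> b"
      by blast
    consider "e \<inter> {x, y} = {}" | "e \<inter> {x, y} \<noteq> {}" by blast
    then show ?thesis
    proof cases
      case 1
      then have "sym_diff {x, y} e = {x, y, a, b}" "card {x, y, a, b} = 4"
        using e assms(1) by auto
      with 1 assms show ?thesis by (simp add: symdiff_dist_def)
    next
      case 2
      then obtain c where c: "c \<in> e" "c \<in> {x, y}" by blast
      have "card (sym_diff {x, y} e) \<le> card (({x, y} - {c}) \<union> (e - {c}))"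
        using c e by (intro card_mono) auto
      also have "\<dots> \<le> card ({x, y} - {c}) + card (e - {c})"
        by (rule card_Un_le)
      also have "\<dots> = 2"
        using c e assms(1) by auto
      finally have "symdiff_dist {x, y} e \<le> 2"
        by (simp add: symdiff_dist_def)
      with 2 assms show ?thesis by simp
    qed
  qed
  have "{x, y} \<in> F2 m"
    using assms by (auto simp: F2_def)
  with * show ?thesis
    by (auto simp: Metric_space.mcball_def[OF Metric_space_F2] star_set_def)
qed

lemma cech_complex_F2:
  assumes "4 \<le> r" "r < 8"
  shows "cech_complex (F2 m) symdiff_dist r = K1 m \<union> K2 m"
proof -
  interpret Metric_space "F2 m" symdiff_dist
    by (rule Metric_space_F2)
  have "\<sigma> \<subseteq> F2 m \<and> (\<Inter>x\<in>\<sigma>. mcball x (r / 2)) \<noteq> {} \<longleftrightarrow> (\<exists>c\<in>F2 m. \<sigma> \<subseteq> mcball c (r / 2))"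
    if "\<sigma> \<noteq> {}" for \<sigma>
    using that by (fastforce simp: commute)
  moreover have "(\<lambda>c. mcball c (r / 2)) ` F2 m =
      {star_set m x y | x y. x \<in> {1..m} \<and> y \<in> {1..m} \<and> x \<noteq> y}"
  proof (intro set_eqI iffI)
    fix s assume "s \<in> (\<lambda>c. mcball c (r / 2)) ` F2 m"
    then obtain x y where "{x, y} \<subseteq> {1..m}" "x \<noteq> y" "s = mcball {x, y} (r / 2)"
      by (auto simp: F2_def card_2_iff)
    then show "s \<in> {star_set m x y | x y. x \<in> {1..m} \<and> y \<in> {1..m} \<and> x \<noteq> y}"
      using mcball_F2[of x y m r] assms by blast
  next
    fix s assume "s \<in> {star_set m x y | x y. x \<in> {1..m} \<and> y \<in> {1..m} \<and> x \<noteq> y}"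
    then obtain x y where *: "x \<in> {1..m}" "y \<in> {1..m}" "x \<noteq> y" "s = star_set m x y"
      by blast
    then have "{x, y} \<in> F2 m" "s = mcball {x, y} (r / 2)"
      using mcball_F2[of x y m r] assms by (auto simp: F2_def)
    then show "s \<in> (\<lambda>c. mcball c (r / 2)) ` F2 m"
      by blast
  qed
  ultimately have "cech_complex (F2 m) symdiff_dist r =
      generated_complex {star_set m x y | x y. x \<in> {1..m} \<and> y \<in> {1..m} \<and> x \<noteq> y}"
    unfolding cech_complex_def generated_complex_def by (metis (no_types, lifting) image_iff)
  also have "{star_set m x y | x y. x \<in> {1..m} \<and> y \<in> {1..m} \<and> x \<noteq> y} =
      {star_set m i m | i. i \<in> {1..m - 1}} \<union>
      {star_set m x y | x y. x \<in> {1..m} \<and> y \<in> {1..m} \<and> x \<noteq> y \<and> m \<notin> {x, y}}" (is "?A = ?B \<union> ?C")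
  proof
    have comm: "star_set m x y = star_set m y x" for x y
      by (simp add: star_set_def insert_commute)
    show "?A \<subseteq> ?B \<union> ?C"
    proof
      fix s assume "s \<in> ?A"
      then obtain x y where *: "x \<in> {1..m}" "y \<in> {1..m}" "x \<noteq> y" "s = star_set m x y"
        by blast
      consider "x = m" | "y = m" | "m \<notin> {x, y}" by blast
      then show "s \<in> ?B \<union> ?C"
      proof cases
        case 1
        then have "y \<in> {1..m - 1}" "s = star_set m y m" using * comm by auto
        then show ?thesis by blast
      next
        case 2
        then have "x \<in> {1..m - 1}" using * by auto
        then show ?thesis using * 2 by blast
      next
        case 3
        then show ?thesis using * by blast
      qed
    qed
    show "?B \<union> ?C \<subseteq> ?A"
    proof
      fix s assume "s \<in> ?B \<union> ?C"
      then consider i where "i \<in> {1..m - 1}" "s = star_set m i m" | "s \<in> ?C" by blast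
      then show "s \<in> ?A"
      proof cases
        case 1
        then have "i \<in> {1..m}" "m \<in> {1..m}" "i \<noteq> m" by auto
        then show ?thesis using 1 by blast
      qed blast
    qed
  qed
  also have "generated_complex (?B \<union> ?C) = K1 m \<union> K2 m"
    unfolding K1_def K2_def generated_complex_def by blast
  finally show ?thesis .
qed

end

theory Submission
  imports Defs
begin

text \<open>
  Up to homotopy, the complex for \<open>m\<close> is the complex for \<open>m - 1\<close> with some 3-spheres and 4-spheres wedged
  on. Every simplex of \<open>K1 m\<close> remains a simplex when \<open>{1, m}\<close> is added, so \<open>K1 m\<close> is a cone and may be
  replaced by a cone over the overlap of \<open>K1 m\<close> and \<open>K2 m\<close> (\<open>replace_cone\<close>). The complex \<open>K2 m\<close> in turn
  collapses onto the whole complex for \<open>m - 1\<close> (\<open>K2_collapse\<close>): a vertex \<open>{x, m}\<close> occurs only together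
  with all edges at \<open>x\<close>. It remains to see what the cone over the overlap contributes.

  The overlap is built from a point by reversed collapses and by adding two kinds of cells whose boundaries
  are null-homotopic in what is already there: a triangle for each 3-subset of \<open>{2..m - 1}\<close> and a
  tetrahedron for each 3-subset of \<open>{1..m - 1}\<close>. Geometrically, after collapsing large stars, each triple
  of indices carries a 3-sphere (the join of two circles, formed by its three edges and by its three
  points), and these spheres are glued together like the triangles of the 2-skeleton of a simplex. In the
  cone over the overlap the collapses persist (\<open>collapses_cone\<close>), and the cells become cells of
  dimension 3 and 4. Since the overlap is null-homotopic in \<open>K2 m\<close> by hypothesis, the boundaries of these
  cells are null-homotopic as well (\<open>suspension_null\<close>). A cell with null-homotopic boundary may be traded for
  a sphere wedged on at a fixed vertex (\<open>cell_to_sphere\<close>), by the invariance of an attached cone under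
  homotopies of the attaching map (\<open>homotopy_equivalent_attachments\<close>). Hence passing from \<open>m - 1\<close> to \<open>m\<close>
  contributes \<open>m - 2 choose 3\<close> spheres of dimension 3 and \<open>m - 1 choose 3\<close> of dimension 4
  (\<open>cech_step\<close>), and Pascal's rule sums them up, starting from a single vertex for \<open>m = 2\<close>.

  All intermediate spaces are finite simplicial complexes. The spheres are boundaries of simplices with fresh
  vertices that share one vertex with the complex, so that collapses and exchanges of cells can be carried
  out in their presence; only at the end is this bouquet compared with the topological wedge
  (\<open>bouquet_homeomorphic_wedge\<close>).
\<close>

section \<open>Complexes and their points\<close>

text \<open>
  Compact sets of barycentric coordinates are closed because a product of Hausdorff spaces is
  Hausdorff. The classes below it come first, since the arity of a class must not be less general
  than those of its subclasses.
\<close>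

instance "fun" :: (type, t0_space) t0_space
proof
  fix f g :: "'a \<Rightarrow> 'b"
  assume "f \<noteq> g"
  then obtain i where "f i \<noteq> g i" by blast
  then obtain U where U: "open U" "\<not> (f i \<in> U \<longleftrightarrow> g i \<in> U)"
    using t0_space_class.t0_space[OF \<open>f i \<noteq> g i\<close>] by auto
  then have "open ((\<lambda>h. h i) -` U)"
    by (intro open_vimage continuous_on_product_coordinates)
  with U show "\<exists>U. open U \<and> \<not> (f \<in> U \<longleftrightarrow> g \<in> U)"
    by (metis vimage_eq)
qed

instance "fun" :: (type, t1_space) t1_space
proof
  fix f g :: "'a \<Rightarrow> 'b"
  assume "f \<noteq> g"
  then obtain i where "f i \<noteq> g i" by blast
  then obtain U where U: "open U" "f i \<in> U" "g i \<notin> U"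
    by (meson t1_space)
  then have "open ((\<lambda>h. h i) -` U)"
    by (intro open_vimage continuous_on_product_coordinates)
  with U show "\<exists>U. open U \<and> f \<in> U \<and> g \<notin> U"
    by (metis vimage_eq)
qed

instance "fun" :: (type, t2_space) t2_space
proof
  fix f g :: "'a \<Rightarrow> 'b"
  assume "f \<noteq> g"
  then obtain i where "f i \<noteq> g i" by blast
  then obtain U V where UV: "open U" "open V" "f i \<in> U" "g i \<in> V" "U \<inter> V = {}"
    by (meson hausdorff)
  have "open ((\<lambda>h. h i) -` U)" "open ((\<lambda>h. h i) -` V)" for i
    by (intro open_vimage UV continuous_on_product_coordinates)+
  moreover have "((\<lambda>h. h i) -` U) \<inter> ((\<lambda>h. h i) -` V) = {}"
    using UV by blast
  ultimately show "\<exists>U V. open U \<and> open V \<and> f \<in> U \<and> g \<in> V \<and> U \<inter> V = {}"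
    using UV by (metis vimageI)
qed

definition points :: "'a set set \<Rightarrow> ('a \<Rightarrow> real) set" where
  "points K = {f. (\<forall>v. 0 \<le> f v) \<and> {v. f v \<noteq> 0} \<in> K \<and> (\<Sum>v | f v \<noteq> 0. f v) = 1}"

lemma realization_eq: "realization K = top_of_set (points K)"
  by (simp add: realization_def points_def euclidean_product_topology)

text \<open>Finiteness of the complex and of its simplices makes the realization compact.\<close>

definition simplicial_complex :: "'a set set \<Rightarrow> bool" where
  "simplicial_complex K \<longleftrightarrow> finite K \<and> (\<forall>\<tau>\<in>K. finite \<tau> \<and> \<tau> \<noteq> {}) \<and> (\<forall>\<tau>\<in>K. \<forall>\<rho>. \<rho> \<noteq> {} \<longrightarrow> \<rho> \<subseteq> \<tau> \<longrightarrow> \<rho> \<in> K)"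

lemma complexD:
  assumes "simplicial_complex K" "\<tau> \<in> K"
  shows "finite \<tau>" "\<tau> \<noteq> {}" "\<rho> \<noteq> {} \<Longrightarrow> \<rho> \<subseteq> \<tau> \<Longrightarrow> \<rho> \<in> K"
  using assms unfolding simplicial_complex_def by blast+

lemma complexI:
  assumes "finite K" "\<And>\<tau>. \<tau> \<in> K \<Longrightarrow> finite \<tau>" "\<And>\<tau>. \<tau> \<in> K \<Longrightarrow> \<tau> \<noteq> {}"
    and "\<And>\<tau> \<rho>. \<tau> \<in> K \<Longrightarrow> \<rho> \<noteq> {} \<Longrightarrow> \<rho> \<subseteq> \<tau> \<Longrightarrow> \<rho> \<in> K"
  shows "simplicial_complex K"
  using assms unfolding simplicial_complex_def by blast

lemma complex_finite: "simplicial_complex K \<Longrightarrow> finite K"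
  by (simp add: simplicial_complex_def)

lemma complex_Un:
  assumes "simplicial_complex K" "simplicial_complex L"
  shows "simplicial_complex (K \<union> L)"
proof (rule complexI)
  show "finite (K \<union> L)" using assms by (simp add: complex_finite)
  show "\<rho> \<in> K \<union> L" if "\<tau> \<in> K \<union> L" "\<rho> \<noteq> {}" "\<rho> \<subseteq> \<tau>" for \<tau> \<rho>
    using that complexD(3)[OF assms(1), of \<tau> \<rho>] complexD(3)[OF assms(2), of \<tau> \<rho>] by auto
qed (use complexD(1,2)[OF assms(1)] complexD(1,2)[OF assms(2)] in blast)+

lemma complex_Int:
  assumes "simplicial_complex K" "simplicial_complex L"
  shows "simplicial_complex (K \<inter> L)"
proof (rule complexI)
  show "finite (K \<inter> L)" using assms by (simp add: complex_finite)
  show "\<rho> \<in> K \<inter> L" if "\<tau> \<in> K \<inter> L" "\<rho> \<noteq> {}" "\<rho> \<subseteq> \<tau>" for \<tau> \<rho>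
    using that complexD(3)[OF assms(1), of \<tau> \<rho>] complexD(3)[OF assms(2), of \<tau> \<rho>] by auto
qed (use complexD(1,2)[OF assms(1)] complexD(1,2)[OF assms(2)] in blast)+

lemma points_mono: "K \<subseteq> L \<Longrightarrow> points K \<subseteq> points L"
  by (auto simp: points_def)

lemma points_iff:
  assumes "finite W" "{v. f v \<noteq> 0} \<subseteq> W"
  shows "f \<in> points K \<longleftrightarrow> (\<forall>v. 0 \<le> f v) \<and> {v. f v \<noteq> 0} \<in> K \<and> sum f W = 1"
proof -
  have "sum f W = sum f {v. f v \<noteq> 0}"
    using assms by (intro sum.mono_neutral_right) auto
  then show ?thesis by (simp add: points_def)
qed

lemma points_not_zero: "f \<in> points K \<Longrightarrow> {v. f v \<noteq> 0} \<noteq> {}"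
  unfolding points_def by (metis (mono_tags, lifting) mem_Collect_eq sum.empty zero_neq_one)

lemma pointsI_le:
  assumes "simplicial_complex K" "\<tau> \<in> K" "\<And>v. 0 \<le> f v" "{v. f v \<noteq> 0} \<subseteq> \<tau>" "sum f \<tau> = 1"
  shows "f \<in> points K"
proof -
  have "finite \<tau>" using complexD(1) assms by blast
  have "{v. f v \<noteq> 0} \<noteq> {}" using assms(5) sum.neutral[of \<tau> f] by fastforce
  then have "{v. f v \<noteq> 0} \<in> K" using assms complexD(3) by metis
  then show ?thesis using points_iff[OF \<open>finite \<tau>\<close> assms(4)] assms by auto
qed

section \<open>Elementary collapses\<close>

lemma continuous_on_coord [continuous_intros]: "continuous_on A (\<lambda>f::'a\<Rightarrow>'b::topological_space. f v)"
  by (rule continuous_on_subset[OF continuous_on_product_coordinates]) auto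

lemma continuous_on_Min_coord:
  fixes \<sigma> :: "'a set"
  assumes "finite \<sigma>" "\<sigma> \<noteq> {}"
  shows "continuous_on A (\<lambda>f::'a \<Rightarrow> real. Min (f ` \<sigma>))"
  using assms
proof (induction rule: finite_ne_induct)
  case (singleton x)
  then show ?case by (auto intro: continuous_intros)
next
  case (insert x F)
  have "(\<lambda>f::'a \<Rightarrow> real. Min (f ` insert x F)) = (\<lambda>f. min (f x) (Min (f ` F)))"
    using insert by (auto simp: fun_eq_iff)
  then show ?case using insert by (auto intro!: continuous_intros)
qed

definition delete_star :: "'a set \<Rightarrow> 'a set set \<Rightarrow> 'a set set" where
  "delete_star \<sigma> K = {\<tau> \<in> K. \<not> \<sigma> \<subseteq> \<tau>}"

text \<open>
  Mass is moved from \<open>\<sigma>\<close> to the apex \<open>v\<close> at equal rates; at time 1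
  some vertex of \<open>\<sigma>\<close> has lost all its mass.
\<close>

definition push :: "'a set \<Rightarrow> 'a \<Rightarrow> real \<Rightarrow> ('a \<Rightarrow> real) \<Rightarrow> 'a \<Rightarrow> real" where
  "push \<sigma> v t f x = (if x \<in> \<sigma> then f x - t * Min (f ` \<sigma>)
     else if x = v then f v + t * (real (card \<sigma>) * Min (f ` \<sigma>)) else f x)"

lemma complex_delete_star: "simplicial_complex K \<Longrightarrow> simplicial_complex (delete_star \<sigma> K)"
  unfolding simplicial_complex_def delete_star_def by (simp, meson subset_trans)

lemma push_in_points:
  assumes K: "simplicial_complex K" and \<sigma>: "\<sigma> \<in> K" "v \<notin> \<sigma>"
    and cone: "\<And>\<tau>. \<tau> \<in> K \<Longrightarrow> \<sigma> \<subseteq> \<tau> \<Longrightarrow> insert v \<tau> \<in> K"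
    and f: "f \<in> points K" and t: "0 \<le> t" "t \<le> 1"
  shows "push \<sigma> v t f \<in> points K" "push \<sigma> v 1 f \<in> points (delete_star \<sigma> K)"
    "f \<in> points (delete_star \<sigma> K) \<Longrightarrow> push \<sigma> v t f = f"
proof -
  have fin: "finite \<sigma>" "\<sigma> \<noteq> {}" using complexD(1,2)[OF K \<sigma>(1)] by auto
  let ?\<mu> = "Min (f ` \<sigma>)" and ?S = "{v. f v \<noteq> 0}"
  have fS: "?S \<in> K" "\<And>x. 0 \<le> f x" using f by (auto simp: points_def)
  have finS: "finite ?S" using complexD(1)[OF K fS(1)] by auto
  have \<mu>0: "0 \<le> ?\<mu>" and \<mu>le: "\<And>x. x \<in> \<sigma> \<Longrightarrow> ?\<mu> \<le> f x" using fin fS by auto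
  have \<mu>in: "?\<mu> \<in> f ` \<sigma>" using fin by (intro Min_in) auto
  have triv: "push \<sigma> v t f = f" if "?\<mu> = 0" for t
    using that by (auto simp: push_def)
  have zero: "?\<mu> = 0" if ns: "\<not> \<sigma> \<subseteq> ?S"
  proof -
    obtain x where "x \<in> \<sigma>" "f x = 0" using ns by blast
    then show ?thesis using \<mu>0 \<mu>le by force
  qed
  show "f \<in> points (delete_star \<sigma> K) \<Longrightarrow> push \<sigma> v t f = f"
    using triv zero by (auto simp: points_def delete_star_def)
  have main: "push \<sigma> v t f \<in> points K" if t: "0 \<le> t" "t \<le> 1" for t
  proof (cases "\<sigma> \<subseteq> ?S")
    case False
    then show ?thesis using triv zero f by simp
  next
    case True
    let ?W = "insert v ?S"
    have WK: "?W \<in> K" using cone True fS by blast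
    show ?thesis
    proof (rule pointsI_le[OF K WK])
      fix x
      have "t * ?\<mu> \<le> 1 * ?\<mu>" using t \<mu>0 by (intro mult_right_mono) auto
      then show "0 \<le> push \<sigma> v t f x" using \<mu>le[of x] fS(2) \<mu>0 t by (auto simp: push_def)
    next
      show "{x. push \<sigma> v t f x \<noteq> 0} \<subseteq> ?W" using True by (auto simp: push_def split: if_splits)
      have "push \<sigma> v t f = (\<lambda>x. f x + ((if x \<in> \<sigma> then - (t * ?\<mu>) else 0)
          + (if x = v then t * (real (card \<sigma>) * ?\<mu>) else 0)))"
        using \<sigma> by (auto simp: push_def fun_eq_iff)
      moreover have "(\<Sum>x\<in>?W. if x \<in> \<sigma> then - (t * ?\<mu>) else 0) = - (real (card \<sigma>) * (t * ?\<mu>))"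
      proof -
        have "(\<Sum>x\<in>?W. if x \<in> \<sigma> then - (t * ?\<mu>) else 0) = (\<Sum>x\<in>?W \<inter> \<sigma>. - (t * ?\<mu>))"
          using finS by (intro sum.inter_restrict[symmetric]) auto
        also have "?W \<inter> \<sigma> = \<sigma>" using True by auto
        finally show ?thesis by simp
      qed
      moreover have "sum f ?W = 1"
        using f finS points_iff[of ?W f K] by auto
      moreover have "(\<Sum>x\<in>?W. if x = v then t * (real (card \<sigma>) * ?\<mu>) else 0) = t * (real (card \<sigma>) * ?\<mu>)"
        using finS by (subst sum.delta) auto
      ultimately show "sum (push \<sigma> v t f) ?W = 1"
        by (simp only: sum.distrib) simp
    qed
  qed
  show "push \<sigma> v t f \<in> points K" using main t by blast
  have "push \<sigma> v 1 f \<in> points K" using main by simp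
  moreover obtain x where "x \<in> \<sigma>" "f x = ?\<mu>" using \<mu>in by auto
  then have "push \<sigma> v 1 f x = 0" "x \<in> \<sigma>" by (auto simp: push_def)
  ultimately show "push \<sigma> v 1 f \<in> points (delete_star \<sigma> K)"
    by (auto simp: points_def delete_star_def)
qed

lemma continuous_on_push:
  assumes "finite \<sigma>" "\<sigma> \<noteq> {}"
  shows "continuous_on A (\<lambda>(t, f). push \<sigma> v t f)"
proof -
  have *: "continuous_on A (\<lambda>z. Min (snd z ` \<sigma>))" for A :: "(real \<times> ('a \<Rightarrow> real)) set"
    by (rule continuous_on_compose2[OF continuous_on_Min_coord[OF assms] continuous_on_snd[OF continuous_on_id]]) auto
  have c: "continuous_on A (\<lambda>z. snd z x)" for A :: "(real \<times> ('a \<Rightarrow> real)) set" and x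
    by (rule continuous_on_product_then_coordinatewise[OF continuous_on_snd[OF continuous_on_id]])
  show ?thesis
    unfolding case_prod_unfold
    apply (rule continuous_on_coordinatewise_then_product)
    subgoal for i
      apply (cases "i \<in> \<sigma>"; cases "i = v")
         apply (simp_all add: push_def)
         apply (intro continuous_intros c *)+
      done
    done
qed

text \<open>
  The deformation \<open>push\<close> stays inside the complex because a simplex containing
  \<open>\<sigma>\<close> may be enlarged by \<open>v\<close>. A point whose support does not
  contain \<open>\<sigma>\<close> has least coordinate 0 on \<open>\<sigma>\<close> and does not
  move.
\<close>

lemma homotopy_equivalent_delete_star:
  assumes K: "simplicial_complex K" and \<sigma>: "\<sigma> \<in> K" "v \<notin> \<sigma>"
    and cone: "\<And>\<tau>. \<tau> \<in> K \<Longrightarrow> \<sigma> \<subseteq> \<tau> \<Longrightarrow> insert v \<tau> \<in> K"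
  shows "realization K homotopy_equivalent_space realization (delete_star \<sigma> K)"
proof -
  let ?L = "delete_star \<sigma> K"
  have fin: "finite \<sigma>" "\<sigma> \<noteq> {}" using complexD(1,2)[OF K \<sigma>(1)] by auto
  note push = push_in_points[OF assms]
  have sub: "points ?L \<subseteq> points K" by (rule points_mono) (auto simp: delete_star_def)
  have cont: "continuous_on A (push \<sigma> v t)" for A t
  proof -
    have "continuous_on A ((\<lambda>(t, f). push \<sigma> v t f) \<circ> (\<lambda>f. (t, f)))"
      by (intro continuous_on_compose continuous_on_push fin continuous_intros)
    then show ?thesis by (simp add: o_def)
  qed
  have "homotopic_with_canon (\<lambda>_. True) (points K) (points K) id (push \<sigma> v 1)"
    unfolding homotopic_with_def
  proof (intro exI[of _ "\<lambda>(t, f). push \<sigma> v t f"] conjI ballI)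
    show "continuous_map (prod_topology (top_of_set {0..1}) (top_of_set (points K)))
        (top_of_set (points K)) (\<lambda>(t, f). push \<sigma> v t f)"
      using continuous_on_push[OF fin, of _ v] push(1)
      by (auto simp: prod_topology_subtopology_eu)
  qed (auto simp: push_def fun_eq_iff)
  then have "homotopic_with (\<lambda>_. True) (realization K) (realization K) (id \<circ> push \<sigma> v 1) id"
    by (simp add: realization_eq homotopic_with_sym)
  moreover have "homotopic_with (\<lambda>_. True) (realization ?L) (realization ?L) (push \<sigma> v 1 \<circ> id) id"
    unfolding realization_eq
    using push(3)[of _ 1] sub by (intro homotopic_with_id2) auto
  moreover have "continuous_map (realization K) (realization ?L) (push \<sigma> v 1)"
    using cont push(2)[of _ 1] by (auto simp: realization_eq)
  moreover have "continuous_map (realization ?L) (realization K) id"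
    using sub by (auto simp: realization_eq)
  ultimately show ?thesis
    unfolding homotopy_equivalent_space_def by blast
qed

text \<open>
  One step deletes the open star of a simplex whose link is a cone with apex \<open>v\<close>.
  Elementary collapses of free faces are the special case in which the link is a single vertex;
  larger steps keep the case analyses for the Cech complexes short.
\<close>

inductive collapses :: "'a set set \<Rightarrow> 'a set set \<Rightarrow> bool" for K where
  none: "collapses K K"
| delete: "collapses K L \<Longrightarrow> \<sigma> \<in> L \<Longrightarrow> v \<notin> \<sigma> \<Longrightarrow> (\<And>\<tau>. \<tau> \<in> L \<Longrightarrow> \<sigma> \<subseteq> \<tau> \<Longrightarrow> insert v \<tau> \<in> L) \<Longrightarrow>
    collapses K (delete_star \<sigma> L)"

lemma collapses_trans: "collapses L M \<Longrightarrow> collapses K L \<Longrightarrow> collapses K M"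
  by (induction rule: collapses.induct) (auto intro: collapses.intros)

lemma collapses_subset: "collapses K L \<Longrightarrow> L \<subseteq> K"
  by (induction rule: collapses.induct) (auto simp: delete_star_def)

lemma complex_collapses: "collapses K L \<Longrightarrow> simplicial_complex K \<Longrightarrow> simplicial_complex L"
  by (induction rule: collapses.induct) (auto simp: complex_delete_star)

lemma collapses_homotopy_equivalent:
  "collapses K L \<Longrightarrow> simplicial_complex K \<Longrightarrow> realization K homotopy_equivalent_space realization L"
proof (induction rule: collapses.induct)
  case none
  then show ?case by (simp add: homotopy_equivalent_space_refl)
next
  case (delete L \<sigma> v)
  then show ?case
    by (meson complex_collapses homotopy_equivalent_delete_star homotopy_eqv_trans)
qed

text \<open>
  The deleted stars may not meet \<open>A\<close>: whatever \<open>A\<close> shares with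
  \<open>K\<close> has to survive in \<open>L\<close>.
\<close>

lemma collapses_Un:
  assumes "collapses K L" "\<And>\<tau> \<rho>. \<tau> \<in> A \<Longrightarrow> \<rho> \<subseteq> \<tau> \<Longrightarrow> \<rho> \<in> K \<Longrightarrow> \<rho> \<in> L"
  shows "collapses (K \<union> A) (L \<union> A)"
  using assms
proof (induction rule: collapses.induct)
  case none
  then show ?case by (simp add: collapses.none)
next
  case (delete L \<sigma> v)
  have LK: "L \<subseteq> K" by (rule collapses_subset[OF delete.hyps(1)])
  have nA: "\<not> \<sigma> \<subseteq> \<tau>" if "\<tau> \<in> A" for \<tau>
    using delete.prems[OF that, of \<sigma>] LK delete.hyps by (auto simp: delete_star_def)
  have 1: "collapses (K \<union> A) (L \<union> A)"
    using delete.IH delete.prems by (auto simp: delete_star_def)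
  have "collapses (K \<union> A) (delete_star \<sigma> (L \<union> A))"
    by (rule collapses.delete[OF 1, of _ v]) (use delete nA in auto)
  moreover have "delete_star \<sigma> (L \<union> A) = delete_star \<sigma> L \<union> A"
    using nA by (auto simp: delete_star_def)
  ultimately show ?case by simp
qed

definition delete_stars :: "'a set set \<Rightarrow> 'a set set \<Rightarrow> 'a set set" where
  "delete_stars S K = {\<tau> \<in> K. \<forall>\<sigma>\<in>S. \<not> \<sigma> \<subseteq> \<tau>}"

text \<open>
  The stars are deleted one after the other. The last hypothesis preserves the apex condition:
  adding the apex of one simplex must not recreate the star of another one.
\<close>

lemma collapses_delete_stars:
  assumes "simplicial_complex K" "finite S"
    and "\<And>\<sigma>. \<sigma> \<in> S \<Longrightarrow> \<sigma> \<noteq> {} \<and> v \<sigma> \<notin> \<sigma>"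
    and "\<And>\<sigma> \<tau>. \<sigma> \<in> S \<Longrightarrow> \<tau> \<in> K \<Longrightarrow> \<sigma> \<subseteq> \<tau> \<Longrightarrow> insert (v \<sigma>) \<tau> \<in> K"
    and "\<And>\<sigma> \<sigma>' \<tau>. \<sigma> \<in> S \<Longrightarrow> \<sigma>' \<in> S \<Longrightarrow> \<tau> \<in> K \<Longrightarrow> \<sigma> \<subseteq> \<tau> \<Longrightarrow> \<sigma>' \<subseteq> insert (v \<sigma>) \<tau> \<Longrightarrow> \<sigma>' \<subseteq> \<tau>"
  shows "collapses K (delete_stars S K)"
proof -
  have "collapses K (delete_stars S' K)" if "S' \<subseteq> S" "finite S'" for S'
    using that(2,1)
  proof (induction rule: finite_induct)
    case empty
    then show ?case by (simp add: delete_stars_def collapses.none)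
  next
    case (insert \<sigma> S')
    let ?L = "delete_stars S' K"
    have eq: "delete_stars (insert \<sigma> S') K = delete_star \<sigma> ?L"
      by (auto simp: delete_stars_def delete_star_def)
    have 1: "collapses K ?L" using insert by auto
    show ?case
    proof (cases "\<sigma> \<in> ?L")
      case True
      show ?thesis unfolding eq
      proof (rule collapses.delete[OF 1 True])
        show "v \<sigma> \<notin> \<sigma>" using assms(3)[of \<sigma>] insert.prems by auto
        show "insert (v \<sigma>) \<tau> \<in> ?L" if "\<tau> \<in> ?L" "\<sigma> \<subseteq> \<tau>" for \<tau>
        proof -
          have \<tau>: "\<tau> \<in> K" "\<And>\<sigma>'. \<sigma>' \<in> S' \<Longrightarrow> \<not> \<sigma>' \<subseteq> \<tau>" and \<sigma>: "\<sigma> \<in> S"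
            using that(1) insert.prems by (auto simp: delete_stars_def)
          have "insert (v \<sigma>) \<tau> \<in> K" by (rule assms(4)[OF \<sigma> \<tau>(1) that(2)])
          moreover have "\<not> \<sigma>' \<subseteq> insert (v \<sigma>) \<tau>" if "\<sigma>' \<in> S'" for \<sigma>'
            using assms(5)[OF \<sigma> _ \<tau>(1) \<open>\<sigma> \<subseteq> \<tau>\<close>, of \<sigma>'] \<tau>(2)[OF that] that insert.prems by auto
          ultimately show ?thesis by (simp add: delete_stars_def)
        qed
      qed
    next
      case False
      have "\<not> \<sigma> \<subseteq> \<tau>" if "\<tau> \<in> ?L" for \<tau>
      proof
        assume "\<sigma> \<subseteq> \<tau>"
        moreover have "simplicial_complex ?L" by (rule complex_collapses[OF 1 assms(1)])
        moreover have "\<sigma> \<noteq> {}" using assms(3)[of \<sigma>] insert.prems by auto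
        ultimately show False using False complexD(3) that \<open>\<sigma> \<subseteq> \<tau>\<close> by metis
      qed
      then have "delete_star \<sigma> ?L = ?L" by (auto simp: delete_star_def)
      then show ?thesis using 1 eq by simp
    qed
  qed
  then show ?thesis using assms(2) by blast
qed

definition cone :: "'a \<Rightarrow> 'a set set \<Rightarrow> 'a set set" where
  "cone w D = insert {w} (D \<union> insert w ` D)"

lemma complex_cone:
  assumes "simplicial_complex D"
  shows "simplicial_complex (cone w D)"
proof (rule complexI)
  fix \<tau> \<rho> assume \<tau>: "\<tau> \<in> cone w D" and \<rho>: "\<rho> \<noteq> {}" "\<rho> \<subseteq> \<tau>"
  have *: "\<rho>' \<in> D \<or> \<rho>' = {}" if "\<rho>' \<subseteq> \<tau>'" "\<tau>' \<in> D" for \<rho>' \<tau>'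
    using complexD(3)[OF assms that(2)] that by blast
  from \<tau> consider "\<tau> = {w}" | "\<tau> \<in> D" | \<tau>' where "\<tau>' \<in> D" "\<tau> = insert w \<tau>'"
    by (auto simp: cone_def)
  then show "\<rho> \<in> cone w D"
  proof cases
    case 1
    then have "\<rho> = {w}" using \<rho> by auto
    then show ?thesis by (simp add: cone_def)
  next
    case 2
    then show ?thesis using * \<rho> by (auto simp: cone_def)
  next
    case 3
    then have "\<rho> - {w} \<in> D \<or> \<rho> - {w} = {}" using *[of "\<rho> - {w}" \<tau>'] \<rho> by blast
    moreover have "\<rho> = insert w (\<rho> - {w}) \<or> \<rho> = \<rho> - {w}" by auto
    ultimately show ?thesis using \<rho>(1) unfolding cone_def
      by (metis UnCI imageI insertCI)
  qed
qed (use complex_finite[OF assms] complexD(1,2)[OF assms] in \<open>auto simp: cone_def\<close>)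

text \<open>
  An apex for the link of \<open>\<sigma>\<close> in \<open>D\<close> is an apex for the link of
  \<open>insert w \<sigma>\<close> in the cone. Only simplices containing \<open>w\<close> are
  deleted, so the base \<open>D\<close> remains and may be part of a larger complex.
\<close>

lemma collapses_cone:
  assumes "collapses D D'" "simplicial_complex D" "\<And>\<tau>. \<tau> \<in> D \<Longrightarrow> w \<notin> \<tau>" 
  shows "collapses (cone w D) (cone w D' \<union> D)"
  using assms(1)
proof (induction rule: collapses.induct)
  case none
  have "cone w D \<union> D = cone w D" by (auto simp: cone_def)
  then show ?case by (simp add: collapses.none)
next
  case (delete L \<sigma> v)
  have LD: "L \<subseteq> D" by (rule collapses_subset[OF delete.hyps(1)])
  have nw: "w \<notin> \<sigma>" "\<sigma> \<in> D" using assms delete LD by auto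
  have ne: "\<sigma> \<noteq> {}" using nw complexD(2)[OF assms(2)] by blast
  have nD: "\<not> insert w \<sigma> \<subseteq> \<tau>" if "\<tau> \<in> D" for \<tau> using assms(3) that by blast
  have "collapses (cone w D) (delete_star (insert w \<sigma>) (cone w L \<union> D))"
  proof (rule collapses.delete[OF delete.IH])
    show "insert w \<sigma> \<in> cone w L \<union> D" using delete by (auto simp: cone_def)
    have "insert v \<sigma> \<in> L" using delete by auto
    then have "v \<noteq> w" using assms LD by blast
    then show "v \<notin> insert w \<sigma>" using delete by auto
    show "insert v \<tau> \<in> cone w L \<union> D" if \<tau>: "\<tau> \<in> cone w L \<union> D" "insert w \<sigma> \<subseteq> \<tau>" for \<tau>
    proof -
      have "\<tau> \<notin> D" "\<tau> \<notin> L" using \<tau> nD LD by auto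
      moreover have "\<tau> \<noteq> {w}" using \<tau>(2) nw ne by auto
      ultimately obtain \<tau>' where 2: "\<tau>' \<in> L" "\<tau> = insert w \<tau>'" using \<tau> by (auto simp: cone_def)
      then have "\<sigma> \<subseteq> \<tau>'" using \<tau> nw by auto
      then have "insert v \<tau>' \<in> L" using delete 2 by auto
      then have "insert w (insert v \<tau>') \<in> cone w L" by (auto simp: cone_def)
      then show ?thesis using 2 by (simp add: insert_commute)
    qed
  qed
  moreover have "delete_star (insert w \<sigma>) (cone w L \<union> D) = cone w (delete_star \<sigma> L) \<union> D"
  proof (intro set_eqI iffI)
    fix \<tau> assume \<tau>: "\<tau> \<in> delete_star (insert w \<sigma>) (cone w L \<union> D)"
    show "\<tau> \<in> cone w (delete_star \<sigma> L) \<union> D"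
    proof (cases "\<tau> \<in> D \<or> \<tau> = {w}")
      case False
      then obtain \<tau>' where "\<tau>' \<in> L" "\<tau> = insert w \<tau>'" using \<tau> LD by (auto simp: cone_def delete_star_def)
      then show ?thesis using \<tau> by (auto simp: cone_def delete_star_def)
    qed (auto simp: cone_def)
  next
    fix \<tau> assume \<tau>: "\<tau> \<in> cone w (delete_star \<sigma> L) \<union> D"
    show "\<tau> \<in> delete_star (insert w \<sigma>) (cone w L \<union> D)"
    proof (cases "\<tau> \<in> D \<or> \<tau> = {w}")
      case True
      then show ?thesis using nD ne nw by (auto simp: cone_def delete_star_def)
    next
      case False
      then obtain \<tau>' where "\<tau>' \<in> L" "\<tau> = insert w \<tau>'" "\<not> \<sigma> \<subseteq> \<tau>'" using \<tau> LD by (auto simp: cone_def delete_star_def)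
      then show ?thesis using nw by (auto simp: cone_def delete_star_def)
    qed
  qed
  ultimately show ?case by simp
qed

text \<open>
  Only the members of \<open>S\<close> that are simplices of \<open>K\<close> matter, and there are
  finitely many of them.
\<close>

lemma collapses_delete_stars_ex:
  assumes K: "simplicial_complex K" and ne: "\<And>\<sigma>. \<sigma> \<in> S \<Longrightarrow> \<sigma> \<noteq> {}"
    and apex: "\<And>\<sigma>. \<sigma> \<in> S \<Longrightarrow> \<exists>v. v \<notin> \<sigma> \<and>
      (\<forall>\<tau>\<in>K. \<sigma> \<subseteq> \<tau> \<longrightarrow> insert v \<tau> \<in> K \<and> (\<forall>\<sigma>'\<in>S. \<sigma>' \<subseteq> insert v \<tau> \<longrightarrow> \<sigma>' \<subseteq> \<tau>))"
  shows "collapses K (delete_stars S K)"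
proof -
  obtain v where v: "\<And>\<sigma>. \<sigma> \<in> S \<Longrightarrow> v \<sigma> \<notin> \<sigma> \<and>
      (\<forall>\<tau>\<in>K. \<sigma> \<subseteq> \<tau> \<longrightarrow> insert (v \<sigma>) \<tau> \<in> K \<and> (\<forall>\<sigma>'\<in>S. \<sigma>' \<subseteq> insert (v \<sigma>) \<tau> \<longrightarrow> \<sigma>' \<subseteq> \<tau>))"
    using apex by metis
  have "collapses K (delete_stars (S \<inter> K) K)"
    by (rule collapses_delete_stars[OF K, where v = v]) (use complex_finite[OF K] ne v in blast)+
  moreover have "delete_stars (S \<inter> K) K = delete_stars S K"
  proof -
    have "\<sigma> \<in> K" if "\<sigma> \<in> S" "\<sigma> \<subseteq> \<tau>" "\<tau> \<in> K" for \<sigma> \<tau>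
      using complexD(3)[OF K that(3) ne[OF that(1)] that(2)] .
    then show ?thesis unfolding delete_stars_def by blast
  qed
  ultimately show ?thesis by simp
qed

lemma collapses_to_apex:
  assumes K: "simplicial_complex K" and "{v} \<in> K" "\<And>\<tau>. \<tau> \<in> K \<Longrightarrow> insert v \<tau> \<in> K"
  shows "collapses K {{v}}"
proof -
  let ?S = "{{u} | u. u \<noteq> v}"
  have "collapses K (delete_stars ?S K)"
    by (rule collapses_delete_stars_ex[OF K]) (use assms(3) in \<open>auto intro!: exI[of _ v]\<close>)
  moreover have "delete_stars ?S K = {{v}}"
  proof (intro set_eqI iffI)
    fix \<tau> assume "\<tau> \<in> delete_stars ?S K"
    then have "\<tau> \<in> K" "\<tau> \<subseteq> {v}" by (auto simp: delete_stars_def)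
    then show "\<tau> \<in> {{v}}" using complexD(2)[OF K] by blast
  qed (use assms(2) in \<open>auto simp: delete_stars_def\<close>)
  ultimately show ?thesis by simp
qed

lemma complex_delete_stars: "simplicial_complex K \<Longrightarrow> simplicial_complex (delete_stars S K)"
  unfolding simplicial_complex_def delete_stars_def by (simp, meson subset_trans)

section \<open>Attaching cones along homotopic maps\<close>

lemma homotopicI:
  fixes h :: "real \<times> 'a::topological_space \<Rightarrow> 'b::topological_space"
  assumes "continuous_on ({0..1} \<times> S) h"
    and "\<And>t x. 0 \<le> t \<Longrightarrow> t \<le> 1 \<Longrightarrow> x \<in> S \<Longrightarrow> h (t, x) \<in> T"
    and "\<And>x. x \<in> S \<Longrightarrow> h (0, x) = f x" "\<And>x. x \<in> S \<Longrightarrow> h (1, x) = g x"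
  shows "homotopic_with_canon (\<lambda>_. True) S T f g"
proof -
  have "continuous_map (prod_topology (top_of_set {0..1}) (top_of_set S)) (top_of_set T) h"
    using assms(1,2) by (auto simp: prod_topology_subtopology_eu)
  then show ?thesis
    unfolding homotopic_with[where P = "\<lambda>_. True", OF refl]
    by (intro exI[of _ h]) (simp add: assms(3,4))
qed

lemma homotopicE:
  assumes "homotopic_with_canon (\<lambda>_. True) S T f g"
  obtains h where "continuous_on ({0..1} \<times> S) h"
    "\<And>t x. 0 \<le> t \<Longrightarrow> t \<le> 1 \<Longrightarrow> x \<in> S \<Longrightarrow> h (t, x) \<in> T"
    "\<And>x. h (0::real, x) = f x" "\<And>x. h (1, x) = g x"
proof -
  from assms obtain h where h: "continuous_map (prod_topology (top_of_set {0..1::real}) (top_of_set S)) (top_of_set T) h"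
    "\<forall>x. h (0, x) = f x" "\<forall>x. h (1, x) = g x"
    by (auto simp: homotopic_with_def)
  then have "continuous_on ({0..1} \<times> S) h" "h \<in> {0..1} \<times> S \<rightarrow> T"
    by (auto simp: prod_topology_subtopology_eu)
  with h that show thesis by (metis atLeastAtMost_iff SigmaI PiE)
qed

text \<open>
  Images of compact sets are closed, so preimages of closed sets can be computed on the two pieces.
\<close>

lemma continuous_on_compact_cover:
  fixes f :: "'b::t2_space \<Rightarrow> 'c::topological_space"
  assumes "compact P" "continuous_on P h" "compact Q" "continuous_on Q k"
    and "continuous_on P (\<lambda>x. f (h x))" "continuous_on Q (\<lambda>x. f (k x))"
  shows "continuous_on (h ` P \<union> k ` Q) f"
proof -
  have "closed (f -` C \<inter> (h ` P \<union> k ` Q))" if "closed C" for C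
  proof -
    have "closedin (top_of_set P) (P \<inter> (\<lambda>x. f (h x)) -` C)" "closedin (top_of_set Q) (Q \<inter> (\<lambda>x. f (k x)) -` C)"
      using that assms by (auto intro: continuous_closedin_preimage)
    then have "compact (P \<inter> (\<lambda>x. f (h x)) -` C)" "compact (Q \<inter> (\<lambda>x. f (k x)) -` C)"
      using assms closedin_compact by blast+
    then have "compact (h ` (P \<inter> (\<lambda>x. f (h x)) -` C) \<union> k ` (Q \<inter> (\<lambda>x. f (k x)) -` C))"
      using assms by (auto intro!: compact_Un compact_continuous_image intro: continuous_on_subset)
    moreover have "h ` (P \<inter> (\<lambda>x. f (h x)) -` C) \<union> k ` (Q \<inter> (\<lambda>x. f (k x)) -` C) = f -` C \<inter> (h ` P \<union> k ` Q)"
      by auto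
    ultimately show ?thesis by (metis compact_imp_closed)
  qed
  moreover have "closed (h ` P \<union> k ` Q)"
    using assms by (intro closed_Un compact_imp_closed compact_continuous_image)
  ultimately show ?thesis
    by (subst continuous_on_closed_vimage) auto
qed

text \<open>
  The cone over \<open>S\<close> is attached to \<open>X\<close> along \<open>s \<mapsto> q (s,
  0)\<close>; its cone point is \<open>q (s, 1)\<close>. Working inside a given Hausdorff space
  avoids quotient topologies.
\<close>

definition cone_attached :: "'b::t2_space set \<Rightarrow> 'a::t2_space set \<Rightarrow> ('a \<times> real \<Rightarrow> 'b) \<Rightarrow> bool" where
  "cone_attached X S q \<longleftrightarrow> compact X \<and> compact S \<and> continuous_on (S \<times> {0..1}) q \<and>
     (\<forall>s\<in>S. \<forall>t\<in>{0..1}. q (s, t) \<in> X \<longleftrightarrow> t = 0) \<and>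
     (\<forall>s\<in>S. \<forall>s'\<in>S. \<forall>t\<in>{0<..1}. \<forall>t'\<in>{0<..1}. q (s, t) = q (s', t') \<longleftrightarrow> t = t' \<and> (t = 1 \<or> s = s'))"

text \<open>
  The choice of a preimage is harmless when \<open>\<phi>\<close> takes a single value on the top of
  the cylinder and extends \<open>f\<close> at its bottom.
\<close>

definition glue :: "'b set \<Rightarrow> 'a set \<Rightarrow> ('a \<times> real \<Rightarrow> 'b) \<Rightarrow> ('b \<Rightarrow> 'c) \<Rightarrow> ('a \<times> real \<Rightarrow> 'c) \<Rightarrow> 'b \<Rightarrow> 'c" where
  "glue X S q f \<phi> x = (if x \<in> X then f x else \<phi> (SOME p. p \<in> S \<times> {0..1} \<and> q p = x))"

lemma glue_base: "x \<in> X \<Longrightarrow> glue X S q f \<phi> x = f x"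
  by (simp add: glue_def)

lemma glue_cone:
  assumes "cone_attached X S q" "s \<in> S" "0 \<le> t" "t \<le> 1"
    and "\<And>s. s \<in> S \<Longrightarrow> \<phi> (s, 0) = f (q (s, 0))" "\<And>s s'. s \<in> S \<Longrightarrow> s' \<in> S \<Longrightarrow> \<phi> (s, 1) = \<phi> (s', 1)"
  shows "glue X S q f \<phi> (q (s, t)) = \<phi> (s, t)"
proof (cases "t = 0")
  case True
  then show ?thesis using assms by (auto simp: glue_def cone_attached_def)
next
  case False
  let ?p = "SOME p. p \<in> S \<times> {0..1} \<and> q p = q (s, t)"
  have nX: "q (s, t) \<notin> X" using assms False by (auto simp: cone_attached_def)
  have "?p \<in> S \<times> {0..1} \<and> q ?p = q (s, t)"
    by (rule someI[of _ "(s, t)"]) (use assms in auto)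
  moreover obtain s' t' where p: "?p = (s', t')" by (cases ?p)
  ultimately have st: "s' \<in> S" "0 \<le> t'" "t' \<le> 1" "q (s', t') = q (s, t)" by auto
  moreover have "q (s', 0) \<in> X" using st(1) assms(1) by (simp add: cone_attached_def)
  ultimately have "t' \<noteq> 0" using nX by metis
  then have "t' = t \<and> (t = 1 \<or> s = s')" using st assms False unfolding cone_attached_def
    by (metis greaterThanAtMost_iff order_le_less)
  then have "\<phi> (s', t') = \<phi> (s, t)" using assms(6)[OF st(1) assms(2)] by auto
  then show ?thesis using nX p by (simp add: glue_def)
qed

lemma continuous_on_glue:
  fixes U :: "'d::t2_space set"
  assumes q: "cone_attached X S q" and "compact U"
    and F: "continuous_on (U \<times> X) F" and \<Phi>: "continuous_on (U \<times> (S \<times> {0..1})) \<Phi>"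
    and "\<And>u s. u \<in> U \<Longrightarrow> s \<in> S \<Longrightarrow> \<Phi> (u, (s, 0)) = F (u, q (s, 0))"
    and "\<And>u s s'. u \<in> U \<Longrightarrow> s \<in> S \<Longrightarrow> s' \<in> S \<Longrightarrow> \<Phi> (u, (s, 1)) = \<Phi> (u, (s', 1))"
  shows "continuous_on (U \<times> (X \<union> q ` (S \<times> {0..1})))
           (\<lambda>(u, x). glue X S q (\<lambda>x. F (u, x)) (\<lambda>p. \<Phi> (u, p)) x)"
proof -
  have comp: "compact X" "compact S" "continuous_on (S \<times> {0..1}) q"
    using q by (auto simp: cone_attached_def)
  have eq: "U \<times> (X \<union> q ` (S \<times> {0..1})) =
      id ` (U \<times> X) \<union> (\<lambda>(u, p). (u, q p)) ` (U \<times> (S \<times> {0..1}))"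
    by force
  show ?thesis unfolding eq
  proof (rule continuous_on_compact_cover)
    show "compact (U \<times> X)" "compact (U \<times> (S \<times> {0..1::real}))"
      using comp assms by (auto intro!: compact_Times)
    show "continuous_on (U \<times> (S \<times> {0..1})) (\<lambda>(u, p). (u, q p))"
      unfolding case_prod_unfold
      by (intro continuous_intros continuous_on_compose2[OF comp(3)]) auto
    show "continuous_on (U \<times> X) (\<lambda>x. case id x of (u, x) \<Rightarrow> glue X S q (\<lambda>x. F (u, x)) (\<lambda>p. \<Phi> (u, p)) x)"
      using F by (rule continuous_on_eq) (auto simp: glue_base)
    show "continuous_on (U \<times> (S \<times> {0..1}))
      (\<lambda>x. case case x of (u, p) \<Rightarrow> (u, q p) of (u, x) \<Rightarrow> glue X S q (\<lambda>x. F (u, x)) (\<lambda>p. \<Phi> (u, p)) x)"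
      using \<Phi>
    proof (rule continuous_on_eq)
      fix z assume z: "z \<in> U \<times> (S \<times> {0..1::real})"
      then obtain u s t where z: "z = (u, (s, t))" "u \<in> U" "s \<in> S" "0 \<le> t" "t \<le> 1" by auto
      then show "\<Phi> z = (case case z of (u, p) \<Rightarrow> (u, q p) of (u, x) \<Rightarrow> glue X S q (\<lambda>x. F (u, x)) (\<lambda>p. \<Phi> (u, p)) x)"
        using glue_cone[OF q \<open>s \<in> S\<close> \<open>0 \<le> t\<close> \<open>t \<le> 1\<close>, of "\<lambda>p. \<Phi> (u, p)" "\<lambda>x. F (u, x)",
            OF assms(5)[OF \<open>u \<in> U\<close>] assms(6)[OF \<open>u \<in> U\<close>]] by simp
    qed
  qed simp
qed

lemma continuous_on_glue0:
  assumes q: "cone_attached X S q"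
    and F: "continuous_on X F" and \<Phi>: "continuous_on (S \<times> {0..1}) \<Phi>"
    and "\<And>s. s \<in> S \<Longrightarrow> \<Phi> (s, 0) = F (q (s, 0))"
    and "\<And>s s'. s \<in> S \<Longrightarrow> s' \<in> S \<Longrightarrow> \<Phi> (s, 1) = \<Phi> (s', 1)"
  shows "continuous_on (X \<union> q ` (S \<times> {0..1})) (glue X S q F \<Phi>)"
proof -
  have "continuous_on ({0::real} \<times> (X \<union> q ` (S \<times> {0..1})))
      (\<lambda>(u, x). glue X S q (\<lambda>x. (F \<circ> snd) (u, x)) (\<lambda>p. (\<Phi> \<circ> snd) (u, p)) x)"
  proof (rule continuous_on_glue[OF q])
    show "continuous_on ({0::real} \<times> X) (F \<circ> snd)"
      by (intro continuous_on_compose continuous_intros continuous_on_subset[OF F]) auto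
    show "continuous_on ({0::real} \<times> (S \<times> {0..1})) (\<Phi> \<circ> snd)"
      by (intro continuous_on_compose continuous_intros continuous_on_subset[OF \<Phi>]) auto
    show "(\<Phi> \<circ> snd) (u, s, 1) = (\<Phi> \<circ> snd) (u, s', 1)" if "s \<in> S" "s' \<in> S" for u :: real and s s'
      using assms(5)[OF that] by simp
  qed (use assms(4) in auto)
  then have c: "continuous_on ({0::real} \<times> (X \<union> q ` (S \<times> {0..1}))) (\<lambda>z. glue X S q F \<Phi> (snd z))"
    by (simp add: o_def case_prod_unfold)
  have "continuous_on (X \<union> q ` (S \<times> {0..1})) (\<lambda>x. glue X S q F \<Phi> (snd (0::real, x)))"
    by (rule continuous_on_compose2[OF c]) (auto intro!: continuous_on_Pair continuous_on_const continuous_on_id)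
  then show ?thesis by simp
qed

text \<open>
  The path belonging to \<open>s\<close>: from \<open>-1\<close> to \<open>0\<close> it runs
  backwards through the homotopy \<open>G\<close>, from \<open>0\<close> to \<open>1\<close> up the
  cone.
\<close>

definition track :: "('a \<times> real \<Rightarrow> 'b) \<Rightarrow> ('a \<times> real \<Rightarrow> 'b) \<Rightarrow> 'a \<times> real \<Rightarrow> 'b" where
  "track G q p = (if snd p \<le> 0 then G (fst p, - snd p) else q p)"

lemma continuous_on_track:
  assumes "continuous_on (S \<times> {0..1}) G" "continuous_on (S \<times> {0..1}) q"
    and "\<And>s. s \<in> S \<Longrightarrow> G (s, 0) = q (s, 0)"
  shows "continuous_on (S \<times> {-1..1}) (track G q)"
proof -
  have eq: "S \<times> {-1..1} = S \<times> {-1..0} \<union> S \<times> {0..1::real}" by auto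
  have "continuous_on (S \<times> {-1..0} \<union> S \<times> {0..1}) (\<lambda>p. if snd p \<le> 0 then G (fst p, - snd p) else q p)"
  proof (rule continuous_on_cases_local)
    have "S \<times> {-1..0} = (S \<times> {-1..1::real}) \<inter> UNIV \<times> {..0}" "S \<times> {0..1} = (S \<times> {-1..1::real}) \<inter> UNIV \<times> {0..}"
      by auto
    then show "closedin (top_of_set (S \<times> {-1..0} \<union> S \<times> {0..1::real})) (S \<times> {-1..0})"
      "closedin (top_of_set (S \<times> {-1..0} \<union> S \<times> {0..1::real})) (S \<times> {0..1})"
      unfolding eq[symmetric] by (auto intro!: closedin_closed_Int closed_Times)
    show "continuous_on (S \<times> {-1..0}) (\<lambda>p. G (fst p, - snd p))"
      by (rule continuous_on_compose2[OF assms(1)]) (auto intro!: continuous_intros)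
  qed (use assms in auto)
  then show ?thesis unfolding eq track_def .
qed

text \<open>
  Two cones over the same space, attached to \<open>X\<close> along maps that are homotopic through
  \<open>G\<close>.
\<close>

locale two_attachments =
  fixes X :: "'b::t2_space set" and S :: "'a::t2_space set" and q1 q2 G :: "'a \<times> real \<Rightarrow> 'b"
  assumes q1: "cone_attached X S q1" and q2: "cone_attached X S q2"
    and G: "continuous_on (S \<times> {0..1}) G" "\<And>s t. s \<in> S \<Longrightarrow> 0 \<le> t \<Longrightarrow> t \<le> 1 \<Longrightarrow> G (s, t) \<in> X"
      "\<And>s. s \<in> S \<Longrightarrow> G (s, 0) = q1 (s, 0)" "\<And>s. s \<in> S \<Longrightarrow> G (s, 1) = q2 (s, 0)"
begin

abbreviation "Y1 \<equiv> X \<union> q1 ` (S \<times> {0..1})"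
abbreviation "Y2 \<equiv> X \<union> q2 ` (S \<times> {0..1})"
definition "T1 = track G q1"
definition "T2 = track (\<lambda>p. G (fst p, 1 - snd p)) q2"
definition "going = glue X S q1 id (\<lambda>p. T2 (fst p, 2 * snd p - 1))"
definition "returning = glue X S q2 id (\<lambda>p. T1 (fst p, 2 * snd p - 1))"

lemma cone1: "q1 (s, 1) = q1 (s', 1)" "q2 (s, 1) = q2 (s', 1)" if "s \<in> S" "s' \<in> S"
  using q1 q2 that by (auto simp: cone_attached_def)

lemma cont12: "continuous_on (S \<times> {0..1}) q1" "continuous_on (S \<times> {0..1}) q2"
  using q1 q2 by (auto simp: cone_attached_def)

lemma cont_T1: "continuous_on (S \<times> {-1..1}) T1"
  unfolding T1_def using cont12 G by (intro continuous_on_track) auto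

lemma cont_T2: "continuous_on (S \<times> {-1..1}) T2"
  unfolding T2_def using cont12 G
  by (intro continuous_on_track continuous_on_compose2[OF G(1)]) (auto intro!: continuous_intros)

lemma T1_in: "T1 (s, r) \<in> Y1" if "s \<in> S" "-1 \<le> r" "r \<le> 1"
  using that G(2)[OF that(1), of "-r"] by (cases "r \<le> 0") (simp_all add: T1_def track_def)

lemma T2_in: "T2 (s, r) \<in> Y2" if "s \<in> S" "-1 \<le> r" "r \<le> 1"
  using that G(2)[OF that(1), of "1+r"] by (cases "r \<le> 0") (simp_all add: T2_def track_def)

lemma T_ends: "T1 (s, 1) = q1 (s, 1)" "T2 (s, 1) = q2 (s, 1)" "T1 (s, -1) = G (s, 1)" "T2 (s, -1) = G (s, 0)"
  by (auto simp: T1_def T2_def track_def)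

lemma going_base: "x \<in> X \<Longrightarrow> going x = x" and returning_base: "x \<in> X \<Longrightarrow> returning x = x"
  by (auto simp: going_def returning_def glue_base)

lemma going_cone: "going (q1 (s, t)) = T2 (s, 2 * t - 1)" if "s \<in> S" "0 \<le> t" "t \<le> 1"
  unfolding going_def
proof (subst glue_cone[OF q1 that])
  show "T2 (fst (s, 1), 2 * snd (s, 1) - 1) = T2 (fst (s', 1), 2 * snd (s', 1) - 1)"
    if "s \<in> S" "s' \<in> S" for s s' using cone1(2)[OF that] by (simp add: T_ends)
qed (use G(3) in \<open>simp_all add: T_ends\<close>)

lemma returning_cone: "returning (q2 (s, t)) = T1 (s, 2 * t - 1)" if "s \<in> S" "0 \<le> t" "t \<le> 1"
  unfolding returning_def
proof (subst glue_cone[OF q2 that])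
  show "T1 (fst (s, 1), 2 * snd (s, 1) - 1) = T1 (fst (s', 1), 2 * snd (s', 1) - 1)"
    if "s \<in> S" "s' \<in> S" for s s' using cone1(1)[OF that] by (simp add: T_ends)
qed (use G(4) in \<open>simp_all add: T_ends\<close>)

lemma going_map: "continuous_on Y1 going" "going ` Y1 \<subseteq> Y2"
proof -
  show "continuous_on Y1 going"
    unfolding going_def
  proof (rule continuous_on_glue0[OF q1])
    show "continuous_on (S \<times> {0..1}) (\<lambda>p. T2 (fst p, 2 * snd p - 1))"
      by (rule continuous_on_compose2[OF cont_T2]) (auto intro!: continuous_intros)
    show "T2 (fst (s, 1), 2 * snd (s, 1) - 1) = T2 (fst (s', 1), 2 * snd (s', 1) - 1)"
      if "s \<in> S" "s' \<in> S" for s s' using cone1(2)[OF that] by (simp add: T_ends)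
  qed (use G(3) in \<open>simp_all add: T_ends\<close>)
  show "going ` Y1 \<subseteq> Y2"
    proof
    fix y assume "y \<in> going ` Y1"
    then consider x where "x \<in> X" "y = going x" | s t where "s \<in> S" "0 \<le> t" "t \<le> 1" "y = going (q1 (s, t))" by auto
    then show "y \<in> Y2"
    proof cases
      case 2
      then show ?thesis using T2_in[of s "2 * t - 1"] by (simp add: going_cone)
    qed (simp add: going_base)
  qed
qed

lemma returning_map: "continuous_on Y2 returning" "returning ` Y2 \<subseteq> Y1"
proof -
  show "continuous_on Y2 returning"
    unfolding returning_def
  proof (rule continuous_on_glue0[OF q2])
    show "continuous_on (S \<times> {0..1}) (\<lambda>p. T1 (fst p, 2 * snd p - 1))"
      by (rule continuous_on_compose2[OF cont_T1]) (auto intro!: continuous_intros)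
    show "T1 (fst (s, 1), 2 * snd (s, 1) - 1) = T1 (fst (s', 1), 2 * snd (s', 1) - 1)"
      if "s \<in> S" "s' \<in> S" for s s' using cone1(1)[OF that] by (simp add: T_ends)
  qed (use G(4) in \<open>simp_all add: T_ends\<close>)
  show "returning ` Y2 \<subseteq> Y1"
  proof
    fix y assume "y \<in> returning ` Y2"
    then consider x where "x \<in> X" "y = returning x" | s t where "s \<in> S" "0 \<le> t" "t \<le> 1" "y = returning (q2 (s, t))" by auto
    then show "y \<in> Y1"
    proof cases
      case 2
      then show ?thesis using T1_in[of s "2 * t - 1"] by (simp add: returning_cone)
    qed (simp add: returning_base)
  qed
qed

text \<open>
  Going there and back traverses the path of \<open>s\<close> in this parametrization: down through
  \<open>G\<close>, back again, and then up the cone. It agrees with the identity at 0 and 1.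
\<close>

definition "bend t = (if t \<le> 1/2 then - 2 * t else 4 * t - 3 :: real)"

text \<open>
  The parameter \<open>bend t\<close> is moved to \<open>t\<close> along a straight line. At
  \<open>t = 0\<close> and \<open>t = 1\<close> nothing moves, so the homotopy is constant on
  \<open>X\<close> and well defined at the cone point.
\<close>

lemma returning_going: "homotopic_with_canon (\<lambda>_. True) Y1 Y1 (returning \<circ> going) id"
proof -
  have bend: "-1 \<le> bend t" "bend t \<le> 1" if "0 \<le> t" "t \<le> 1" for t
    using that by (auto simp: bend_def)
  have bt: "returning (going (q1 (s, t))) = T1 (s, bend t)" if "s \<in> S" "0 \<le> t" "t \<le> 1" for s t
  proof (cases "t \<le> 1/2")
    case True
    have "returning (going (q1 (s, t))) = returning (G (s, 2 * t))"
      using going_cone[OF that] True by (simp add: T2_def track_def)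
    also have "\<dots> = G (s, 2 * t)" using G(2)[of s "2 * t"] True that by (intro returning_base) auto
    finally show ?thesis using True that by (simp add: T1_def track_def bend_def)
  next
    case False
    have "returning (going (q1 (s, t))) = returning (q2 (s, 2 * t - 1))"
      using going_cone[OF that] False by (simp add: T2_def track_def)
    also have "\<dots> = T1 (s, 2 * (2 * t - 1) - 1)" using False that by (intro returning_cone) auto
    finally show ?thesis using False by (simp add: bend_def algebra_simps)
  qed
  define \<Phi> where "\<Phi> = (\<lambda>(u, (s, t)). T1 (s, (1 - u) * bend t + u * t))"
  define h where "h = (\<lambda>(u::real, x). glue X S q1 (\<lambda>x. snd (u, x)) (\<lambda>p. \<Phi> (u, p)) x)"
  have range: "-1 \<le> (1 - u) * bend t + u * t" "(1 - u) * bend t + u * t \<le> 1"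
    if "0 \<le> u" "u \<le> 1" "0 \<le> t" "t \<le> 1" for u t
  proof -
    have "(1 - u) * (-1) + u * (-1) \<le> (1 - u) * bend t + u * t"
      using that bend by (intro add_mono mult_left_mono) auto
    then show "-1 \<le> (1 - u) * bend t + u * t" by simp
    have "(1 - u) * bend t + u * t \<le> (1 - u) * 1 + u * 1"
      using that bend by (intro add_mono mult_left_mono) auto
    then show "(1 - u) * bend t + u * t \<le> 1" by simp
  qed
  have c0: "\<Phi> (u, (s, 0)) = q1 (s, 0)" if "s \<in> S" for u s
    using G(3)[OF that] by (simp add: \<Phi>_def bend_def T1_def track_def)
  have c1: "\<Phi> (u, (s, 1)) = q1 (s, 1)" for u s
    by (simp add: \<Phi>_def bend_def T_ends)
  have h_base: "h (u, x) = x" if "x \<in> X" for u x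
    using that by (simp add: h_def glue_base)
  have h_cone: "h (u, q1 (s, t)) = T1 (s, (1 - u) * bend t + u * t)" if "s \<in> S" "0 \<le> t" "t \<le> 1" for u s t
    unfolding h_def case_prod_conv
  proof (subst glue_cone[OF q1 that])
    show "\<Phi> (u, s, 1) = \<Phi> (u, s', 1)" if "s \<in> S" "s' \<in> S" for s s'
      using cone1(1)[OF that] by (simp add: c1)
  qed (simp_all add: c0, simp add: \<Phi>_def)
  have cont_bend: "continuous_on UNIV bend"
    unfolding bend_def by (rule continuous_on_cases_le) (auto intro!: continuous_intros)
  have "continuous_on ({0..1} \<times> (S \<times> {0..1})) \<Phi>"
    unfolding \<Phi>_def case_prod_unfold
    by (rule continuous_on_compose2[OF cont_T1])
      (auto intro!: continuous_intros continuous_on_compose2[OF cont_bend] simp: range)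
  then have ch: "continuous_on ({0..1} \<times> Y1) h"
    unfolding h_def
  proof (intro continuous_on_glue[OF q1])
    show "\<Phi> (u, s, 1) = \<Phi> (u, s', 1)" if "s \<in> S" "s' \<in> S" for u s s'
      using cone1(1)[OF that] by (simp add: c1)
  qed (auto intro!: continuous_intros simp: c0)
  show ?thesis
  proof (rule homotopicI[OF ch])
    fix u :: real and x assume u: "0 \<le> u" "u \<le> 1" "x \<in> Y1"
    then consider "x \<in> X" | s t where "s \<in> S" "0 \<le> t" "t \<le> 1" "x = q1 (s, t)" by auto
    then show "h (u, x) \<in> Y1"
      by cases (use h_base h_cone T1_in range u in auto)
  next
    fix x assume "x \<in> Y1"
    then consider "x \<in> X" | s t where "s \<in> S" "0 \<le> t" "t \<le> 1" "x = q1 (s, t)" by auto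
    then show "h (0, x) = (returning \<circ> going) x"
      by cases (use h_base h_cone bt going_base returning_base in auto)
  next
    fix x assume "x \<in> Y1"
    then consider "x \<in> X" | s t where "s \<in> S" "0 \<le> t" "t \<le> 1" "x = q1 (s, t)" by auto
    then show "h (1, x) = id x"
      by cases (use h_base h_cone G(3) in \<open>auto simp: T1_def track_def\<close>)
  qed
qed

end

text \<open>
  Reversing \<open>G\<close> exchanges the two attachments, so the other composite needs no separate
  argument.
\<close>

lemma homotopy_equivalent_attachments:
  fixes S :: "'a::t2_space set" and G :: "'a \<times> real \<Rightarrow> 'b::t2_space"
  assumes "two_attachments X S q1 q2 G"
  shows "top_of_set (X \<union> q1 ` (S \<times> {0..1})) homotopy_equivalent_space top_of_set (X \<union> q2 ` (S \<times> {0..1}))"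
proof -
  interpret A: two_attachments X S q1 q2 G by fact
  define G' where "G' = (\<lambda>p. G (fst p, 1 - snd p))"
  interpret B: two_attachments X S q2 q1 G'
  proof
    show "continuous_on (S \<times> {0..1}) G'" unfolding G'_def
      by (rule continuous_on_compose2[OF A.G(1)]) (auto intro!: continuous_intros)
  qed (use A.q1 A.q2 A.G in \<open>auto simp: G'_def\<close>)
  have eq: "(\<lambda>p. G' (fst p, 1 - snd p)) = G" by (auto simp: G'_def)
  have "B.going = A.returning" "B.returning = A.going"
    unfolding A.going_def A.returning_def B.going_def B.returning_def A.T1_def A.T2_def B.T1_def B.T2_def eq
    by (simp_all add: G'_def)
  then have "homotopic_with_canon (\<lambda>_. True) A.Y2 A.Y2 (A.going \<circ> A.returning) id"
    using B.returning_going by simp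
  then show ?thesis
    unfolding homotopy_equivalent_space_def
    using A.returning_going A.going_map A.returning_map by (metis continuous_map_subtopology_eu image_subset_iff_funcset)
qed

section \<open>Simplices as cones over their boundaries\<close>

definition boundary :: "'a set \<Rightarrow> 'a set set" where
  "boundary \<sigma> = {\<tau>. \<tau> \<noteq> {} \<and> \<tau> \<subset> \<sigma>}"

definition vertex :: "'a \<Rightarrow> 'a \<Rightarrow> real" where
  "vertex v = (\<lambda>x. if x = v then 1 else 0)"

definition barycenter :: "'a set \<Rightarrow> 'a \<Rightarrow> real" where
  "barycenter \<sigma> = (\<lambda>x. if x \<in> \<sigma> then 1 / real (card \<sigma>) else 0)"

lemma complex_boundary: "finite \<sigma> \<Longrightarrow> simplicial_complex (boundary \<sigma>)"
  by (rule complexI) (auto simp: boundary_def intro: finite_subset)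

lemma complex_insert:
  assumes "simplicial_complex L" "finite \<sigma>" "\<sigma> \<noteq> {}" "boundary \<sigma> \<subseteq> L"
  shows "simplicial_complex (insert \<sigma> L)"
proof (rule complexI)
  show "finite (insert \<sigma> L)" using assms complex_finite by auto
  show "\<rho> \<in> insert \<sigma> L" if "\<tau> \<in> insert \<sigma> L" "\<rho> \<noteq> {}" "\<rho> \<subseteq> \<tau>" for \<tau> \<rho>
  proof (cases "\<tau> = \<sigma>")
    case True
    then show ?thesis using that assms(4) by (auto simp: boundary_def)
  next
    case False
    then show ?thesis using that complexD(3)[OF assms(1), of \<tau> \<rho>] by auto
  qed
qed (use assms complexD(1,2)[OF assms(1)] in auto)

lemma points_outside: "s \<in> points (boundary \<sigma>) \<Longrightarrow> v \<notin> \<sigma> \<Longrightarrow> s v = 0"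
  unfolding points_def boundary_def by blast

lemma points_boundary_zero: "s \<in> points (boundary \<sigma>) \<Longrightarrow> \<exists>v\<in>\<sigma>. s v = 0"
  unfolding points_def boundary_def by blast

lemma continuous_on_fst_coord: "continuous_on A (\<lambda>p. fst p v)"
  by (rule continuous_on_product_then_coordinatewise[OF continuous_on_fst[OF continuous_on_id]])

lemma continuous_on_snd_coord: "continuous_on A (\<lambda>p. snd p v)"
  by (rule continuous_on_product_then_coordinatewise[OF continuous_on_snd[OF continuous_on_id]])

lemma vertex_in_points: "{v} \<in> K \<Longrightarrow> vertex v \<in> points K"
proof -
  have "{x. vertex v x \<noteq> 0} = {v}" by (auto simp: vertex_def)
  then show "{v} \<in> K \<Longrightarrow> vertex v \<in> points K" by (auto simp: points_def vertex_def)
qed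

lemma compact_points:
  assumes "simplicial_complex K"
  shows "compact (points K)"
proof -
  have "points K = (\<Union>\<sigma>\<in>K. PiE UNIV (\<lambda>v. if v \<in> \<sigma> then {0..1} else {0}) \<inter> {f. sum f \<sigma> = 1})" (is "_ = (\<Union>\<sigma>\<in>K. ?F \<sigma>)")
  proof (intro set_eqI iffI)
    fix f assume f: "f \<in> points K"
    let ?S = "{v. f v \<noteq> 0}"
    have S: "?S \<in> K" "\<And>v. 0 \<le> f v" "sum f ?S = 1" using f by (auto simp: points_def)
    have "finite ?S" using complexD(1)[OF assms S(1)] .
    then have "f v \<le> 1" if "f v \<noteq> 0" for v using member_le_sum[of v ?S f] S that by auto
    then have "f \<in> ?F ?S" using S by (auto simp: PiE_iff)
    then show "f \<in> (\<Union>\<sigma>\<in>K. ?F \<sigma>)" using S(1) by blast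
  next
    fix f assume "f \<in> (\<Union>\<sigma>\<in>K. ?F \<sigma>)"
    then obtain \<sigma> where \<sigma>: "\<sigma> \<in> K" "sum f \<sigma> = 1" and f: "\<And>v. f v \<in> (if v \<in> \<sigma> then {0..1} else {0})"
      by (auto simp: PiE_iff)
    show "f \<in> points K"
    proof (rule pointsI_le[OF assms \<sigma>(1)])
      show "0 \<le> f v" for v using f[of v] by (auto split: if_splits)
      show "{v. f v \<noteq> 0} \<subseteq> \<sigma>" using f by (metis (mono_tags, lifting) mem_Collect_eq singletonD subsetI)
    qed fact
  qed
  moreover have "compact (?F \<sigma>)" if "\<sigma> \<in> K" for \<sigma>
  proof (rule compact_Int_closed)
    have "compactin (product_topology (\<lambda>i. euclidean) UNIV) (PiE UNIV (\<lambda>v::'a. if v \<in> \<sigma> then {0..1::real} else {0}))"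
      by (subst compactin_PiE) auto
    then show "compact (PiE UNIV (\<lambda>v::'a. if v \<in> \<sigma> then {0..1::real} else {0}))"
      by (simp add: euclidean_product_topology)
    show "closed {f. sum f \<sigma> = (1::real)}"
      by (rule closed_Collect_eq) (auto intro!: continuous_intros)
  qed
  ultimately show ?thesis using complex_finite[OF assms] by (auto intro!: compact_UN)
qed

lemma points_mix:
  assumes K: "simplicial_complex K" and \<tau>: "\<tau> \<in> K" "{v. f v \<noteq> 0} \<subseteq> \<tau>" "{v. g v \<noteq> 0} \<subseteq> \<tau>"
    and f: "f \<in> points L" and g: "g \<in> points M" and t: "0 \<le> t" "t \<le> (1::real)"
  shows "(\<lambda>v. (1 - t) * f v + t * g v) \<in> points K"
proof (rule pointsI_le[OF K \<tau>(1)])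
  have "finite \<tau>" by (rule complexD(1)[OF K \<tau>(1)])
  then have "sum f \<tau> = 1" "sum g \<tau> = 1"
    using points_iff[of \<tau> f L] points_iff[of \<tau> g M] f g \<tau> by auto
  then show "(\<Sum>v\<in>\<tau>. (1 - t) * f v + t * g v) = 1"
    by (simp add: sum.distrib flip: sum_distrib_left)
  show "0 \<le> (1 - t) * f v + t * g v" for v using f g t by (auto simp: points_def)
  show "{v. (1 - t) * f v + t * g v \<noteq> 0} \<subseteq> \<tau>"
  proof
    fix v assume "v \<in> {v. (1 - t) * f v + t * g v \<noteq> 0}"
    then have "f v \<noteq> 0 \<or> g v \<noteq> 0" by auto
    then show "v \<in> \<tau>" using \<tau>(2,3) by blast
  qed
qed

text \<open>
  Transport of barycentric coordinates on a simplex along a bijection of its vertices.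
\<close>

definition relabel :: "('a \<Rightarrow> 'b) \<Rightarrow> 'a set \<Rightarrow> ('b \<Rightarrow> real) \<Rightarrow> 'a \<Rightarrow> real" where
  "relabel b \<rho> s = (\<lambda>v. if v \<in> \<rho> then s (b v) else 0)"

lemma relabel_in_points:
  assumes b: "bij_betw b \<rho> \<sigma>" and fin: "finite \<rho>" and s: "s \<in> points (boundary \<sigma>)"
  shows "relabel b \<rho> s \<in> points (boundary \<rho>)" "\<And>v. v \<in> \<sigma> \<Longrightarrow> relabel b \<rho> s (inv_into \<rho> b v) = s v"
proof -
  have *: "relabel b \<rho> s (inv_into \<rho> b v) = s v" if "v \<in> \<sigma>" for v
    using that b by (simp add: relabel_def bij_betw_def f_inv_into_f inv_into_into)
  then show "\<And>v. v \<in> \<sigma> \<Longrightarrow> relabel b \<rho> s (inv_into \<rho> b v) = s v" .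
  have fins: "finite \<sigma>" using b fin by (metis bij_betw_finite)
  have S: "{v. s v \<noteq> 0} \<subset> \<sigma>" "{v. s v \<noteq> 0} \<noteq> {}" "\<And>v. 0 \<le> s v"
    using s by (auto simp: points_def boundary_def)
  have "sum s \<sigma> = 1" using s points_iff[of \<sigma> s] S(1) fins by auto
  then have sum: "sum (relabel b \<rho> s) \<rho> = 1"
    using sum.reindex_bij_betw[OF b, of s] by (simp add: relabel_def)
  have supp: "{v. relabel b \<rho> s v \<noteq> 0} \<subseteq> \<rho>" by (auto simp: relabel_def)
  obtain v where "v \<in> \<sigma>" "s v = 0" using S(1) by auto
  then have "inv_into \<rho> b v \<in> \<rho>" "relabel b \<rho> s (inv_into \<rho> b v) = 0"
    using * b by (auto simp: bij_betw_def inv_into_into)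
  then have "{v. relabel b \<rho> s v \<noteq> 0} \<noteq> \<rho>" by blast
  moreover have "{v. relabel b \<rho> s v \<noteq> 0} \<noteq> {}"
  proof
    assume "{v. relabel b \<rho> s v \<noteq> 0} = {}"
    then have "sum (relabel b \<rho> s) \<rho> = 0" by (intro sum.neutral) auto
    then show False using sum by simp
  qed
  ultimately have "{v. relabel b \<rho> s v \<noteq> 0} \<in> boundary \<rho>" using supp by (auto simp: boundary_def)
  moreover have "0 \<le> relabel b \<rho> s v" for v using S(3) by (simp add: relabel_def)
  ultimately show "relabel b \<rho> s \<in> points (boundary \<rho>)"
    using points_iff[OF fin supp] sum by blast
qed

lemma relabel_inverse:
  assumes b: "bij_betw b \<rho> \<sigma>" and s: "s \<in> points (boundary \<rho>)"
  shows "relabel b \<rho> (relabel (inv_into \<rho> b) \<sigma> s) = s"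
proof
  fix v
  have "s v = 0" if "v \<notin> \<rho>" using s that by (auto simp: points_def boundary_def)
  moreover have "b v \<in> \<sigma>" "inv_into \<rho> b (b v) = v" if "v \<in> \<rho>"
    using b that by (auto simp: bij_betw_def)
  ultimately show "relabel b \<rho> (relabel (inv_into \<rho> b) \<sigma> s) v = s v"
    by (simp add: relabel_def)
qed

lemma relabel_id: "s \<in> points (boundary \<sigma>) \<Longrightarrow> relabel id \<sigma> s = s"
  by (auto simp: relabel_def points_def boundary_def fun_eq_iff)

text \<open>
  A simplex as the cone over its boundary with the barycenter as cone point; the boundary is named
  by another simplex through \<open>b\<close>.
\<close>

definition cell_map :: "('a \<Rightarrow> 'b) \<Rightarrow> 'a set \<Rightarrow> ('b \<Rightarrow> real) \<times> real \<Rightarrow> 'a \<Rightarrow> real" where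
  "cell_map b \<rho> p = (\<lambda>v. (1 - snd p) * relabel b \<rho> (fst p) v + snd p * barycenter \<rho> v)"

lemma cell_map_inj:
  assumes "finite \<rho>" "\<rho> \<noteq> {}" "s \<in> points (boundary \<rho>)" "s' \<in> points (boundary \<rho>)" "0 < t" "t \<le> 1" "0 < t'" "t' \<le> 1"
    and "\<And>v. (1 - t) * s v + t * barycenter \<rho> v = (1 - t') * s' v + t' * barycenter \<rho> v"
  shows "t = t'" "t = 1 \<or> s = s'"
proof -
  have c: "real (card \<rho>) > 0" using assms by (simp add: card_gt_0_iff)
  have *: "t' \<le> t" if sb: "s \<in> points (boundary \<rho>)" and "s' \<in> points (boundary \<rho>)"
    "\<And>v. (1 - t) * s v + t * barycenter \<rho> v = (1 - t') * s' v + t' * barycenter \<rho> v" "t' \<le> 1" for s s' t t'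
  proof -
    obtain v where v: "v \<in> \<rho>" "s v = 0" using points_boundary_zero[OF sb] by blast
    have "0 \<le> (1 - t') * s' v" using that by (auto simp: points_def)
    then have "t' * barycenter \<rho> v \<le> t * barycenter \<rho> v" using that(3)[of v] v by simp
    then show ?thesis using v c by (simp add: barycenter_def divide_le_cancel)
  qed
  show "t = t'" using *[of s s' t t'] *[of s' s t' t] assms by force
  then show "t = 1 \<or> s = s'" using assms(9) by auto
qed

text \<open>
  The cone parameter of a point is its least coordinate times the number of vertices. Subtracting
  that multiple of the barycenter leaves a multiple of a boundary point.
\<close>

lemma cell_attached:
  assumes L: "simplicial_complex L" and \<rho>: "finite \<rho>" "2 \<le> card \<rho>" "\<rho> \<notin> L" "boundary \<rho> \<subseteq> L"
    and b: "bij_betw b \<rho> \<sigma>"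
  shows "cone_attached (points L) (points (boundary \<sigma>)) (cell_map b \<rho>)"
    "points (insert \<rho> L) = points L \<union> cell_map b \<rho> ` (points (boundary \<sigma>) \<times> {0..1})"
proof -
  have fins: "finite \<sigma>" using b \<rho> by (metis bij_betw_finite)
  have ne: "\<rho> \<noteq> {}" using \<rho> by auto
  have c: "real (card \<rho>) > 0" using \<rho> by simp
  have bi: "bij_betw (inv_into \<rho> b) \<sigma> \<rho>" using b by (rule bij_betw_inv_into)
  have rel: "relabel b \<rho> s \<in> points (boundary \<rho>)" if "s \<in> points (boundary \<sigma>)" for s
    by (rule relabel_in_points(1)[OF b \<rho>(1) that])
  have zero: "cell_map b \<rho> (s, 0) \<in> points L" if "s \<in> points (boundary \<sigma>)" for s
    using rel[OF that] points_mono[OF \<rho>(4)] by (auto simp: cell_map_def)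
  have supp: "{v. cell_map b \<rho> (s, t) v \<noteq> 0} = \<rho>" if "s \<in> points (boundary \<sigma>)" "0 < t" "t \<le> 1" for s t
  proof -
    have "0 \<le> relabel b \<rho> s v" for v using rel[OF that(1)] by (auto simp: points_def)
    moreover have "0 < t * barycenter \<rho> v" if "v \<in> \<rho>" for v using that \<open>0 < t\<close> c by (simp add: barycenter_def)
    ultimately have "0 < cell_map b \<rho> (s, t) v" if "v \<in> \<rho>" for v
      using that \<open>t \<le> 1\<close> unfolding cell_map_def fst_conv snd_conv
      by (metis add_nonneg_pos diff_ge_0_iff_ge mult_nonneg_nonneg)
    moreover have "cell_map b \<rho> (s, t) v = 0" if "v \<notin> \<rho>" for v
      using that by (simp add: cell_map_def barycenter_def relabel_def)
    ultimately show ?thesis by force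
  qed
  have s_ext: "s = s'" if "s \<in> points (boundary \<sigma>)" "s' \<in> points (boundary \<sigma>)" "relabel b \<rho> s = relabel b \<rho> s'" for s s'
  proof
    fix v
    show "s v = s' v"
    proof (cases "v \<in> \<sigma>")
      case True
      then show ?thesis using relabel_in_points(2)[OF b \<rho>(1)] that by metis
    next
      case False
      then show ?thesis using that points_outside by metis
    qed
  qed
  show "cone_attached (points L) (points (boundary \<sigma>)) (cell_map b \<rho>)"
    unfolding cone_attached_def
  proof (intro conjI ballI)
    show "compact (points L)" "compact (points (boundary \<sigma>))"
      using compact_points[OF L] compact_points[OF complex_boundary[OF fins]] by auto
    have r: "continuous_on A (\<lambda>p. relabel b \<rho> (fst p) v)" for v and A :: "(('b \<Rightarrow> real) \<times> real) set"
      by (cases "v \<in> \<rho>") (auto simp: relabel_def intro: continuous_on_fst_coord continuous_on_const)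
    show "continuous_on (points (boundary \<sigma>) \<times> {0..1}) (cell_map b \<rho>)"
      unfolding cell_map_def
      by (rule continuous_on_coordinatewise_then_product) (intro continuous_intros r)
    fix s t assume s: "s \<in> points (boundary \<sigma>)" and t: "t \<in> {0..1::real}"
    show "cell_map b \<rho> (s, t) \<in> points L \<longleftrightarrow> t = 0"
    proof (cases "t = 0")
      case True
      then show ?thesis using zero s by auto
    next
      case False
      then have "{v. cell_map b \<rho> (s, t) v \<noteq> 0} = \<rho>" using supp[OF s] t by auto
      then show ?thesis using \<rho>(3) False by (auto simp: points_def)
    qed
  next
    fix s s' and t t' :: real
    assume *: "s \<in> points (boundary \<sigma>)" "s' \<in> points (boundary \<sigma>)" "t \<in> {0<..1}" "t' \<in> {0<..1}"
    show "cell_map b \<rho> (s, t) = cell_map b \<rho> (s', t') \<longleftrightarrow> t = t' \<and> (t = 1 \<or> s = s')"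
    proof
      assume eq: "cell_map b \<rho> (s, t) = cell_map b \<rho> (s', t')"
      have "t = t'" "t = 1 \<or> relabel b \<rho> s = relabel b \<rho> s'"
        using cell_map_inj[OF \<rho>(1) ne rel[OF *(1)] rel[OF *(2)], of t t'] *(3,4) fun_cong[OF eq]
        by (auto simp: cell_map_def)
      then show "t = t' \<and> (t = 1 \<or> s = s')" using s_ext *(1,2) by blast
    qed (auto simp: cell_map_def)
  qed
  show "points (insert \<rho> L) = points L \<union> cell_map b \<rho> ` (points (boundary \<sigma>) \<times> {0..1})"
  proof (intro set_eqI iffI)
    fix f assume "f \<in> points L \<union> cell_map b \<rho> ` (points (boundary \<sigma>) \<times> {0..1})"
    then consider "f \<in> points L" | s t where "s \<in> points (boundary \<sigma>)" "0 \<le> t" "t \<le> 1" "f = cell_map b \<rho> (s, t)"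
      by auto
    then show "f \<in> points (insert \<rho> L)"
    proof cases
      case 1
      then show ?thesis using points_mono[of L "insert \<rho> L"] by auto
    next
      case 2
      have K: "simplicial_complex (insert \<rho> L)" by (rule complex_insert[OF L \<rho>(1) ne \<rho>(4)])
      have "{v. relabel b \<rho> s v \<noteq> 0} \<subseteq> \<rho>" "{v. barycenter \<rho> v \<noteq> 0} \<subseteq> \<rho>"
        by (auto simp: relabel_def barycenter_def)
      moreover have "{v. barycenter \<rho> v \<noteq> 0} = \<rho>" using c by (auto simp: barycenter_def)
      then have "barycenter \<rho> \<in> points {\<rho>}"
        using c by (auto simp: points_def) (auto simp: barycenter_def)
      ultimately show ?thesis unfolding 2(4) cell_map_def fst_conv snd_conv
        using points_mix[OF K _ _ _ rel[OF 2(1)], of \<rho> "barycenter \<rho>" "{\<rho>}" t] 2 by auto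
    qed
  next
    fix f assume f: "f \<in> points (insert \<rho> L)"
    show "f \<in> points L \<union> cell_map b \<rho> ` (points (boundary \<sigma>) \<times> {0..1})"
    proof (cases "{v. f v \<noteq> 0} \<in> L")
      case True
      then show ?thesis using f by (auto simp: points_def)
    next
      case False
      then have S: "{v. f v \<noteq> 0} = \<rho>" and f0: "\<And>v. 0 \<le> f v" and sum: "sum f \<rho> = 1"
        using f by (auto simp: points_def)
      define \<mu> where "\<mu> = Min (f ` \<rho>)"
      define t where "t = real (card \<rho>) * \<mu>"
      have "\<mu> \<in> f ` \<rho>" unfolding \<mu>_def using \<rho> ne by (intro Min_in) auto
      then obtain v0 where v0: "v0 \<in> \<rho>" "f v0 = \<mu>" by auto
      have \<mu>le: "\<mu> \<le> f v" if "v \<in> \<rho>" for v unfolding \<mu>_def using \<rho> that by auto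
      have "(\<Sum>v\<in>\<rho>. \<mu>) \<le> sum f \<rho>" by (intro sum_mono \<mu>le)
      then have t1: "t \<le> 1" by (simp add: t_def sum)
      have t0: "0 \<le> t" using f0[of v0] v0 by (simp add: t_def)
      have bc: "t * barycenter \<rho> v = (if v \<in> \<rho> then \<mu> else 0)" for v
        using c by (auto simp: t_def barycenter_def)
      have "\<exists>s\<in>points (boundary \<rho>). \<forall>v. f v = (1 - t) * s v + t * barycenter \<rho> v"
      proof (cases "t = 1")
        case True
        have "(\<Sum>v\<in>\<rho>. f v - \<mu>) = 0" using True by (simp add: sum_subtractf sum t_def)
        then have c\<mu>: "f v = \<mu>" if "v \<in> \<rho>" for v
          using sum_nonneg_eq_0_iff[OF \<rho>(1), of "\<lambda>v. f v - \<mu>"] \<mu>le that by auto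
        have "f v = t * barycenter \<rho> v" for v
        proof (cases "v \<in> \<rho>")
          case False
          then have "f v = 0" using S by blast
          then show ?thesis using bc[of v] False by simp
        qed (use c\<mu>[of v] bc[of v] in simp)
        moreover have "{v0} \<noteq> \<rho>" using card_1_singleton_iff[of \<rho>] \<rho>(2) by fastforce
        then have "{v0} \<in> boundary \<rho>" using v0(1) unfolding boundary_def by blast
        then have "vertex v0 \<in> points (boundary \<rho>)" by (rule vertex_in_points)
        ultimately show ?thesis using True by auto
      next
        case False
        define s where "s = (\<lambda>v. (f v - t * barycenter \<rho> v) / (1 - t))"
        have fs: "f v = (1 - t) * s v + t * barycenter \<rho> v" for v using False by (simp add: s_def)
        have s0: "0 \<le> s v" for v using t1 False \<mu>le[of v] f0[of v] by (simp add: s_def bc)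
        have ssub: "{v. s v \<noteq> 0} \<subseteq> \<rho>" using S by (auto simp: s_def bc)
        have "s v0 = 0" using v0 by (simp add: s_def bc)
        have "sum s \<rho> = (\<Sum>v\<in>\<rho>. f v - t * barycenter \<rho> v) / (1 - t)" by (simp add: s_def sum_divide_distrib)
        also have "(\<Sum>v\<in>\<rho>. f v - t * barycenter \<rho> v) = (\<Sum>v\<in>\<rho>. f v - \<mu>)"
          by (intro sum.cong) (simp_all add: bc)
        also have "\<dots> = 1 - t" by (simp add: sum_subtractf sum t_def)
        finally have sums: "sum s \<rho> = 1" using False by simp
        have "{v. s v \<noteq> 0} \<noteq> {}"
        proof
          assume "{v. s v \<noteq> 0} = {}"
          then have "sum s \<rho> = 0" by (intro sum.neutral) auto
          then show False using sums by simp
        qed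
        moreover have "{v. s v \<noteq> 0} \<noteq> \<rho>" using v0(1) \<open>s v0 = 0\<close> by blast
        ultimately have "{v. s v \<noteq> 0} \<in> boundary \<rho>" using ssub by (auto simp: boundary_def)
        then have "s \<in> points (boundary \<rho>)" using points_iff[OF \<rho>(1) ssub] s0 sums by blast
        then show ?thesis using fs by auto
      qed
      then obtain s where s: "s \<in> points (boundary \<rho>)" "\<And>v. f v = (1 - t) * s v + t * barycenter \<rho> v" by auto
      let ?s = "relabel (inv_into \<rho> b) \<sigma> s"
      have "?s \<in> points (boundary \<sigma>)" using relabel_in_points(1)[OF bi fins s(1)] .
      moreover have "f = cell_map b \<rho> (?s, t)"
        using s(2) relabel_inverse[OF b s(1)] by (auto simp: cell_map_def)
      ultimately show ?thesis using t0 t1 by (auto intro!: image_eqI[of _ _ "(?s, t)"])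
    qed
  qed
qed

text \<open>
  Both complexes arise from \<open>L\<close> by attaching a cone over the same sphere along
  homotopic maps.
\<close>

lemma exchange_cells:
  assumes L: "simplicial_complex L" and \<rho>: "finite \<rho>" "2 \<le> card \<rho>" "\<rho> \<notin> L" "boundary \<rho> \<subseteq> L"
    and \<sigma>: "\<sigma> \<notin> L" "boundary \<sigma> \<subseteq> L" and b: "bij_betw b \<rho> \<sigma>"
    and hom: "homotopic_with_canon (\<lambda>_. True) (points (boundary \<sigma>)) (points L) (\<lambda>x. x) (relabel b \<rho>)"
  shows "realization (insert \<sigma> L) homotopy_equivalent_space realization (insert \<rho> L)"
proof -
  have fins: "finite \<sigma>" "2 \<le> card \<sigma>" using b \<rho> bij_betw_finite bij_betw_same_card by metis+
  have id: "bij_betw id \<sigma> \<sigma>" by simp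
  note c1 = cell_attached[OF L fins \<sigma> id] and c2 = cell_attached[OF L \<rho> b]
  from hom obtain h where h: "continuous_on ({0..1} \<times> points (boundary \<sigma>)) h"
    "\<And>t x. 0 \<le> t \<Longrightarrow> t \<le> 1 \<Longrightarrow> x \<in> points (boundary \<sigma>) \<Longrightarrow> h (t, x) \<in> points L"
    "\<And>x. h (0::real, x) = x" "\<And>x. h (1, x) = relabel b \<rho> x"
    by (rule homotopicE) blast
  have "two_attachments (points L) (points (boundary \<sigma>)) (cell_map id \<sigma>) (cell_map b \<rho>) (\<lambda>(s, t). h (t, s))"
  proof
    show "continuous_on (points (boundary \<sigma>) \<times> {0..1}) (\<lambda>(s, t). h (t, s))"
      unfolding case_prod_unfold
      by (rule continuous_on_compose2[OF h(1)])
        (auto intro!: continuous_on_Pair continuous_on_fst continuous_on_snd continuous_on_id)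
  qed (use c1 c2 h in \<open>auto simp: cell_map_def relabel_id\<close>)
  from homotopy_equivalent_attachments[OF this] show ?thesis
    by (simp add: realization_eq c1(2) c2(2))
qed

section \<open>Trading a null-homotopic cell for a sphere\<close>

lemma boundary_insert:
  assumes "v \<notin> \<rho>" "\<rho> \<noteq> {}"
  shows "boundary (insert v \<rho>) = insert \<rho> (cone v (boundary \<rho>))"
proof (intro set_eqI iffI)
  fix \<tau> assume "\<tau> \<in> boundary (insert v \<rho>)"
  then have \<tau>: "\<tau> \<noteq> {}" "\<tau> \<subseteq> insert v \<rho>" "\<tau> \<noteq> insert v \<rho>" by (auto simp: boundary_def)
  show "\<tau> \<in> insert \<rho> (cone v (boundary \<rho>))"
  proof (cases "v \<in> \<tau>")
    case False
    then have "\<tau> = \<rho> \<or> \<tau> \<in> boundary \<rho>" using \<tau> by (auto simp: boundary_def)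
    then show ?thesis by (auto simp: cone_def)
  next
    case True
    then have eq: "\<tau> = insert v (\<tau> - {v})" by auto
    have "\<tau> - {v} \<subseteq> \<rho>" "\<tau> - {v} \<noteq> \<rho>" using \<tau> eq by auto
    then have "\<tau> - {v} = {} \<or> \<tau> - {v} \<in> boundary \<rho>" unfolding boundary_def by blast
    then show ?thesis using eq unfolding cone_def by (metis UnCI imageI insertCI)
  qed
next
  fix \<tau> assume "\<tau> \<in> insert \<rho> (cone v (boundary \<rho>))"
  then consider "\<tau> = \<rho>" | "\<tau> = {v}" | "\<tau> \<in> boundary \<rho>" | \<tau>' where "\<tau>' \<in> boundary \<rho>" "\<tau> = insert v \<tau>'"
    by (auto simp: cone_def)
  then show "\<tau> \<in> boundary (insert v \<rho>)"
    by cases (use assms in \<open>auto simp: boundary_def\<close>)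
qed

lemma cell_vertices: "boundary \<sigma> \<subseteq> K \<Longrightarrow> 2 \<le> card \<sigma> \<Longrightarrow> x \<in> \<sigma> \<Longrightarrow> {x} \<in> K"
  unfolding boundary_def using card_1_singleton_iff[of \<sigma>] by fastforce

lemma continuous_on_segment:
  fixes f :: "'z::topological_space \<Rightarrow> 'a \<Rightarrow> real"
  assumes "continuous_on A t" "\<And>v. continuous_on A (\<lambda>z. f z v)" "\<And>v. continuous_on A (\<lambda>z. g z v)"
  shows "continuous_on A (\<lambda>z v. (1 - t z) * f z v + t z * g z v)"
  by (rule continuous_on_coordinatewise_then_product) (intro continuous_intros assms)

lemma segment_in_cone:
  assumes D: "simplicial_complex D" and s: "s \<in> points D" and t: "0 \<le> t" "t \<le> 1"
  shows "(\<lambda>v. (1 - t) * s v + t * vertex w v) \<in> points (cone w D)"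
proof (rule points_mix[OF complex_cone[OF D] _ _ _ s vertex_in_points t])
  show "insert w {v. s v \<noteq> 0} \<in> cone w D" using s by (auto simp: cone_def points_def)
qed (auto simp: vertex_def)

text \<open>
  Adding the cone with apex \<open>v\<close> over the boundary of \<open>\<rho>\<close> does not
  change the homotopy type. In the enlarged complex the boundaries of \<open>\<sigma>\<close> and of
  \<open>\<rho>\<close> both contract to \<open>v\<close>, so \<open>\<sigma>\<close> may be
  exchanged for \<open>\<rho>\<close>; together with its cone \<open>\<rho>\<close> makes up the
  boundary of \<open>insert v \<rho>\<close>.
\<close>

lemma cell_to_sphere:
  assumes K: "simplicial_complex K" and \<sigma>: "\<sigma> \<notin> K" "boundary \<sigma> \<subseteq> K"
    and \<rho>: "finite \<rho>" "2 \<le> card \<rho>" "\<rho> \<inter> \<Union>K = {}" and b: "bij_betw b \<rho> \<sigma>" and v: "{v} \<in> K"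
    and null: "homotopic_with_canon (\<lambda>_. True) (points (boundary \<sigma>)) (points K) (\<lambda>x. x) (\<lambda>_. vertex v)"
  shows "realization (insert \<sigma> K) homotopy_equivalent_space realization (K \<union> boundary (insert v \<rho>))"
proof -
  have fins: "finite \<sigma>" "2 \<le> card \<sigma>" using b \<rho> bij_betw_finite bij_betw_same_card by metis+
  have ne: "\<rho> \<noteq> {}" "\<sigma> \<noteq> {}" using \<rho> fins by auto
  have v\<rho>: "v \<notin> \<rho>" using v \<rho> by auto
  have K\<rho>: "\<tau> \<inter> \<rho> = {}" if "\<tau> \<in> K" for \<tau> using \<rho>(3) that by auto
  have \<sigma>K: "\<sigma> \<inter> \<rho> = {}" using cell_vertices[OF \<sigma>(2) fins(2)] \<rho>(3) by blast
  have b\<rho>: "\<tau> \<noteq> {} \<and> \<tau> \<subseteq> \<rho>" if "\<tau> \<in> boundary \<rho>" for \<tau> using that by (auto simp: boundary_def)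
  define L where "L = K \<union> cone v (boundary \<rho>)"
  have c\<rho>: "simplicial_complex (boundary \<rho>)" by (rule complex_boundary[OF \<rho>(1)])
  have cone: "simplicial_complex (cone v (boundary \<rho>))" by (rule complex_cone[OF c\<rho>])
  have L: "simplicial_complex L" unfolding L_def by (rule complex_Un[OF K cone])
  have \<rho>L: "\<rho> \<notin> L" "boundary \<rho> \<subseteq> L"
    using K\<rho>[of \<rho>] ne v\<rho> by (auto simp: L_def cone_def boundary_def)
  have \<sigma>L: "\<sigma> \<notin> L" "boundary \<sigma> \<subseteq> L"
  proof -
    show "\<sigma> \<notin> L"
    proof
      assume "\<sigma> \<in> L"
      then consider "\<sigma> = {v}" | \<tau> where "\<tau> \<in> boundary \<rho>" "\<tau> \<subseteq> \<sigma>" using \<sigma> by (auto simp: L_def cone_def)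
      then show False
      proof cases
        case 2
        then show False using \<sigma>K b\<rho>[OF 2(1)] by blast
      qed (use \<sigma> v in simp)
    qed
  qed (use \<sigma> in \<open>auto simp: L_def\<close>)
  have "homotopic_with_canon (\<lambda>_. True) (points (boundary \<sigma>)) (points L) (relabel b \<rho>) (\<lambda>_. vertex v)"
  proof (rule homotopicI[of _ "\<lambda>z v'. (1 - fst z) * relabel b \<rho> (snd z) v' + fst z * vertex v v'"])
    have "continuous_on A (\<lambda>z. relabel b \<rho> (snd z) v)" for v and A :: "(real \<times> _) set"
      by (cases "v \<in> \<rho>") (auto simp: relabel_def intro: continuous_on_snd_coord continuous_on_const)
    then show "continuous_on ({0..1} \<times> points (boundary \<sigma>)) (\<lambda>z v'. (1 - fst z) * relabel b \<rho> (snd z) v' + fst z * vertex v v')"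
      by (intro continuous_on_segment continuous_on_fst continuous_on_id continuous_on_const)
    fix t x assume *: "0 \<le> t" "t \<le> (1::real)" "x \<in> points (boundary \<sigma>)"
    show "(\<lambda>v'. (1 - fst (t, x)) * relabel b \<rho> (snd (t, x)) v' + fst (t, x) * vertex v v') \<in> points L"
      using segment_in_cone[OF c\<rho> relabel_in_points(1)[OF b \<rho>(1) *(3)] *(1,2), of v]
        points_mono[of "cone v (boundary \<rho>)" L] by (auto simp: L_def)
  qed auto
  moreover have "homotopic_with_canon (\<lambda>_. True) (points (boundary \<sigma>)) (points L) (\<lambda>x. x) (\<lambda>_. vertex v)"
    by (rule homotopic_with_subset_right[OF null]) (auto intro!: points_mono simp: L_def)
  ultimately have "homotopic_with_canon (\<lambda>_. True) (points (boundary \<sigma>)) (points L) (\<lambda>x. x) (relabel b \<rho>)"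
    by (meson homotopic_with_symD homotopic_with_trans)
  from exchange_cells[OF L \<rho>(1,2) \<rho>L \<sigma>L b this]
  have "realization (insert \<sigma> L) homotopy_equivalent_space realization (insert \<rho> L)" .
  moreover have "insert \<rho> L = K \<union> boundary (insert v \<rho>)"
    using boundary_insert[OF v\<rho> ne(1)] by (auto simp: L_def)
  moreover have "realization (insert \<sigma> L) homotopy_equivalent_space realization (insert \<sigma> K)"
  proof -
    have cL: "simplicial_complex (insert \<sigma> L)" by (rule complex_insert[OF L fins(1) ne(2) \<sigma>L(2)])
    have in_cone: "\<tau>' \<in> cone v (boundary \<rho>)" if "\<tau>' \<in> insert \<sigma> L" "\<tau> \<in> boundary \<rho>" "\<tau> \<subseteq> \<tau>'" for \<tau> \<tau>'
      using that K\<rho>[of \<tau>'] \<sigma>K b\<rho>[OF that(2)] unfolding L_def by blast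
    have "collapses (insert \<sigma> L) (delete_stars (boundary \<rho>) (insert \<sigma> L))"
    proof (rule collapses_delete_stars[OF cL, where v = "\<lambda>_. v"])
      show "finite (boundary \<rho>)" by (rule complex_finite[OF c\<rho>])
      show "\<tau> \<noteq> {} \<and> v \<notin> \<tau>" if "\<tau> \<in> boundary \<rho>" for \<tau> using b\<rho>[OF that] v\<rho> by auto
      show "insert v \<tau>' \<in> insert \<sigma> L" if "\<tau> \<in> boundary \<rho>" "\<tau>' \<in> insert \<sigma> L" "\<tau> \<subseteq> \<tau>'" for \<tau> \<tau>'
        using in_cone[OF that(2,1,3)] by (auto simp: L_def cone_def)
      show "\<sigma>' \<subseteq> \<tau>'" if "\<sigma>' \<in> boundary \<rho>" "\<sigma>' \<subseteq> insert v \<tau>'" for \<sigma>' \<tau>'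
        using b\<rho>[OF that(1)] v\<rho> that(2) by auto
    qed
    moreover have "delete_stars (boundary \<rho>) (insert \<sigma> L) = insert \<sigma> K"
    proof (intro set_eqI iffI)
      fix \<tau> assume \<tau>: "\<tau> \<in> delete_stars (boundary \<rho>) (insert \<sigma> L)"
      then show "\<tau> \<in> insert \<sigma> K"
        using v by (auto simp: delete_stars_def L_def cone_def)
    next
      fix \<tau> assume \<tau>: "\<tau> \<in> insert \<sigma> K"
      have "\<not> \<tau>' \<subseteq> \<tau>" if "\<tau>' \<in> boundary \<rho>" for \<tau>'
        using b\<rho>[OF that] \<tau> K\<rho>[of \<tau>] \<sigma>K by blast
      then show "\<tau> \<in> delete_stars (boundary \<rho>) (insert \<sigma> L)"
        using \<tau> by (auto simp: delete_stars_def L_def)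
    qed
    ultimately show ?thesis using collapses_homotopy_equivalent[OF _ cL] by metis
  qed
  ultimately show ?thesis by (metis homotopy_eqv_trans homotopy_equivalent_space_sym)
qed

section \<open>Null-homotopic suspensions\<close>

lemma glue_homotopic:
  assumes q: "cone_attached X S q"
    and F: "continuous_on ({0..1} \<times> X) F" and \<Phi>: "continuous_on ({0..1} \<times> (S \<times> {0..1})) \<Phi>"
    and base: "\<And>u s. 0 \<le> u \<Longrightarrow> u \<le> 1 \<Longrightarrow> s \<in> S \<Longrightarrow> \<Phi> (u, (s, 0)) = F (u, q (s, 0))"
    and apex: "\<And>u s s'. 0 \<le> u \<Longrightarrow> u \<le> 1 \<Longrightarrow> s \<in> S \<Longrightarrow> s' \<in> S \<Longrightarrow> \<Phi> (u, (s, 1)) = \<Phi> (u, (s', 1))"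
    and FZ: "\<And>u x. 0 \<le> u \<Longrightarrow> u \<le> 1 \<Longrightarrow> x \<in> X \<Longrightarrow> F (u, x) \<in> Z"
    and \<Phi>Z: "\<And>u s t. 0 \<le> u \<Longrightarrow> u \<le> 1 \<Longrightarrow> s \<in> S \<Longrightarrow> 0 \<le> t \<Longrightarrow> t \<le> 1 \<Longrightarrow> \<Phi> (u, (s, t)) \<in> Z"
  shows "homotopic_with_canon (\<lambda>_. True) (X \<union> q ` (S \<times> {0..1})) Z
     (glue X S q (\<lambda>x. F (0::real, x)) (\<lambda>p. \<Phi> (0, p))) (glue X S q (\<lambda>x. F (1, x)) (\<lambda>p. \<Phi> (1, p)))"
proof (rule homotopicI[of _ "\<lambda>(u, x). glue X S q (\<lambda>x. F (u, x)) (\<lambda>p. \<Phi> (u, p)) x"])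
  show "continuous_on ({0..1} \<times> (X \<union> q ` (S \<times> {0..1}))) (\<lambda>(u, x). glue X S q (\<lambda>x. F (u, x)) (\<lambda>p. \<Phi> (u, p)) x)"
    by (rule continuous_on_glue[OF q compact_Icc F \<Phi>]) (use base in simp, rule apex, auto)
  fix u :: real and x assume u: "0 \<le> u" "u \<le> 1" and x: "x \<in> X \<union> q ` (S \<times> {0..1})"
  show "(case (u, x) of (u, x) \<Rightarrow> glue X S q (\<lambda>x. F (u, x)) (\<lambda>p. \<Phi> (u, p)) x) \<in> Z"
  proof (cases "x \<in> X")
    case True
    then show ?thesis using FZ u by (simp add: glue_base)
  next
    case False
    then obtain s t where st: "s \<in> S" "0 \<le> t" "t \<le> 1" "x = q (s, t)" using x by auto
    have "glue X S q (\<lambda>x. F (u, x)) (\<lambda>p. \<Phi> (u, p)) (q (s, t)) = \<Phi> (u, (s, t))"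
      by (rule glue_cone[OF q st(1-3)]) (rule base[OF u], assumption, rule apex[OF u])
    then show ?thesis using \<Phi>Z[OF u st(1-3)] st(4) by simp
  qed
qed auto

definition join_map :: "'a \<Rightarrow> ('a \<Rightarrow> real) \<times> real \<Rightarrow> 'a \<Rightarrow> real" where
  "join_map w p = (\<lambda>v. (1 - snd p) * fst p v + snd p * vertex w v)"

lemma continuous_on_join_map: "continuous_on A (join_map w)"
  unfolding join_map_def
  by (intro continuous_on_segment continuous_on_snd continuous_on_id continuous_on_const continuous_on_fst_coord)

text \<open>The cone parameter is the mass at \<open>w\<close>.\<close>

lemma join_attached:
  assumes D: "simplicial_complex D" and E: "simplicial_complex E" "D \<subseteq> E" and w: "w \<notin> \<Union>E"
  shows "cone_attached (points E) (points D) (join_map w)"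
    "D \<noteq> {} \<Longrightarrow> points (E \<union> cone w D) = points E \<union> join_map w ` (points D \<times> {0..1})"
proof -
  have s0: "s w = 0" if "s \<in> points E" for s using w that unfolding points_def by blast
  have DE: "s \<in> points E" if "s \<in> points D" for s using points_mono[OF E(2)] that by blast
  have jw: "join_map w (s, t) w = t" if "s \<in> points D" for s t
    using s0[OF DE[OF that]] by (simp add: join_map_def vertex_def)
  show "cone_attached (points E) (points D) (join_map w)"
    unfolding cone_attached_def
  proof (intro conjI ballI)
    show "compact (points E)" "compact (points D)" using compact_points D E by auto
    show "continuous_on (points D \<times> {0..1}) (join_map w)" by (rule continuous_on_join_map)
    fix s and t :: real assume s: "s \<in> points D" "t \<in> {0..1}"
    have "join_map w (s, 0) = s" by (simp add: join_map_def)
    then show "join_map w (s, t) \<in> points E \<longleftrightarrow> t = 0"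
      using s0[of "join_map w (s, t)"] jw[OF s(1), of t] DE[OF s(1)] by auto
  next
    fix s s' and t t' :: real
    assume *: "s \<in> points D" "s' \<in> points D" "t \<in> {0<..1}" "t' \<in> {0<..1}"
    show "join_map w (s, t) = join_map w (s', t') \<longleftrightarrow> t = t' \<and> (t = 1 \<or> s = s')"
    proof
      assume eq: "join_map w (s, t) = join_map w (s', t')"
      then have t: "t = t'" using jw *(1,2) by metis
      moreover have "s v = s' v" if "t \<noteq> 1" for v
        using fun_cong[OF eq, of v] that t by (simp add: join_map_def)
      ultimately show "t = t' \<and> (t = 1 \<or> s = s')" by auto
    qed (auto simp: join_map_def)
  qed
  assume neD: "D \<noteq> {}"
  have cx: "simplicial_complex (E \<union> cone w D)" by (intro complex_Un complex_cone D E)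
  show "points (E \<union> cone w D) = points E \<union> join_map w ` (points D \<times> {0..1})"
  proof (intro set_eqI iffI)
    fix f assume "f \<in> points E \<union> join_map w ` (points D \<times> {0..1})"
    then consider "f \<in> points E" | s t where "s \<in> points D" "0 \<le> t" "t \<le> 1" "f = join_map w (s, t)" by auto
    then show "f \<in> points (E \<union> cone w D)"
    proof cases
      case 1
      then show ?thesis using points_mono[of E "E \<union> cone w D"] by auto
    next
      case 2
      then show ?thesis using segment_in_cone[OF D 2(1-3), of w] points_mono[of "cone w D" "E \<union> cone w D"]
        by (auto simp: join_map_def)
    qed
  next
    fix f assume f: "f \<in> points (E \<union> cone w D)"
    show "f \<in> points E \<union> join_map w ` (points D \<times> {0..1})"
    proof (cases "{v. f v \<noteq> 0} \<in> E")
      case True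
      then show ?thesis using f by (auto simp: points_def)
    next
      case False
      then have S: "{v. f v \<noteq> 0} \<in> cone w D" and f0: "\<And>v. 0 \<le> f v" using f by (auto simp: points_def)
      have fin: "finite {v. f v \<noteq> 0}" by (rule complexD(1)[OF complex_cone[OF D] S])
      have sum: "sum f {v. f v \<noteq> 0} = 1" using f by (auto simp: points_def)
      consider "{v. f v \<noteq> 0} = {w}" | \<tau> where "\<tau> \<in> D" "{v. f v \<noteq> 0} = insert w \<tau>"
        using S False E by (auto simp: cone_def)
      then show ?thesis
      proof cases
        case 1
        obtain \<tau> where "\<tau> \<in> D" using neD by auto
        then obtain v where "v \<in> \<tau>" using complexD(2)[OF D] by blast
        then have "{v} \<in> D" using complexD(3)[OF D \<open>\<tau> \<in> D\<close>, of "{v}"] by auto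
        then have "vertex v \<in> points D" by (rule vertex_in_points)
        moreover have "f = join_map w (vertex v, 1)"
        proof
          fix x show "f x = join_map w (vertex v, 1) x"
            using 1 sum by (cases "x = w") (auto simp: join_map_def vertex_def)
        qed
        ultimately show ?thesis by (auto intro!: image_eqI[of _ _ "(vertex v, 1)"])
      next
        case 2
        have w\<tau>: "w \<notin> \<tau>" using 2(1) w E by auto
        have fin\<tau>: "finite \<tau>" "\<tau> \<noteq> {}" using complexD(1,2)[OF D 2(1)] by auto
        define t where "t = f w"
        have st: "f w + sum f \<tau> = 1" using sum 2(2) fin\<tau> w\<tau> by simp
        have pos: "0 < f v" if "v \<in> \<tau>" for v using f0[of v] 2(2) that by (metis (mono_tags, lifting) insertCI less_eq_real_def mem_Collect_eq)
        have "0 < sum f \<tau>" by (rule sum_pos) (use fin\<tau> pos in auto)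
        then have t: "0 \<le> t" "t < 1" using st f0[of w] by (auto simp: t_def)
        define s where "s = (\<lambda>v. if v = w then 0 else f v / (1 - t))"
        have ss: "{v. s v \<noteq> 0} = \<tau>" using 2(2) w\<tau> t by (auto simp: s_def)
        have "sum s \<tau> = (\<Sum>v\<in>\<tau>. f v / (1 - t))" by (rule sum.cong) (use w\<tau> in \<open>auto simp: s_def\<close>)
        also have "\<dots> = 1" using st t by (simp add: t_def flip: sum_divide_distrib)
        finally have "s \<in> points D" using ss 2(1) f0 t by (auto simp: points_def s_def)
        moreover have "f = join_map w (s, t)"
          using t by (auto simp: join_map_def s_def vertex_def t_def fun_eq_iff)
        ultimately show ?thesis using t by (auto intro!: image_eqI[of _ _ "(s, t)"])
      qed
    qed
  qed
qed

text \<open>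
  The boundary of \<open>insert w \<sigma>\<close> is \<open>\<sigma>\<close> together with the cone
  over \<open>boundary \<sigma>\<close>, hence a suspension. The homotopy has three stages. First
  \<open>\<sigma>\<close> is shrunk to \<open>c\<close> inside \<open>K\<close>, and the cone lines
  trail behind: the line over \<open>s\<close> becomes the path \<open>\<Gamma> (s, _)\<close> from
  \<open>c\<close> through \<open>s\<close> to \<open>w\<close>. Then \<open>s\<close> is contracted
  inside \<open>D\<close>, where \<open>\<Gamma>\<close> is still defined, so that all lines become
  one path. Finally that path is drawn into \<open>w\<close>.
\<close>

lemma suspension_null:
  assumes C: "simplicial_complex C" and K: "simplicial_complex K" and D: "simplicial_complex D" "D \<subseteq> C"
    and \<sigma>: "\<sigma> \<in> C" "boundary \<sigma> \<subseteq> D" "2 \<le> card \<sigma>" and w: "w \<notin> \<Union>C"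
    and HC: "homotopic_with_canon (\<lambda>_. True) (points C) (points K) (\<lambda>x. x) (\<lambda>_. c)"
    and HD: "homotopic_with_canon (\<lambda>_. True) (points (boundary \<sigma>)) (points D) (\<lambda>x. x) (\<lambda>_. u0)"
  shows "homotopic_with_canon (\<lambda>_. True) (points (boundary (insert w \<sigma>))) (points (K \<union> cone w D))
     (\<lambda>x. x) (\<lambda>_. vertex w)"
proof -
  let ?B = "boundary \<sigma>" and ?X = "points (K \<union> cone w D)"
  have fin: "finite \<sigma>" "\<sigma> \<noteq> {}" using complexD(1,2)[OF C \<sigma>(1)] by auto
  have B: "simplicial_complex ?B" by (rule complex_boundary[OF fin(1)])
  have E: "simplicial_complex (insert \<sigma> ?B)" by (rule complex_insert[OF B fin order_refl])
  have EC: "insert \<sigma> ?B \<subseteq> C" using \<sigma> D by auto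
  have w\<sigma>: "w \<notin> \<sigma>" using w \<sigma> by auto
  have wE: "w \<notin> \<Union>(insert \<sigma> ?B)" using w\<sigma> by (auto simp: boundary_def)
  obtain x0 where "x0 \<in> \<sigma>" using fin by auto
  then have "{x0} \<in> ?B" using cell_vertices[of \<sigma> ?B] \<sigma>(3) by blast
  then have neB: "?B \<noteq> {}" and x0: "vertex x0 \<in> points ?B" using vertex_in_points[of x0] by auto
  note ja = join_attached[OF B E subset_insertI wE]
  have dom: "points (boundary (insert w \<sigma>)) = points (insert \<sigma> ?B) \<union> join_map w ` (points ?B \<times> {0..1})"
  proof -
    have "boundary (insert w \<sigma>) = insert \<sigma> ?B \<union> cone w ?B"
      using boundary_insert[OF w\<sigma> fin(2)] by (auto simp: cone_def)
    then show ?thesis using ja(2)[OF neB] by simp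
  qed
  from HC obtain H where H: "continuous_on ({0..1} \<times> points C) H"
    "\<And>t x. 0 \<le> t \<Longrightarrow> t \<le> 1 \<Longrightarrow> x \<in> points C \<Longrightarrow> H (t, x) \<in> points K"
    "\<And>x. H (0::real, x) = x" "\<And>x. H (1, x) = c"
    by (rule homotopicE) blast
  from HD obtain R where R: "continuous_on ({0..1} \<times> points ?B) R"
    "\<And>t x. 0 \<le> t \<Longrightarrow> t \<le> 1 \<Longrightarrow> x \<in> points ?B \<Longrightarrow> R (t, x) \<in> points D"
    "\<And>x. R (0::real, x) = x" "\<And>x. R (1, x) = u0"
    by (rule homotopicE) blast
  have u0: "u0 \<in> points D" using R(2)[of 1, OF _ _ x0] R(4) by simp
  have DC: "s \<in> points C" if "s \<in> points D" for s using points_mono[OF D(2)] that by blast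
  have BD: "s \<in> points D" if "s \<in> points ?B" for s using points_mono[OF \<sigma>(2)] that by blast
  have EC': "s \<in> points C" if "s \<in> points (insert \<sigma> ?B)" for s using points_mono[OF EC] that by blast
  have KX: "f \<in> ?X" if "f \<in> points K" for f using points_mono[of K "K \<union> cone w D"] that by blast
  define \<Gamma> where "\<Gamma> = track (\<lambda>p. H (snd p, fst p)) (join_map w)"
  have c\<Gamma>: "continuous_on (points D \<times> {-1..1}) \<Gamma>"
    unfolding \<Gamma>_def
  proof (rule continuous_on_track)
    show "continuous_on (points D \<times> {0..1}) (\<lambda>p. H (snd p, fst p))"
      by (rule continuous_on_compose2[OF H(1)])
        (use DC in \<open>auto intro!: continuous_on_Pair continuous_on_fst continuous_on_snd continuous_on_id\<close>)
  qed (auto intro: continuous_on_join_map simp: H(3), simp add: join_map_def)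
  have \<Gamma>X: "\<Gamma> (s, r) \<in> ?X" if s: "s \<in> points D" and r: "-1 \<le> r" "r \<le> 1" for s r
  proof (cases "r \<le> 0")
    case True
    then show ?thesis using KX[OF H(2)[of "-r" s]] DC[OF s] r by (simp add: \<Gamma>_def track_def)
  next
    case False
    then have "join_map w (s, r) \<in> points (cone w D)"
      using segment_in_cone[OF D(1) s, of r w] r by (simp add: join_map_def)
    then show ?thesis using False points_mono[of "cone w D" "K \<union> cone w D"] by (auto simp: \<Gamma>_def track_def)
  qed
  have \<Gamma>ends: "\<Gamma> (s, -1) = c" "\<Gamma> (s, 1) = vertex w" "\<Gamma> (s, 0) = s" for s
    by (simp_all add: \<Gamma>_def track_def H join_map_def)
  have \<Gamma>neg: "\<Gamma> (s, r) = H (- r, s)" if "r \<le> 0" for s r using that by (simp add: \<Gamma>_def track_def)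
  have \<Gamma>pos: "\<Gamma> (s, r) = join_map w (s, r)" if "0 \<le> r" for s r
    using that by (cases "r = 0") (simp_all add: \<Gamma>_def track_def H(3) join_map_def)
  have j0: "join_map w (s, 0) = s" for s by (simp add: join_map_def)
  let ?gl = "\<lambda>f \<phi>. glue (points (insert \<sigma> ?B)) (points ?B) (join_map w) f \<phi>"
  let ?T = "points (insert \<sigma> ?B) \<union> join_map w ` (points ?B \<times> {0..1})"
  note cint = continuous_on_Pair continuous_on_fst continuous_on_snd continuous_on_id continuous_on_const
    continuous_on_diff continuous_on_add continuous_on_mult
  have r1: "-1 \<le> t - (1 - t) * u" "t - (1 - t) * u \<le> 1" if "0 \<le> u" "u \<le> 1" "0 \<le> t" "t \<le> (1::real)" for u t
  proof -
    have "0 \<le> (1 - t) * u" "(1 - t) * u \<le> 1" using that by (auto intro!: mult_le_one)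
    then show "-1 \<le> t - (1 - t) * u" "t - (1 - t) * u \<le> 1" using that by linarith+
  qed
  have r3: "-1 \<le> (1 - u) * (2 * t - 1) + u" "(1 - u) * (2 * t - 1) + u \<le> 1" if "0 \<le> u" "u \<le> 1" "0 \<le> t" "t \<le> (1::real)" for u t
  proof -
    have "\<bar>(1 - u) * (2 * t - 1)\<bar> \<le> (1 - u) * 1"
      unfolding abs_mult using that by (intro mult_mono) auto
    then have a: "- (1 - u) \<le> (1 - u) * (2 * t - 1)" "(1 - u) * (2 * t - 1) \<le> 1 - u"
      by (simp_all only: abs_le_iff mult_1_right minus_le_iff)
    show "-1 \<le> (1 - u) * (2 * t - 1) + u" using add_mono[OF a(1) order_refl[of u]] that by simp
    show "(1 - u) * (2 * t - 1) + u \<le> 1" using add_mono[OF a(2) order_refl[of u]] that by simp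
  qed
  have s1: "homotopic_with_canon (\<lambda>_. True) ?T ?X
     (?gl (\<lambda>x. H (0, x)) (\<lambda>p. \<Gamma> (fst p, snd p - (1 - snd p) * 0)))
     (?gl (\<lambda>x. H (1, x)) (\<lambda>p. \<Gamma> (fst p, snd p - (1 - snd p) * 1)))"
  proof -
    have "homotopic_with_canon (\<lambda>_. True) ?T ?X
      (?gl (\<lambda>x. H (0, x)) (\<lambda>p. (\<lambda>z. \<Gamma> (fst (snd z), snd (snd z) - (1 - snd (snd z)) * fst z)) (0, p)))
      (?gl (\<lambda>x. H (1, x)) (\<lambda>p. (\<lambda>z. \<Gamma> (fst (snd z), snd (snd z) - (1 - snd (snd z)) * fst z)) (1, p)))"
    proof (rule glue_homotopic[OF ja(1)])
      show "continuous_on ({0..1} \<times> points (insert \<sigma> ?B)) H"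
        by (rule continuous_on_subset[OF H(1)]) (use EC' in auto)
      show "continuous_on ({0..1} \<times> points ?B \<times> {0..1})
          (\<lambda>z. \<Gamma> (fst (snd z), snd (snd z) - (1 - snd (snd z)) * fst z))"
        by (rule continuous_on_compose2[OF c\<Gamma>]) (intro cint, use BD r1 in auto)
    qed (use H \<Gamma>ends EC' KX BD \<Gamma>X r1 in \<open>simp_all add: \<Gamma>neg j0\<close>)
    then show ?thesis by simp
  qed
  have s2: "homotopic_with_canon (\<lambda>_. True) ?T ?X
     (?gl (\<lambda>x. c) (\<lambda>p. \<Gamma> (R (0, fst p), 2 * snd p - 1)))
     (?gl (\<lambda>x. c) (\<lambda>p. \<Gamma> (R (1, fst p), 2 * snd p - 1)))"
  proof -
    have "homotopic_with_canon (\<lambda>_. True) ?T ?X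
      (?gl (\<lambda>x. (\<lambda>_. c) (0, x)) (\<lambda>p. (\<lambda>z. \<Gamma> (R (fst z, fst (snd z)), 2 * snd (snd z) - 1)) (0, p)))
      (?gl (\<lambda>x. (\<lambda>_. c) (1, x)) (\<lambda>p. (\<lambda>z. \<Gamma> (R (fst z, fst (snd z)), 2 * snd (snd z) - 1)) (1, p)))"
    proof (rule glue_homotopic[OF ja(1)])
      have "continuous_on ({0..1} \<times> points ?B \<times> {0..1::real}) (\<lambda>z. R (fst z, fst (snd z)))"
        by (rule continuous_on_compose2[OF R(1)]) (intro cint, auto)
      then show "continuous_on ({0..1} \<times> points ?B \<times> {0..1})
          (\<lambda>z. \<Gamma> (R (fst z, fst (snd z)), 2 * snd (snd z) - 1))"
        by (intro continuous_on_compose2[OF c\<Gamma>] cint) (use R(2) in auto)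
      have "c \<in> points K" using H(2)[of 1, OF _ _ DC[OF u0]] H(4) by simp
      then show "c \<in> ?X" by (rule KX)
    qed (use R(2) \<Gamma>ends \<Gamma>X in simp_all)
    then show ?thesis by simp
  qed
  have s3: "homotopic_with_canon (\<lambda>_. True) ?T ?X
     (?gl (\<lambda>x. \<Gamma> (u0, 2 * 0 - 1)) (\<lambda>p. \<Gamma> (u0, (1 - 0) * (2 * snd p - 1) + 0)))
     (?gl (\<lambda>x. \<Gamma> (u0, 2 * 1 - 1)) (\<lambda>p. \<Gamma> (u0, (1 - 1) * (2 * snd p - 1) + 1)))"
  proof -
    have "homotopic_with_canon (\<lambda>_. True) ?T ?X
      (?gl (\<lambda>x. (\<lambda>z. \<Gamma> (u0, 2 * fst z - 1)) (0, x)) (\<lambda>p. (\<lambda>z. \<Gamma> (u0, (1 - fst z) * (2 * snd (snd z) - 1) + fst z)) (0, p)))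
      (?gl (\<lambda>x. (\<lambda>z. \<Gamma> (u0, 2 * fst z - 1)) (1, x)) (\<lambda>p. (\<lambda>z. \<Gamma> (u0, (1 - fst z) * (2 * snd (snd z) - 1) + fst z)) (1, p)))"
    proof (rule glue_homotopic[OF ja(1)])
      show "continuous_on ({0..1} \<times> points (insert \<sigma> ?B)) (\<lambda>z. \<Gamma> (u0, 2 * fst z - 1))"
        by (rule continuous_on_compose2[OF c\<Gamma>]) (intro cint, use u0 in auto)
      show "continuous_on ({0..1} \<times> points ?B \<times> {0..1::real})
          (\<lambda>z. \<Gamma> (u0, (1 - fst z) * (2 * snd (snd z) - 1) + fst z))"
        by (rule continuous_on_compose2[OF c\<Gamma>]) (intro cint, use u0 r3 in auto)
    qed (use u0 r3 \<Gamma>X \<Gamma>ends in simp_all)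
    then show ?thesis by simp
  qed
  have "homotopic_with_canon (\<lambda>_. True) ?T ?X
     (?gl (\<lambda>x. H (0, x)) (\<lambda>p. \<Gamma> (fst p, snd p)))
     (?gl (\<lambda>x. c) (\<lambda>p. \<Gamma> (fst p, 2 * snd p - 1)))"
    using s1 H(4) by simp
  moreover have "homotopic_with_canon (\<lambda>_. True) ?T ?X
     (?gl (\<lambda>x. c) (\<lambda>p. \<Gamma> (fst p, 2 * snd p - 1))) (?gl (\<lambda>x. c) (\<lambda>p. \<Gamma> (u0, 2 * snd p - 1)))"
    using s2 R(3,4) by simp
  moreover have "homotopic_with_canon (\<lambda>_. True) ?T ?X
     (?gl (\<lambda>x. c) (\<lambda>p. \<Gamma> (u0, 2 * snd p - 1))) (?gl (\<lambda>x. vertex w) (\<lambda>p. vertex w))"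
    using s3 \<Gamma>ends by simp
  ultimately have "homotopic_with_canon (\<lambda>_. True) ?T ?X
     (?gl (\<lambda>x. H (0, x)) (\<lambda>p. \<Gamma> (fst p, snd p))) (?gl (\<lambda>x. vertex w) (\<lambda>p. vertex w))"
    by (meson homotopic_with_trans)
  then show ?thesis unfolding dom
  proof (rule homotopic_with_eq)
    fix x assume "x \<in> topspace (top_of_set ?T)"
    then have "x \<in> ?T" by simp
    then consider "x \<in> points (insert \<sigma> ?B)" | s t where "s \<in> points ?B" "0 \<le> t" "t \<le> 1" "x = join_map w (s, t)"
      by auto
    then show "x = ?gl (\<lambda>x. H (0, x)) (\<lambda>p. \<Gamma> (fst p, snd p)) x"
    proof cases
      case 2
      then show ?thesis by (simp, subst glue_cone[OF ja(1)]) (simp_all add: \<Gamma>ends H(3) \<Gamma>pos j0)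
    qed (simp add: glue_base H(3))
  qed (simp_all add: glue_def)
qed

section \<open>Bouquets of simplex boundaries\<close>

definition sphere_vertices :: "(nat \<times> nat \<times> nat \<Rightarrow> 'a) \<Rightarrow> nat \<Rightarrow> nat \<Rightarrow> 'a set" where
  "sphere_vertices \<nu> d j = (\<lambda>k. \<nu> (d, j, k)) ` {..d}"

text \<open>
  The sphere labelled \<open>(d, j)\<close> is the boundary of a simplex with vertex
  \<open>v\<close> and \<open>d + 1\<close> vertices of its own, supplied by \<open>\<nu>\<close>.
  Thus wedges with further spheres stay simplicial complexes.
\<close>

definition bouquet :: "(nat \<times> nat \<times> nat \<Rightarrow> 'a) \<Rightarrow> 'a \<Rightarrow> (nat \<times> nat) set \<Rightarrow> 'a set set" where
  "bouquet \<nu> v S = insert {v} (\<Union>(d, j)\<in>S. boundary (insert v (sphere_vertices \<nu> d j)))"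

lemma complex_singleton: "simplicial_complex {{v}}"
  by (rule complexI) (auto simp: subset_singleton_iff)

lemma bouquet_insert: "bouquet \<nu> v (insert (d, j) S) = bouquet \<nu> v S \<union> boundary (insert v (sphere_vertices \<nu> d j))"
  by (auto simp: bouquet_def)

lemma complex_bouquet: "finite S \<Longrightarrow> simplicial_complex (bouquet \<nu> v S)"
proof (induction S rule: finite_induct)
  case empty
  then show ?case by (simp add: bouquet_def complex_singleton)
next
  case (insert x S)
  obtain d j where x: "x = (d, j)" by (cases x)
  show ?case unfolding x bouquet_insert
    by (intro complex_Un insert complex_boundary) (simp add: sphere_vertices_def)
qed

lemma bouquet_vertices: "\<tau> \<in> bouquet \<nu> v S \<Longrightarrow> \<tau> \<subseteq> insert v (range \<nu>)"
  by (auto simp: bouquet_def boundary_def sphere_vertices_def)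

text \<open>
  The bouquet meets \<open>K\<close> in \<open>v\<close> only, and \<open>v\<close> survives the
  collapse.
\<close>

lemma collapses_bouquet:
  assumes "collapses K K'" "simplicial_complex K" "{v} \<in> K'" "\<Union>K \<inter> range \<nu> = {}" "finite S"
  shows "realization (K \<union> bouquet \<nu> v S) homotopy_equivalent_space realization (K' \<union> bouquet \<nu> v S)"
proof -
  have "collapses (K \<union> bouquet \<nu> v S) (K' \<union> bouquet \<nu> v S)"
  proof (rule collapses_Un[OF assms(1)])
    fix \<tau> \<rho> assume *: "\<tau> \<in> bouquet \<nu> v S" "\<rho> \<subseteq> \<tau>" "\<rho> \<in> K"
    have "\<rho> \<subseteq> {v}" using bouquet_vertices[OF *(1)] *(2,3) assms(4) by blast
    moreover have "\<rho> \<noteq> {}" by (rule complexD(2)[OF assms(2) *(3)])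
    ultimately have "\<rho> = {v}" by blast
    then show "\<rho> \<in> K'" using assms(3) by simp
  qed
  then show ?thesis
    by (rule collapses_homotopy_equivalent) (intro complex_Un complex_bouquet assms)
qed

lemma points_singleton: "points {{v}} = {vertex v}"
proof -
  have "f x = vertex v x" if "f \<in> points {{v}}" for f x
  proof -
    have "{v. f v \<noteq> 0} = {v}" "sum f {v. f v \<noteq> 0} = 1" using that by (auto simp: points_def)
    then show ?thesis by (cases "x = v") (auto simp: vertex_def)
  qed
  then have "points {{v}} \<subseteq> {vertex v}" by blast
  moreover have "vertex v \<in> points {{v}}" by (rule vertex_in_points) simp
  ultimately show ?thesis by blast
qed

lemma boundary_null_of_collapsible:
  assumes U: "simplicial_complex U" "collapses U {{u}}" "boundary \<sigma> \<subseteq> U" "U \<subseteq> D"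
  obtains a where "homotopic_with_canon (\<lambda>_. True) (points (boundary \<sigma>)) (points D) (\<lambda>x. x) (\<lambda>_. a)"
proof -
  have "contractible_space (realization {{u}})"
    by (simp add: realization_eq points_singleton contractible_space_subtopology_singleton)
  then have "contractible_space (realization U)"
    using collapses_homotopy_equivalent[OF U(2,1)] homotopy_equivalent_space_contractibility by blast
  then obtain a where "homotopic_with_canon (\<lambda>_. True) (points U) (points U) id (\<lambda>_. a)"
    by (auto simp: realization_eq contractible_space_def)
  then have "homotopic_with_canon (\<lambda>_. True) (points (boundary \<sigma>)) (points D) (\<lambda>x. x) (\<lambda>_. a)"
    using homotopic_with_subset_left homotopic_with_subset_right points_mono[OF U(3)] points_mono[OF U(4)]
    unfolding id_def by blast
  then show thesis by (rule that)
qed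

lemma disjoint_insert_Un: "A \<subseteq> insert w (B \<union> B') \<Longrightarrow> w \<notin> R \<Longrightarrow> B \<inter> R = {} \<Longrightarrow> B' \<inter> R = {} \<Longrightarrow> A \<inter> R = {}"
  by blast

section \<open>Adding a cone over a filtered complex\<close>

text \<open>
  Cones with apex \<open>w\<close> over subcomplexes \<open>D\<close> of \<open>C\<close> are added
  to \<open>K\<close>, in which \<open>C\<close> can be contracted; spheres that split off are
  collected in a bouquet at \<open>v\<close>.
\<close>

locale coned_complex =
  fixes C K :: "'a set set" and w v :: 'a and \<nu> :: "nat \<times> nat \<times> nat \<Rightarrow> 'a" and c
  assumes C: "simplicial_complex C" and K: "simplicial_complex K" and CK: "C \<subseteq> K"
    and w: "w \<notin> \<Union>K" "w \<notin> range \<nu>" and \<nu>: "inj \<nu>" "\<Union>K \<inter> range \<nu> = {}"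
    and null: "homotopic_with_canon (\<lambda>_. True) (points C) (points K) (\<lambda>x. x) (\<lambda>_. c)"
begin

text \<open>
  A cell of \<open>C\<close> contributes a cell of one dimension more to the cone. Its boundary is
  null-homotopic by \<open>suspension_null\<close>, so it can be traded for a sphere of dimension
  \<open>card \<sigma>\<close>.
\<close>

lemma cone_cell_to_sphere:
  assumes D: "simplicial_complex D" "D \<subseteq> C" "{v} \<in> D"
    and \<sigma>: "\<sigma> \<in> C" "\<sigma> \<notin> D" "boundary \<sigma> \<subseteq> D" "2 \<le> card \<sigma>"
    and hom: "homotopic_with_canon (\<lambda>_. True) (points (boundary \<sigma>)) (points D) (\<lambda>x. x) (\<lambda>_. a)"
    and S: "finite S" "(card \<sigma>, j) \<notin> S"
  shows "realization (K \<union> cone w (insert \<sigma> D) \<union> bouquet \<nu> v S) homotopy_equivalent_space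
    realization (K \<union> cone w D \<union> bouquet \<nu> v (insert (card \<sigma>, j) S))"
proof -
  define E where "E = K \<union> cone w D \<union> bouquet \<nu> v S"
  let ?\<rho> = "sphere_vertices \<nu> (card \<sigma>) j"
  have fin: "finite \<sigma>" "\<sigma> \<noteq> {}" using complexD(1,2)[OF C \<sigma>(1)] by auto
  have \<sigma>K: "\<sigma> \<in> K" "w \<notin> \<sigma>" using \<sigma>(1) CK w(1) by auto
  have wC: "w \<notin> \<Union>C" using w CK by auto
  have vK: "v \<in> \<Union>K" "v \<noteq> w" using D CK w by auto
  have E: "simplicial_complex E" unfolding E_def
    by (intro complex_Un K complex_cone D complex_bouquet S)
  have fin_w: "finite (insert w \<sigma>)" "card (insert w \<sigma>) = Suc (card \<sigma>)" using fin \<sigma>K by auto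
  have wE: "insert w \<sigma> \<notin> E"
  proof
    assume "insert w \<sigma> \<in> E"
    moreover have "insert w \<sigma> \<notin> K" using w(1) by auto
    moreover have "insert w \<sigma> \<notin> bouquet \<nu> v S" using bouquet_vertices[of "insert w \<sigma>" \<nu> v S] w vK by auto
    moreover have "insert w \<sigma> \<notin> D" using w D CK by auto
    ultimately consider "insert w \<sigma> = {w}" | \<tau> where "\<tau> \<in> D" "insert w \<sigma> = insert w \<tau>"
      by (auto simp: E_def cone_def)
    then show False
    proof cases
      case 2
      then have "w \<notin> \<tau>" using w D CK by auto
      then have "\<sigma> = \<tau>" using 2(2) \<sigma>K(2) insert_ident by metis
      then show False using 2 \<sigma> by simp
    qed (use fin \<sigma>K in auto)
  qed
  have bE: "boundary (insert w \<sigma>) \<subseteq> E"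
    unfolding boundary_insert[OF \<sigma>K(2) fin(2)] using \<sigma>K(1) \<sigma>(3) by (auto simp: E_def cone_def)
  have card\<rho>: "card ?\<rho> = Suc (card \<sigma>)" "finite ?\<rho>" unfolding sphere_vertices_def
    using \<nu>(1) by (auto simp: card_image inj_on_def)
  then obtain b where b: "bij_betw b ?\<rho> (insert w \<sigma>)"
    using fin_w finite_same_card_bij by metis
  have \<rho>\<nu>: "?\<rho> \<subseteq> range \<nu>" by (auto simp: sphere_vertices_def)
  have disj: "?\<rho> \<inter> \<Union>E = {}"
  proof -
    have "?\<rho> \<inter> \<tau> = {}" if "\<tau> \<in> bouquet \<nu> v S" for \<tau>
    proof -
      have "\<tau> \<subseteq> insert v (\<Union>(d, i)\<in>S. sphere_vertices \<nu> d i)"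
        using that by (auto simp: bouquet_def boundary_def)
      moreover have "?\<rho> \<inter> sphere_vertices \<nu> d i = {}" if "(d, i) \<in> S" for d i
        using S(2) that \<nu>(1) by (auto simp: sphere_vertices_def dest: injD)
      moreover have "v \<notin> ?\<rho>" using vK \<nu>(2) \<rho>\<nu> by auto
      ultimately show ?thesis by fast
    qed
    moreover have "?\<rho> \<inter> \<Union>K = {}" using \<rho>\<nu> \<nu>(2) by auto
    moreover have "?\<rho> \<inter> \<Union>(cone w D) = {}"
    proof -
      have "\<Union>(cone w D) \<subseteq> insert w (\<Union>K)" using D CK by (auto simp: cone_def)
      then show ?thesis using \<rho>\<nu> \<nu>(2) w(2) by blast
    qed
    ultimately show ?thesis unfolding E_def by blast
  qed
  have vE: "{v} \<in> E" by (auto simp: E_def bouquet_def)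
  have KE: "points (K \<union> cone w D) \<subseteq> points E" by (rule points_mono) (auto simp: E_def)
  have "homotopic_with_canon (\<lambda>_. True) (points (boundary (insert w \<sigma>))) (points E) (\<lambda>x. x) (\<lambda>_. vertex w)"
    by (rule homotopic_with_subset_right[OF suspension_null[OF C K D(1,2) \<sigma>(1,3,4) wC null hom] KE])
  moreover have "homotopic_with_canon (\<lambda>_. True) (points (boundary (insert w \<sigma>))) (points E) (\<lambda>_. vertex v) (\<lambda>_. vertex w)"
  proof (rule homotopicI[of _ "\<lambda>z x. (1 - fst z) * vertex v x + fst z * vertex w x"])
    show "continuous_on ({0..1} \<times> points (boundary (insert w \<sigma>))) (\<lambda>z x. (1 - fst z) * vertex v x + fst z * vertex w x)"
      by (intro continuous_on_segment continuous_on_fst continuous_on_id continuous_on_const)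
    fix t :: real and x :: "'a \<Rightarrow> real" assume t: "0 \<le> t" "t \<le> 1"
    show "(\<lambda>x'. (1 - fst (t, x)) * vertex v x' + fst (t, x) * vertex w x') \<in> points E"
      using segment_in_cone[OF D(1) vertex_in_points[OF D(3)] t, of w] points_mono[of "cone w D" E]
      by (auto simp: E_def)
  qed auto
  ultimately have hn: "homotopic_with_canon (\<lambda>_. True) (points (boundary (insert w \<sigma>))) (points E) (\<lambda>x. x) (\<lambda>_. vertex v)"
    by (meson homotopic_with_symD homotopic_with_trans)
  have "realization (insert (insert w \<sigma>) E) homotopy_equivalent_space realization (E \<union> boundary (insert v ?\<rho>))"
    by (rule cell_to_sphere[OF E wE bE card\<rho>(2) _ disj b vE hn]) (use card\<rho> \<sigma> in simp)
  moreover have "insert (insert w \<sigma>) E = K \<union> cone w (insert \<sigma> D) \<union> bouquet \<nu> v S"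
    using \<sigma>K(1) by (auto simp: E_def cone_def)
  moreover have "E \<union> boundary (insert v ?\<rho>) = K \<union> cone w D \<union> bouquet \<nu> v (insert (card \<sigma>, j) S)"
    by (auto simp: E_def bouquet_insert)
  ultimately show ?thesis by simp
qed

lemma cone_cells_to_spheres:
  assumes F: "finite F" and D: "simplicial_complex D" "D \<subseteq> C" "{v} \<in> D" "D \<inter> F = {}"
    and cells: "\<And>\<sigma>. \<sigma> \<in> F \<Longrightarrow> \<sigma> \<in> C \<and> boundary \<sigma> \<subseteq> D \<and> card \<sigma> = d" and d: "2 \<le> d"
    and hom: "\<And>\<sigma>. \<sigma> \<in> F \<Longrightarrow> \<exists>a. homotopic_with_canon (\<lambda>_. True) (points (boundary \<sigma>)) (points D) (\<lambda>x. x) (\<lambda>_. a)"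
    and S: "finite S" "S \<inter> {d} \<times> {n..} = {}"
  shows "realization (K \<union> cone w (D \<union> F) \<union> bouquet \<nu> v S) homotopy_equivalent_space
    realization (K \<union> cone w D \<union> bouquet \<nu> v (S \<union> {d} \<times> {n..<n + card F}))"
  using F D(4) cells hom S
proof (induction F arbitrary: S n rule: finite_induct)
  case empty
  then show ?case by (simp add: homotopy_equivalent_space_refl)
next
  case (insert \<sigma> F)
  have \<sigma>: "\<sigma> \<in> C" "boundary \<sigma> \<subseteq> D" "card \<sigma> = d" "\<sigma> \<notin> D"
    using insert.prems(1) insert.prems(2)[of \<sigma>] by auto
  have cellsF: "\<tau> \<in> C \<and> boundary \<tau> \<subseteq> D" if "\<tau> \<in> F" for \<tau>
    using insert.prems(2)[of \<tau>] that by simp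
  have DF: "simplicial_complex (D \<union> F)"
  proof -
    have "simplicial_complex (D \<union> F')" if "F' \<subseteq> F" "finite F'" for F'
      using that(2,1)
    proof (induction F' rule: finite_induct)
      case empty
      then show ?case using D(1) by simp
    next
      case (insert \<tau> F')
      then have \<tau>: "\<tau> \<in> C" "boundary \<tau> \<subseteq> D" using cellsF[of \<tau>] by auto
      have "simplicial_complex (Set.insert \<tau> (D \<union> F'))"
        by (rule complex_insert) (use insert.IH insert.prems \<tau>(2) complexD(1,2)[OF C \<tau>(1)] in \<open>simp_all add: le_supI1\<close>)
      then show ?case by simp
    qed
    then show ?thesis using insert.hyps(1) by blast
  qed
  obtain a where "homotopic_with_canon (\<lambda>_. True) (points (boundary \<sigma>)) (points D) (\<lambda>x. x) (\<lambda>_. a)"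
    using insert.prems(3)[of \<sigma>] by auto
  then have a: "homotopic_with_canon (\<lambda>_. True) (points (boundary \<sigma>)) (points (D \<union> F)) (\<lambda>x. x) (\<lambda>_. a)"
    by (rule homotopic_with_subset_right) (rule points_mono, simp)
  have "realization (K \<union> cone w (Set.insert \<sigma> (D \<union> F)) \<union> bouquet \<nu> v S) homotopy_equivalent_space
    realization (K \<union> cone w (D \<union> F) \<union> bouquet \<nu> v (Set.insert (card \<sigma>, n) S))"
  proof (rule cone_cell_to_sphere[OF DF _ _ \<sigma>(1) _ _ _ a])
    show "D \<union> F \<subseteq> C" using D(2) insert.prems(2) by blast
    show "(card \<sigma>, n) \<notin> S" using \<sigma>(3) insert.prems(5) by auto
  qed (use D(3) \<sigma> d insert.hyps insert.prems(4) in auto)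
  moreover have "realization (K \<union> cone w (D \<union> F) \<union> bouquet \<nu> v (Set.insert (d, n) S)) homotopy_equivalent_space
    realization (K \<union> cone w D \<union> bouquet \<nu> v (Set.insert (d, n) S \<union> {d} \<times> {Suc n..<Suc n + card F}))"
  proof (rule insert.IH)
    show "Set.insert (d, n) S \<inter> {d} \<times> {Suc n..} = {}" using insert.prems(5) by auto
    show "\<tau> \<in> C \<and> boundary \<tau> \<subseteq> D \<and> card \<tau> = d" if "\<tau> \<in> F" for \<tau>
      using insert.prems(2)[of \<tau>] that by simp
    show "\<exists>a. homotopic_with_canon (\<lambda>_. True) (points (boundary \<tau>)) (points D) (\<lambda>x. x) (\<lambda>_. a)" if "\<tau> \<in> F" for \<tau>
      using insert.prems(3)[of \<tau>] that by simp
  qed (use insert.prems(1,4) in auto)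
  moreover have "Set.insert (d, n) S \<union> {d} \<times> {Suc n..<Suc n + card F} = S \<union> {d} \<times> {n..<n + card (Set.insert \<sigma> F)}"
    using insert.hyps by auto
  ultimately show ?case
    unfolding \<sigma>(3) Un_insert_right by (simp only:) (rule homotopy_eqv_trans)
qed

lemma cone_collapse:
  assumes "collapses D D'" "simplicial_complex D" "D \<subseteq> C" "{v} \<in> K" "finite S"
  shows "realization (K \<union> cone w D \<union> bouquet \<nu> v S) homotopy_equivalent_space
    realization (K \<union> cone w D' \<union> bouquet \<nu> v S)"
proof (rule collapses_bouquet)
  have "collapses (cone w D \<union> K) (cone w D' \<union> D \<union> K)"
  proof (rule collapses_Un[OF collapses_cone[OF assms(1,2)]])
    show "w \<notin> \<tau>" if "\<tau> \<in> D" for \<tau> using that assms(3) CK w(1) by blast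
    show "\<rho> \<in> cone w D' \<union> D" if "\<tau> \<in> K" "\<rho> \<subseteq> \<tau>" "\<rho> \<in> cone w D" for \<tau> \<rho>
      using that w(1) by (auto simp: cone_def)
  qed
  moreover have "cone w D' \<union> D \<union> K = K \<union> cone w D'" using assms(3) CK by auto
  ultimately show "collapses (K \<union> cone w D) (K \<union> cone w D')" by (simp add: Un_commute)
  show "simplicial_complex (K \<union> cone w D)" by (intro complex_Un K complex_cone assms)
  have "\<Union>(K \<union> cone w D) \<subseteq> insert w (\<Union>K)" using assms(3) CK by (auto simp: cone_def)
  then show "\<Union>(K \<union> cone w D) \<inter> range \<nu> = {}" using w(2) \<nu>(2) by blast
qed (use assms in auto)

lemma cone_collapse_point:
  assumes "{u} \<in> K" "{v} \<in> K" "finite S"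
  shows "realization (K \<union> cone w {{u}} \<union> bouquet \<nu> v S) homotopy_equivalent_space
    realization (K \<union> bouquet \<nu> v S)"
proof (rule collapses_bouquet)
  have "u \<noteq> w" using assms(1) w(1) by blast
  have "collapses (K \<union> cone w {{u}}) (delete_star {w} (K \<union> cone w {{u}}))"
    by (rule collapses.delete[OF collapses.none, of _ _ u]) (use \<open>u \<noteq> w\<close> w(1) in \<open>auto simp: cone_def\<close>)
  moreover have "delete_star {w} (K \<union> cone w {{u}}) = K"
    using w(1) assms(1) \<open>u \<noteq> w\<close> by (auto simp: cone_def delete_star_def)
  ultimately show "collapses (K \<union> cone w {{u}}) K" by simp
  show "simplicial_complex (K \<union> cone w {{u}})" by (intro complex_Un K complex_cone complex_singleton)
  have "\<Union>(K \<union> cone w {{u}}) \<subseteq> insert w (\<Union>K)" using assms(1) by (auto simp: cone_def)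
  then show "\<Union>(K \<union> cone w {{u}}) \<inter> range \<nu> = {}" using w(2) \<nu>(2) by blast
qed (use assms in auto)

text \<open>
  Both sides are collapses of \<open>K\<close> with a cone over all of \<open>L\<close>: the vertex
  \<open>w\<close> can be deleted since its link \<open>L\<close> is itself a cone, and the
  simplices of \<open>L\<close> outside \<open>K\<close> can be deleted since \<open>w\<close> is an
  apex for their links.
\<close>

lemma replace_cone:
  assumes L: "simplicial_complex L" "L \<inter> K = C" "{u} \<in> L" "\<And>\<tau>. \<tau> \<in> L \<Longrightarrow> insert u \<tau> \<in> L"
    and w': "w \<notin> \<Union>L" "\<Union>L \<inter> range \<nu> = {}" and v: "{v} \<in> K" and S: "finite S"
  shows "realization (L \<union> K \<union> bouquet \<nu> v S) homotopy_equivalent_space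
    realization (K \<union> cone w C \<union> bouquet \<nu> v S)"
proof -
  let ?M = "K \<union> cone w L"
  have M: "simplicial_complex ?M" by (intro complex_Un K complex_cone L)
  have "\<Union>?M \<subseteq> insert w (\<Union>K \<union> \<Union>L)" by (auto simp: cone_def)
  then have M\<nu>: "\<Union>?M \<inter> range \<nu> = {}" by (rule disjoint_insert_Un[OF _ w(2) \<nu>(2) w'(2)])
  have "u \<noteq> w" using L(3) w'(1) by blast
  have "collapses ?M (delete_star {w} ?M)"
  proof (rule collapses.delete[OF collapses.none, of _ _ u])
    show "insert u \<tau> \<in> ?M" if "\<tau> \<in> ?M" "{w} \<subseteq> \<tau>" for \<tau>
    proof -
      have "\<tau> \<notin> K" "\<tau> \<notin> L" using that(2) w(1) w'(1) by blast+
      then have "\<tau> = insert w {} \<or> (\<exists>\<tau>'\<in>L. \<tau> = insert w \<tau>')" using that(1) by (auto simp: cone_def)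
      then have "\<exists>\<tau>'\<in>L. insert u \<tau> = insert w \<tau>'"
        using L(3,4) insert_commute[of u w] by metis
      then show ?thesis unfolding cone_def by blast
    qed
  qed (use \<open>u \<noteq> w\<close> in \<open>simp_all add: cone_def\<close>)
  moreover have "delete_star {w} ?M = L \<union> K"
    using w(1) w'(1) by (auto simp: cone_def delete_star_def)
  ultimately have 1: "collapses ?M (L \<union> K)" by simp
  have "collapses ?M (delete_stars (L - K) ?M)"
  proof (rule collapses_delete_stars[OF M, where v = "\<lambda>_. w"])
    show "finite (L - K)" using complex_finite[OF L(1)] by simp
    show "\<sigma> \<noteq> {} \<and> w \<notin> \<sigma>" if "\<sigma> \<in> L - K" for \<sigma>
      using that complexD(2)[OF L(1)] w'(1) by blast
    show "insert w \<tau> \<in> ?M" if "\<sigma> \<in> L - K" "\<tau> \<in> ?M" "\<sigma> \<subseteq> \<tau>" for \<sigma> \<tau>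
    proof -
      have "\<sigma> \<noteq> {}" "\<sigma> \<notin> K" using that(1) complexD(2)[OF L(1)] by auto
      then have "\<tau> \<notin> K" using that(3) complexD(3)[OF K, of \<tau> \<sigma>] by auto
      then show ?thesis using that(2) by (auto simp: cone_def)
    qed
    show "\<sigma>' \<subseteq> \<tau>" if "\<sigma>' \<in> L - K" "\<sigma>' \<subseteq> insert w \<tau>" for \<sigma>' \<tau>
      using that w'(1) by blast
  qed
  moreover have "delete_stars (L - K) ?M = K \<union> cone w C"
  proof (intro set_eqI iffI)
    fix \<tau> assume "\<tau> \<in> delete_stars (L - K) ?M"
    then show "\<tau> \<in> K \<union> cone w C" using L(2) by (auto simp: delete_stars_def cone_def)
  next
    fix \<tau> assume \<tau>: "\<tau> \<in> K \<union> cone w C"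
    have "\<not> \<sigma> \<subseteq> \<tau>" if \<sigma>: "\<sigma> \<in> L - K" for \<sigma>
    proof
      assume sub: "\<sigma> \<subseteq> \<tau>"
      have "w \<notin> \<sigma>" "\<sigma> \<noteq> {}" using \<sigma> w'(1) complexD(2)[OF L(1)] by blast+
      then obtain \<tau>' where "\<tau>' \<in> K" "\<sigma> \<subseteq> \<tau>'" using \<tau> sub CK unfolding cone_def by blast
      then show False using complexD(3)[OF K, of \<tau>' \<sigma>] \<open>\<sigma> \<noteq> {}\<close> \<sigma> by auto
    qed
    then show "\<tau> \<in> delete_stars (L - K) ?M" using \<tau> L(2) by (auto simp: delete_stars_def cone_def)
  qed
  ultimately have 2: "collapses ?M (K \<union> cone w C)" by simp
  have "realization (?M \<union> bouquet \<nu> v S) homotopy_equivalent_space realization (L \<union> K \<union> bouquet \<nu> v S)"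
    by (rule collapses_bouquet[OF 1 M _ M\<nu> S]) (simp add: v)
  moreover have "realization (?M \<union> bouquet \<nu> v S) homotopy_equivalent_space realization (K \<union> cone w C \<union> bouquet \<nu> v S)"
    by (rule collapses_bouquet[OF 2 M _ M\<nu> S]) (simp add: v)
  ultimately show ?thesis
    using homotopy_eqv_trans homotopy_equivalent_space_sym by blast
qed

end

section \<open>Spheres as boundaries of simplices\<close>

definition unit_sphere :: "nat \<Rightarrow> (nat \<Rightarrow> real) set" where
  "unit_sphere d = {x. (\<Sum>i\<le>d. (x i)\<^sup>2) = 1 \<and> (\<forall>i>d. x i = 0)}"

lemma nsphere_eq: "nsphere d = top_of_set (unit_sphere d)"
  by (simp add: nsphere unit_sphere_def euclidean_product_topology)

lemma compact_unit_sphere: "compact (unit_sphere d)"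
proof -
  let ?P = "PiE UNIV (\<lambda>i. if i \<le> d then {-1..1::real} else {0})"
  have "unit_sphere d = ?P \<inter> {x. (\<Sum>i\<le>d. (x i)\<^sup>2) = 1}"
  proof (intro set_eqI iffI)
    fix x assume x: "x \<in> unit_sphere d"
    have "\<bar>x i\<bar> \<le> 1" if "i \<le> d" for i
    proof -
      have "(x i)\<^sup>2 \<le> (\<Sum>i\<le>d. (x i)\<^sup>2)" using that by (intro member_le_sum) auto
      then have "(x i)\<^sup>2 \<le> 1" using x by (simp add: unit_sphere_def)
      then show ?thesis by (simp add: abs_square_le_1)
    qed
    then show "x \<in> ?P \<inter> {x. (\<Sum>i\<le>d. (x i)\<^sup>2) = 1}" using x by (auto simp: unit_sphere_def PiE_iff abs_le_iff)
  next
    fix x assume "x \<in> ?P \<inter> {x. (\<Sum>i\<le>d. (x i)\<^sup>2) = 1}"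
    then have *: "\<And>i. x i \<in> (if i \<le> d then {-1..1} else {0})" "(\<Sum>i\<le>d. (x i)\<^sup>2) = 1" by (auto simp: PiE_iff)
    have "x i = 0" if "i > d" for i using *(1)[of i] that by simp
    then show "x \<in> unit_sphere d" using *(2) by (simp add: unit_sphere_def)
  qed
  moreover have "compact (?P \<inter> {x. (\<Sum>i\<le>d. (x i)\<^sup>2) = 1})"
  proof (rule compact_Int_closed)
    have "compactin (product_topology (\<lambda>i. euclidean) UNIV) ?P"
      by (subst compactin_PiE) auto
    then show "compact ?P" by (simp add: euclidean_product_topology)
    show "closed {x. (\<Sum>i\<le>d. (x i)\<^sup>2) = (1::real)}"
      by (rule closed_Collect_eq) (auto intro!: continuous_intros)
  qed
  ultimately show ?thesis by simp
qed

definition least :: "nat \<Rightarrow> (nat \<Rightarrow> real) \<Rightarrow> real" where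
  "least d x = Min (x ` {..Suc d})"

definition spread :: "nat \<Rightarrow> (nat \<Rightarrow> real) \<Rightarrow> real" where
  "spread d x = (\<Sum>i\<le>Suc d. x i - least d x)"

text \<open>
  Radial projection from the sphere to the boundary of a simplex: \<open>x (Suc d) = 0\<close>
  serves as last coordinate, then all coordinates are shifted to have minimum 0 and scaled to have
  sum 1.
\<close>

definition simplex_coords :: "nat \<Rightarrow> (nat \<Rightarrow> real) \<Rightarrow> nat \<Rightarrow> real" where
  "simplex_coords d x i = (if i \<le> Suc d then (x i - least d x) / spread d x else 0)"

lemma least_le: "i \<le> Suc d \<Longrightarrow> least d x \<le> x i"
  by (auto simp: least_def)

lemma least_attained: "\<exists>i\<le>Suc d. x i = least d x"
proof -
  have "least d x \<in> x ` {..Suc d}" unfolding least_def by (rule Min_in) auto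
  then show ?thesis by auto
qed

lemma spread_pos:
  assumes "x \<in> unit_sphere d"
  shows "0 < spread d x"
proof -
  have "0 \<le> spread d x" unfolding spread_def by (rule sum_nonneg) (use least_le in auto)
  moreover have "spread d x \<noteq> 0"
  proof
    assume "spread d x = 0"
    then have "x i = least d x" if "i \<le> Suc d" for i
      using sum_nonneg_eq_0_iff[of "{..Suc d}" "\<lambda>i. x i - least d x"] least_le that unfolding spread_def by force
    then have "x i = x (Suc d)" if "i \<le> Suc d" for i using that by (metis order_refl)
    moreover have "x (Suc d) = 0" using assms by (simp add: unit_sphere_def)
    ultimately have "(\<Sum>i\<le>d. (x i)\<^sup>2) = 0" by (intro sum.neutral) simp
    then show False using assms by (simp add: unit_sphere_def)
  qed
  ultimately show ?thesis by simp
qed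

lemma simplex_coords_in_points:
  assumes "x \<in> unit_sphere d"
  shows "simplex_coords d x \<in> points (boundary {..Suc d})"
proof -
  let ?f = "simplex_coords d x"
  have T: "0 < spread d x" by (rule spread_pos[OF assms])
  have "sum ?f {..Suc d} = (\<Sum>i\<le>Suc d. (x i - least d x) / spread d x)"
    by (rule sum.cong) (auto simp: simplex_coords_def)
  also have "\<dots> = 1" using T by (simp only: sum_divide_distrib[symmetric] spread_def[symmetric]) simp
  finally have sum: "sum ?f {..Suc d} = 1" .
  have supp: "{i. ?f i \<noteq> 0} \<subseteq> {..Suc d}" by (auto simp: simplex_coords_def)
  obtain i where "i \<le> Suc d" "x i = least d x" using least_attained by blast
  then have "?f i = 0" by (simp add: simplex_coords_def)
  then have "{i. ?f i \<noteq> 0} \<noteq> {..Suc d}" using \<open>i \<le> Suc d\<close> by blast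
  moreover have "{i. ?f i \<noteq> 0} \<noteq> {}"
  proof
    assume "{i. ?f i \<noteq> 0} = {}"
    then have "sum ?f {..Suc d} = 0" by (intro sum.neutral) blast
    then show False using sum by simp
  qed
  ultimately have "{i. ?f i \<noteq> 0} \<in> boundary {..Suc d}" using supp unfolding boundary_def by blast
  moreover have "0 \<le> ?f i" for i using T least_le[of i d x] by (simp add: simplex_coords_def)
  ultimately show ?thesis using points_iff[OF _ supp] sum by blast
qed

lemma simplex_coords_inj: "inj_on (simplex_coords d) (unit_sphere d)"
proof (rule inj_onI)
  fix x y assume x: "x \<in> unit_sphere d" and y: "y \<in> unit_sphere d" and eq: "simplex_coords d x = simplex_coords d y"
  have T: "0 < spread d x" "0 < spread d y" using spread_pos x y by auto
  have e: "(x i - least d x) / spread d x = (y i - least d y) / spread d y" if "i \<le> Suc d" for i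
    using fun_cong[OF eq, of i] that by (simp add: simplex_coords_def)
  have z: "x (Suc d) = 0" "y (Suc d) = 0" using x y by (auto simp: unit_sphere_def)
  have r: "x i / spread d x = y i / spread d y" if "i \<le> d" for i
    using e[of i] e[of "Suc d"] that by (simp add: z diff_divide_distrib)
  have "(\<Sum>i\<le>d. (x i / spread d x)\<^sup>2) = (\<Sum>i\<le>d. (y i / spread d y)\<^sup>2)"
    by (rule sum.cong) (simp_all add: r)
  then have "1 / (spread d x)\<^sup>2 = 1 / (spread d y)\<^sup>2"
    using x y by (simp add: power_divide unit_sphere_def flip: sum_divide_distrib)
  then have "(spread d x)\<^sup>2 = (spread d y)\<^sup>2" using T by (simp add: field_simps)
  then have "spread d x = spread d y" using T by (simp add: power2_eq_iff_nonneg)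
  then have "x i = y i" if "i \<le> d" for i using r[OF that] T by simp
  moreover have "x i = y i" if "\<not> i \<le> d" for i using x y that by (simp add: unit_sphere_def)
  ultimately show "x = y" by blast
qed

text \<open>
  The preimage of \<open>f\<close> is the normalization of \<open>i \<mapsto> f i - f (Suc
  d)\<close>; that vector is not 0 because \<open>f\<close> has a zero coordinate.
\<close>

lemma simplex_coords_surj:
  assumes f: "f \<in> points (boundary {..Suc d})"
  shows "f \<in> simplex_coords d ` unit_sphere d"
proof -
  have supp: "{i. f i \<noteq> 0} \<subseteq> {..Suc d}" and f0: "\<And>i. 0 \<le> f i" using f by (auto simp: points_def boundary_def)
  have sum: "sum f {..Suc d} = 1" using f points_iff[OF _ supp] by blast
  obtain z where z: "z \<le> Suc d" "f z = 0" using points_boundary_zero[OF f] by auto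
  define g where "g i = f i - f (Suc d)" for i
  define N where "N = sqrt (\<Sum>i\<le>d. (g i)\<^sup>2)"
  have "(\<Sum>i\<le>d. (g i)\<^sup>2) \<noteq> 0"
  proof
    assume "(\<Sum>i\<le>d. (g i)\<^sup>2) = 0"
    then have "g i = 0" if "i \<le> d" for i
      using sum_nonneg_eq_0_iff[of "{..d}" "\<lambda>i. (g i)\<^sup>2"] that by auto
    then have "f i = f (Suc d)" if "i \<le> Suc d" for i using that by (cases "i = Suc d") (auto simp: g_def)
    then have "f i = 0" if "i \<le> Suc d" for i using z that by metis
    then have "sum f {..Suc d} = 0" by (intro sum.neutral) auto
    then show False using sum by simp
  qed
  moreover have "0 \<le> (\<Sum>i\<le>d. (g i)\<^sup>2)" by (rule sum_nonneg) simp
  ultimately have N: "0 < N" "N\<^sup>2 = (\<Sum>i\<le>d. (g i)\<^sup>2)" by (auto simp: N_def)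
  define x where "x i = (if i \<le> Suc d then g i / N else 0)" for i
  have "(\<Sum>i\<le>d. (x i)\<^sup>2) = (\<Sum>i\<le>d. (g i)\<^sup>2 / N\<^sup>2)"
    by (rule sum.cong) (auto simp: x_def power_divide)
  also have "\<dots> = N\<^sup>2 / N\<^sup>2" by (simp only: sum_divide_distrib[symmetric] N(2)[symmetric])
  also have "\<dots> = 1" using N(1) by simp
  finally have xs: "x \<in> unit_sphere d" by (auto simp: unit_sphere_def x_def g_def le_Suc_eq)
  have xz: "x z = - f (Suc d) / N" using z by (simp add: x_def g_def)
  have "least d x = - f (Suc d) / N"
    unfolding least_def
  proof (rule Min_eqI)
    show "- f (Suc d) / N \<in> x ` {..Suc d}" using xz z(1) by (intro image_eqI[of _ _ z]) auto
    show "- f (Suc d) / N \<le> y" if yx: "y \<in> x ` {..Suc d}" for y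
    proof -
      obtain i where i: "i \<le> Suc d" "y = x i" using yx by auto
      then have "y - (- f (Suc d) / N) = f i / N" by (simp add: x_def g_def diff_divide_distrib)
      also have "\<dots> \<ge> 0" using f0 N by simp
      finally show ?thesis by simp
    qed
  qed simp
  then have xl: "x i - least d x = f i / N" if "i \<le> Suc d" for i
    using that by (simp add: x_def g_def diff_divide_distrib)
  have "spread d x = (\<Sum>i\<le>Suc d. f i / N)" unfolding spread_def by (rule sum.cong) (simp_all add: xl del: sum.atMost_Suc)
  also have "\<dots> = 1 / N" by (simp only: sum_divide_distrib[symmetric] sum)
  finally have "simplex_coords d x i = f i" for i
    using xl[of i] N supp by (auto simp: simplex_coords_def)
  then have "f = simplex_coords d x" by auto
  then show ?thesis using xs by blast
qed

lemma simplex_coords_base: "simplex_coords d sphere_base = vertex 0"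
proof -
  have l: "least d sphere_base = 0" unfolding least_def
    by (rule Min_eqI) (auto simp: sphere_base_def intro!: image_eqI[of _ _ "Suc d"])
  have "spread d sphere_base = (\<Sum>i\<in>{0}. sphere_base i)" unfolding spread_def l diff_0_right
    by (rule sum.mono_neutral_right) (auto simp: sphere_base_def)
  then have s: "spread d sphere_base = 1" by (simp add: sphere_base_def)
  show ?thesis
    by (rule ext) (simp add: simplex_coords_def l s vertex_def, simp add: sphere_base_def)
qed

lemma continuous_on_simplex_coords: "continuous_on (unit_sphere d) (simplex_coords d)"
proof (rule continuous_on_coordinatewise_then_product)
  fix i
  have l: "continuous_on (unit_sphere d) (least d)"
    unfolding least_def by (rule continuous_on_Min_coord) auto
  then have "continuous_on (unit_sphere d) (spread d)"
    unfolding spread_def by (intro continuous_intros)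
  then show "continuous_on (unit_sphere d) (\<lambda>x. simplex_coords d x i)"
    using l less_imp_neq[OF spread_pos[of _ d]] unfolding simplex_coords_def
    by (cases "i \<le> Suc d") (auto intro!: continuous_on_divide continuous_on_diff continuous_on_coord)
qed

definition vertex_index :: "(nat \<times> nat \<times> nat \<Rightarrow> 'a) \<Rightarrow> 'a \<Rightarrow> 'a \<Rightarrow> nat" where
  "vertex_index \<nu> v u = (if u = v then 0 else Suc (snd (snd (inv \<nu> u))))"

definition sphere_map :: "(nat \<times> nat \<times> nat \<Rightarrow> 'a) \<Rightarrow> 'a \<Rightarrow> nat \<Rightarrow> nat \<Rightarrow> (nat \<Rightarrow> real) \<Rightarrow> 'a \<Rightarrow> real" where
  "sphere_map \<nu> v d j x = relabel (vertex_index \<nu> v) (insert v (sphere_vertices \<nu> d j)) (simplex_coords d x)"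

lemma bij_vertex_index:
  assumes "inj \<nu>" "v \<notin> range \<nu>"
  shows "bij_betw (vertex_index \<nu> v) (insert v (sphere_vertices \<nu> d j)) {..Suc d}"
proof -
  have *: "vertex_index \<nu> v (\<nu> (d, j, k)) = Suc k" for k
    using assms by (auto simp: vertex_index_def)
  have v: "vertex_index \<nu> v v = 0" by (simp add: vertex_index_def)
  have "inj_on (vertex_index \<nu> v) (insert v (sphere_vertices \<nu> d j))"
    by (rule inj_onI) (auto simp: sphere_vertices_def * v)
  moreover have "vertex_index \<nu> v ` insert v (sphere_vertices \<nu> d j) = {..Suc d}"
    by (simp add: sphere_vertices_def image_image * v atMost_Suc_eq_insert_0)
  ultimately show ?thesis by (simp add: bij_betw_def)
qed

lemma sphere_map:
  assumes "inj \<nu>" "v \<notin> range \<nu>"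
  shows "sphere_map \<nu> v d j ` unit_sphere d = points (boundary (insert v (sphere_vertices \<nu> d j)))"
    "inj_on (sphere_map \<nu> v d j) (unit_sphere d)"
    "continuous_on (unit_sphere d) (sphere_map \<nu> v d j)"
    "sphere_map \<nu> v d j sphere_base = vertex v"
proof -
  let ?\<sigma> = "insert v (sphere_vertices \<nu> d j)" and ?b = "vertex_index \<nu> v"
  have b: "bij_betw ?b ?\<sigma> {..Suc d}" by (rule bij_vertex_index[OF assms])
  have fin: "finite ?\<sigma>" by (simp add: sphere_vertices_def)
  have bi: "bij_betw (inv_into ?\<sigma> ?b) {..Suc d} ?\<sigma>" by (rule bij_betw_inv_into[OF b])
  show "sphere_map \<nu> v d j ` unit_sphere d = points (boundary ?\<sigma>)"
  proof
    show "sphere_map \<nu> v d j ` unit_sphere d \<subseteq> points (boundary ?\<sigma>)"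
      using relabel_in_points(1)[OF b fin simplex_coords_in_points] by (auto simp: sphere_map_def)
    show "points (boundary ?\<sigma>) \<subseteq> sphere_map \<nu> v d j ` unit_sphere d"
    proof
      fix f assume f: "f \<in> points (boundary ?\<sigma>)"
      have "relabel (inv_into ?\<sigma> ?b) {..Suc d} f \<in> points (boundary {..Suc d})"
        by (rule relabel_in_points(1)[OF bi _ f]) simp
      then obtain x where x: "x \<in> unit_sphere d" "relabel (inv_into ?\<sigma> ?b) {..Suc d} f = simplex_coords d x"
        using simplex_coords_surj by blast
      then have "f = sphere_map \<nu> v d j x"
        using relabel_inverse[OF b f] by (simp add: sphere_map_def)
      then show "f \<in> sphere_map \<nu> v d j ` unit_sphere d" using x by blast
    qed
  qed
  show "inj_on (sphere_map \<nu> v d j) (unit_sphere d)"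
  proof (rule inj_onI)
    fix x y assume x: "x \<in> unit_sphere d" and y: "y \<in> unit_sphere d" and eq: "sphere_map \<nu> v d j x = sphere_map \<nu> v d j y"
    have "simplex_coords d x i = simplex_coords d y i" for i
    proof (cases "i \<le> Suc d")
      case True
      then show ?thesis
        using relabel_in_points(2)[OF b fin simplex_coords_in_points[OF x], of i]
          relabel_in_points(2)[OF b fin simplex_coords_in_points[OF y], of i] eq
        by (simp add: sphere_map_def)
    qed (simp add: simplex_coords_def)
    then have "simplex_coords d x = simplex_coords d y" by blast
    then show "x = y" using simplex_coords_inj x y by (metis inj_onD)
  qed
  show "continuous_on (unit_sphere d) (sphere_map \<nu> v d j)"
  proof (rule continuous_on_coordinatewise_then_product)
    fix u
    have "continuous_on (unit_sphere d) (\<lambda>x. simplex_coords d x (?b u))"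
      by (rule continuous_on_product_then_coordinatewise[OF continuous_on_simplex_coords])
    then show "continuous_on (unit_sphere d) (\<lambda>x. sphere_map \<nu> v d j x u)"
      unfolding sphere_map_def relabel_def by (cases "u \<in> ?\<sigma>") (auto simp: continuous_on_const)
  qed
  show "sphere_map \<nu> v d j sphere_base = vertex v"
    by (auto simp: sphere_map_def simplex_coords_base relabel_def vertex_def vertex_index_def fun_eq_iff)
qed

section \<open>Wedges\<close>

lemma continuous_map_from_wedge:
  assumes "\<And>i. i \<in> I \<Longrightarrow> continuous_map (X i) Z (\<lambda>x. f (wedge_in p i x))" "f None \<in> topspace Z"
  shows "continuous_map (wedge I X p) Z f"
  unfolding continuous_map_def
proof (intro conjI allI impI)
  have im: "f (wedge_in p i x) \<in> topspace Z" if "i \<in> I" "x \<in> topspace (X i)" for i x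
    using continuous_map_image_subset_topspace[OF assms(1)[OF that(1)]] that(2) by blast
  then show "f \<in> topspace (wedge I X p) \<rightarrow> topspace Z"
    using assms(2) by (auto simp: topspace_wedge)
  fix U assume "openin Z U"
  then have "openin (X i) {x \<in> topspace (X i). f (wedge_in p i x) \<in> U}" if "i \<in> I" for i
    using assms(1)[OF that] by (simp add: continuous_map_def)
  moreover have "{x \<in> topspace (X i). wedge_in p i x \<in> {y \<in> topspace (wedge I X p). f y \<in> U}}
      = {x \<in> topspace (X i). f (wedge_in p i x) \<in> U}" if "i \<in> I" for i
    using that by (auto simp: topspace_wedge)
  ultimately show "openin (wedge I X p) {x \<in> topspace (wedge I X p). f x \<in> U}"
    unfolding openin_wedge by (auto simp: topspace_wedge)
qed

lemma continuous_map_wedge_in: "i \<in> I \<Longrightarrow> continuous_map (X i) (wedge I X p) (wedge_in p i)"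
  unfolding continuous_map_def by (auto simp: openin_wedge topspace_wedge)

lemma compact_space_wedge:
  assumes "finite I" "\<And>i. i \<in> I \<Longrightarrow> compact_space (X i)"
  shows "compact_space (wedge I X p)"
proof -
  have "compactin (wedge I X p) (wedge_in p i ` topspace (X i))" if "i \<in> I" for i
    by (rule image_compactin[OF _ continuous_map_wedge_in[OF that]])
      (use assms(2)[OF that] in \<open>simp add: compact_space_def\<close>)
  then have "compactin (wedge I X p) (\<Union>i\<in>I. wedge_in p i ` topspace (X i))"
    using assms(1) by (intro compactin_Union) auto
  moreover have "compactin (wedge I X p) {None}"
    by (simp add: topspace_wedge)
  ultimately have "compactin (wedge I X p) ({None} \<union> (\<Union>i\<in>I. wedge_in p i ` topspace (X i)))"
    by (rule compactin_Un[rotated])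
  then show ?thesis by (simp add: compact_space_def topspace_wedge)
qed

definition sphere_labels :: "nat \<Rightarrow> nat \<Rightarrow> (nat \<times> nat) set" where
  "sphere_labels a b = {3} \<times> {0..<a} \<union> {4} \<times> {0..<b}"

definition bouquet_map ::
    "(nat \<times> nat \<times> nat \<Rightarrow> 'a) \<Rightarrow> 'a \<Rightarrow> (bool \<times> (nat \<times> (nat \<Rightarrow> real)) option) option \<Rightarrow> 'a \<Rightarrow> real" where
  "bouquet_map \<nu> v z = (case z of None \<Rightarrow> vertex v | Some (s, y) \<Rightarrow>
     (case y of None \<Rightarrow> vertex v | Some (j, x) \<Rightarrow> sphere_map \<nu> v (if s then 3 else 4) j x))"

lemma points_bouquet:
  "points (bouquet \<nu> v S) = insert (vertex v) (\<Union>(d, j)\<in>S. points (boundary (insert v (sphere_vertices \<nu> d j))))"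
proof -
  have "points (bouquet \<nu> v S) = points {{v}} \<union> (\<Union>(d, j)\<in>S. points (boundary (insert v (sphere_vertices \<nu> d j))))"
    unfolding bouquet_def points_def by blast
  then show ?thesis by (simp add: points_singleton)
qed

text \<open>
  A continuous bijection from a compact space onto a Hausdorff space is a homeomorphism.
\<close>

lemma bouquet_homeomorphic_wedge:
  assumes \<nu>: "inj \<nu>" "v \<notin> range \<nu>"
  shows "wedge2 (sphere_wedge 3 a) None (sphere_wedge 4 b) None homeomorphic_space
    realization (bouquet \<nu> v (sphere_labels a b))"
proof -
  let ?W = "wedge2 (sphere_wedge 3 a) None (sphere_wedge 4 b) None"
  let ?P = "points (bouquet \<nu> v (sphere_labels a b))"
  let ?\<psi> = "sphere_map \<nu> v"
  have lab: "(d, j) \<in> sphere_labels a b \<longleftrightarrow> (d = 3 \<and> j < a) \<or> (d = 4 \<and> j < b)" for d j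
    by (auto simp: sphere_labels_def)
  have ts: "topspace (nsphere d) = unit_sphere d" for d by (simp add: nsphere_eq)
  have \<psi>P: "?\<psi> d j x \<in> ?P" if "(d, j) \<in> sphere_labels a b" "x \<in> unit_sphere d" for d j x
  proof -
    have "?\<psi> d j x \<in> points (boundary (insert v (sphere_vertices \<nu> d j)))"
      using sphere_map(1)[OF \<nu>, of d j] that(2) by blast
    then show ?thesis using that(1) by (auto simp: points_bouquet)
  qed
  have inner: "continuous_map (sphere_wedge d n) (top_of_set ?P)
      (\<lambda>y. case y of None \<Rightarrow> vertex v | Some (j, x) \<Rightarrow> ?\<psi> d j x)"
    if "\<And>j. j < n \<Longrightarrow> (d, j) \<in> sphere_labels a b" for d n
    unfolding sphere_wedge_def
  proof (rule continuous_map_from_wedge)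
    fix j assume j: "j \<in> {..<n}"
    have "(case wedge_in (\<lambda>_. sphere_base) j x of None \<Rightarrow> vertex v | Some (j, x) \<Rightarrow> ?\<psi> d j x) = ?\<psi> d j x" for x
      by (simp add: wedge_in_def sphere_map(4)[OF \<nu>])
    then show "continuous_map (nsphere d) (top_of_set ?P)
        (\<lambda>x. case wedge_in (\<lambda>_. sphere_base) j x of None \<Rightarrow> vertex v | Some (j, x) \<Rightarrow> ?\<psi> d j x)"
      using sphere_map(3)[OF \<nu>, of d j] \<psi>P[OF that] j by (auto simp: nsphere_eq)
  qed (simp add: points_bouquet)
  have cont: "continuous_map ?W (top_of_set ?P) (bouquet_map \<nu> v)"
    unfolding wedge2_def
  proof (rule continuous_map_from_wedge)
    fix s :: bool
    have eq: "bouquet_map \<nu> v (wedge_in (\<lambda>b. if b then None else None) s y)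
        = (case y of None \<Rightarrow> vertex v | Some (j, x) \<Rightarrow> ?\<psi> (if s then 3 else 4) j x)" for y
      by (auto simp: wedge_in_def bouquet_map_def)
    show "continuous_map (if s then sphere_wedge 3 a else sphere_wedge 4 b) (top_of_set ?P)
        (\<lambda>y. bouquet_map \<nu> v (wedge_in (\<lambda>b. if b then None else None) s y))"
      unfolding eq using inner[of a 3] inner[of b 4] lab by (cases s) simp_all
  qed (simp add: points_bouquet bouquet_map_def)
  have comp: "compact_space ?W"
  proof -
    have "compact_space (sphere_wedge d n)" for d n
      unfolding sphere_wedge_def
      by (rule compact_space_wedge) (simp_all add: nsphere_eq compact_space_subtopology compact_unit_sphere)
    then show ?thesis
      unfolding wedge2_def by (intro compact_space_wedge) simp_all
  qed
  have mem: "z \<in> topspace ?W \<longleftrightarrow> z = None \<or> (\<exists>s j x. z = Some (s, Some (j, x)) \<and>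
      (if s then 3 else 4, j) \<in> sphere_labels a b \<and> x \<in> unit_sphere (if s then 3 else 4) \<and> x \<noteq> sphere_base)" for z
  proof -
    have sw: "y \<in> topspace (sphere_wedge d n) \<longleftrightarrow> y = None \<or> (\<exists>j x. y = Some (j, x) \<and> j < n \<and> x \<in> unit_sphere d \<and> x \<noteq> sphere_base)" for y d n
      using sphere_base_in_nsphere[of d]
      by (auto simp: sphere_wedge_def topspace_wedge ts wedge_in_def image_iff)
    have "z \<in> topspace ?W \<longleftrightarrow> z = None \<or> (\<exists>s y. z = Some (s, y) \<and> y \<noteq> None \<and> y \<in> topspace (if s then sphere_wedge 3 a else sphere_wedge 4 b))"
      by (auto simp: wedge2_def topspace_wedge wedge_in_def image_iff)
    then show ?thesis by (auto simp: sw lab split: if_splits)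
  qed
  have surj: "bouquet_map \<nu> v ` topspace ?W = ?P"
  proof
    show "bouquet_map \<nu> v ` topspace ?W \<subseteq> ?P"
      using continuous_map_image_subset_topspace[OF cont] by auto
    show "?P \<subseteq> bouquet_map \<nu> v ` topspace ?W"
    proof
      fix f assume f: "f \<in> ?P"
      show "f \<in> bouquet_map \<nu> v ` topspace ?W"
      proof (cases "f = vertex v")
        case True
        then have "f = bouquet_map \<nu> v None" by (simp add: bouquet_map_def)
        moreover have "None \<in> topspace ?W" by (simp add: mem)
        ultimately show ?thesis by blast
      next
        case False
        then obtain d j where dj: "(d, j) \<in> sphere_labels a b" "f \<in> points (boundary (insert v (sphere_vertices \<nu> d j)))"
          using f by (auto simp: points_bouquet)
        then obtain x where x: "x \<in> unit_sphere d" "f = ?\<psi> d j x" using sphere_map(1)[OF \<nu>, of d j] by blast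
        then have "x \<noteq> sphere_base" using False sphere_map(4)[OF \<nu>] by auto
        have "d = (if d = 3 then 3 else 4)" using dj(1) lab by auto
        then have "f = bouquet_map \<nu> v (Some (d = 3, Some (j, x)))" using x by (simp add: bouquet_map_def)
        moreover have "Some (d = 3, Some (j, x)) \<in> topspace ?W"
          unfolding mem using dj(1) x(1) \<open>x \<noteq> sphere_base\<close> \<open>d = (if d = 3 then 3 else 4)\<close> by auto
        ultimately show ?thesis by blast
      qed
    qed
  qed
  have nv: "?\<psi> d j x \<noteq> vertex v" if "x \<in> unit_sphere d" "x \<noteq> sphere_base" for d j x
    using sphere_map(2,4)[OF \<nu>, of d j] sphere_base_in_nsphere[of d] that
    by (metis inj_onD ts)
  have same: "d = d' \<and> j = j'" if "x \<in> unit_sphere d" "x \<noteq> sphere_base" "x' \<in> unit_sphere d'" "?\<psi> d j x = ?\<psi> d' j' x'" for d j x d' j' x'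
  proof -
    have f: "?\<psi> d j x \<in> points (boundary (insert v (sphere_vertices \<nu> d j)))"
      "?\<psi> d j x \<in> points (boundary (insert v (sphere_vertices \<nu> d' j')))"
      using sphere_map(1)[OF \<nu>] that by (metis imageI)+
    let ?S = "{u. ?\<psi> d j x u \<noteq> 0}"
    have S: "?S \<subseteq> insert v (sphere_vertices \<nu> d j)" "?S \<subseteq> insert v (sphere_vertices \<nu> d' j')"
      using f by (auto simp: points_def boundary_def)
    have "\<not> ?S \<subseteq> {v}"
    proof
      assume "?S \<subseteq> {v}"
      moreover have "?S \<noteq> {}" by (rule points_not_zero[OF f(1)])
      ultimately have "?S = {v}" by blast
      then have "?\<psi> d j x \<in> points (bouquet \<nu> v {})" using f(1) by (simp add: points_def bouquet_def)
      then show False using nv[OF that(1,2)] by (simp add: points_bouquet)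
    qed
    then obtain u where "u \<in> sphere_vertices \<nu> d j" "u \<in> sphere_vertices \<nu> d' j'" using S by blast
    then show ?thesis using \<nu>(1) by (auto simp: sphere_vertices_def dest: injD)
  qed
  have only_base: "z = None" if zW: "z \<in> topspace ?W" and zv: "bouquet_map \<nu> v z = vertex v" for z
  proof (rule ccontr)
    assume "z \<noteq> None"
    then obtain s j x where z: "z = Some (s, Some (j, x))" "x \<in> unit_sphere (if s then 3 else 4)" "x \<noteq> sphere_base"
      using zW unfolding mem by auto
    then show False using zv nv[OF z(2,3), of j] by (simp add: bouquet_map_def)
  qed
  have inj: "inj_on (bouquet_map \<nu> v) (topspace ?W)"
  proof (rule inj_onI)
    fix y z assume yz: "y \<in> topspace ?W" "z \<in> topspace ?W" and eq: "bouquet_map \<nu> v y = bouquet_map \<nu> v z"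
    show "y = z"
    proof (cases "y = None \<or> z = None")
      case True
      moreover have "bouquet_map \<nu> v None = vertex v" by (simp add: bouquet_map_def)
      ultimately show ?thesis using only_base[OF yz(1)] only_base[OF yz(2)] eq by metis
    next
      case False
      let ?d = "\<lambda>s. if s then 3 else 4 :: nat"
      obtain s j x where y: "y = Some (s, Some (j, x))" "x \<in> unit_sphere (?d s)" "x \<noteq> sphere_base"
        using yz(1) False unfolding mem by auto
      obtain s' j' x' where z: "z = Some (s', Some (j', x'))" "x' \<in> unit_sphere (?d s')"
        using yz(2) False unfolding mem by auto
      have e: "?\<psi> (?d s) j x = ?\<psi> (?d s') j' x'" using eq y z by (simp add: bouquet_map_def)
      have dj: "?d s = ?d s' \<and> j = j'" by (rule same[OF y(2,3) z(2) e])
      then have sj: "s = s'" "j = j'" by (cases s; cases s'; simp)+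
      have "x = x'"
        by (rule inj_onD[OF sphere_map(2)[OF \<nu>, of "?d s" j]]) (use e y(2) z(2) sj in simp_all)
      then show ?thesis using sj y z by simp
    qed
  qed
  have haus: "Hausdorff_space (euclidean :: ('a \<Rightarrow> real) topology)"
    unfolding euclidean_product_topology[symmetric] by (simp add: Hausdorff_space_product_topology)
  have "homeomorphic_map ?W (top_of_set ?P) (bouquet_map \<nu> v)"
    by (rule continuous_imp_homeomorphic_map[OF cont comp])
      (use surj inj haus in \<open>simp_all add: Hausdorff_space_subtopology\<close>)
  then show ?thesis
    unfolding realization_eq by (rule homeomorphic_map_imp_homeomorphic_space)
qed

section \<open>The overlap of the two subcomplexes\<close>

lemma complex_generated:
  assumes "finite A" "\<And>\<sigma>. \<sigma> \<in> A \<Longrightarrow> finite \<sigma>"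
  shows "simplicial_complex (generated_complex A)"
proof (rule complexI)
  have "generated_complex A \<subseteq> Pow (\<Union>A)" by (auto simp: generated_complex_def)
  then show "finite (generated_complex A)" by (rule finite_subset) (use assms in auto)
  show "finite \<tau>" if "\<tau> \<in> generated_complex A" for \<tau>
    using that assms(2) by (auto simp: generated_complex_def intro: finite_subset)
  show "\<rho> \<in> generated_complex A" if \<tau>: "\<tau> \<in> generated_complex A" and \<rho>: "\<rho> \<noteq> {}" "\<rho> \<subseteq> \<tau>" for \<tau> \<rho>
  proof -
    obtain \<sigma> where "\<sigma> \<in> A" "\<tau> \<subseteq> \<sigma>" using \<tau> by (auto simp: generated_complex_def)
    then have "\<exists>\<sigma>\<in>A. \<rho> \<subseteq> \<sigma>" using \<rho>(2) by (blast intro: subset_trans)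
    then show ?thesis using \<rho>(1) by (simp add: generated_complex_def)
  qed
qed (simp add: generated_complex_def)

lemma pair_eq [simp]: "{a, b} = {a, c} \<longleftrightarrow> b = c" "{b, a} = {a, c} \<longleftrightarrow> b = c"
    "{a, b} = {c, a} \<longleftrightarrow> b = c" "{b, a} = {c, a} \<longleftrightarrow> b = c"
  by (auto simp: doubleton_eq_iff)

lemma subset_without5: "A \<subseteq> {a, b, c, d, e} \<Longrightarrow> e \<notin> A \<Longrightarrow> A \<subseteq> {a, b, c, d}"
  by blast

lemma swap5: "{b, a, c, e, d} = {a, b, c, d, e}"
  by auto

text \<open>
  The elements of \<open>F2 m\<close> are of two kinds: edges \<open>{a, b}\<close> with \<open>a, b
  < m\<close>, and points \<open>{a, m}\<close>. The overlap of \<open>K1 m\<close> and \<open>K2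
  m\<close> is studied in these terms.
\<close>

locale two_subsets =
  fixes m :: nat
  assumes m3: "3 \<le> m"
begin

lemma edge_not_point [simp]:
  assumes "a < m" "b < m"
  shows "{a, b} \<noteq> {c, m}" "{c, m} \<noteq> {a, b}"
  using assms by (auto simp: doubleton_eq_iff)

abbreviation "ind i \<equiv> 1 \<le> i \<and> i < m"
abbreviation "distinct3 i x y \<equiv> ind i \<and> ind x \<and> ind y \<and> i \<noteq> x \<and> i \<noteq> y \<and> x \<noteq> (y::nat)"

definition "overlap = K1 m \<inter> K2 m"

lemma edge_F2: "ind a \<Longrightarrow> ind b \<Longrightarrow> a \<noteq> b \<Longrightarrow> {a, b} \<in> F2 m"
  by (auto simp: F2_def)

lemma point_F2: "ind a \<Longrightarrow> {a, m} \<in> F2 m"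
  by (auto simp: F2_def)

lemma F2_cases:
  assumes "u \<in> F2 m"
  obtains (point) a where "ind a" "u = {a, m}" | (edge) a b where "ind a" "ind b" "a < b" "u = {a, b}"
proof -
  obtain a' b' where ab': "u = {a', b'}" "a' \<noteq> b'"
    using assms by (auto simp: F2_def card_2_iff)
  obtain a b where ab: "u = {a, b}" "a < b"
  proof (cases "a' < b'")
    case True
    then show thesis using ab' that[of a' b'] by simp
  next
    case False
    then show thesis using ab' that[of b' a'] by (simp add: insert_commute)
  qed
  have "u \<subseteq> {1..m}" using assms by (simp add: F2_def)
  then have le: "1 \<le> a" "b \<le> m" using ab(1) by simp_all
  show thesis
  proof (cases "b = m")
    case True
    show thesis by (rule point[of a]) (use True ab le in simp_all)
  next
    case False
    show thesis by (rule edge[of a b]) (use False ab le in simp_all)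
  qed
qed

lemma finite_F2: "finite (F2 m)"
  by (rule finite_subset[of _ "Pow {1..m}"]) (auto simp: F2_def)

lemma subset_star_set: "\<tau> \<subseteq> star_set m x y \<longleftrightarrow> \<tau> \<subseteq> F2 m \<and> (\<forall>u\<in>\<tau>. x \<in> u \<or> y \<in> u)"
  by (auto simp: star_set_def)

lemma K1_iff: "\<tau> \<in> K1 m \<longleftrightarrow> \<tau> \<noteq> {} \<and> \<tau> \<subseteq> F2 m \<and> (\<exists>i. ind i \<and> (\<forall>u\<in>\<tau>. i \<in> u \<or> m \<in> u))"
proof -
  have *: "i \<in> {1..m - 1} \<longleftrightarrow> ind i" for i using m3 by auto
  have "\<tau> \<in> K1 m \<longleftrightarrow> \<tau> \<noteq> {} \<and> (\<exists>i. ind i \<and> \<tau> \<subseteq> star_set m i m)"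
    unfolding K1_def generated_complex_def * by auto
  then show ?thesis unfolding subset_star_set by auto
qed

lemma K2_iff: "\<tau> \<in> K2 m \<longleftrightarrow> \<tau> \<noteq> {} \<and> \<tau> \<subseteq> F2 m \<and>
    (\<exists>x y. ind x \<and> ind y \<and> x \<noteq> y \<and> (\<forall>u\<in>\<tau>. x \<in> u \<or> y \<in> u))"
proof -
  have *: "x \<in> {1..m} \<and> y \<in> {1..m} \<and> x \<noteq> y \<and> m \<notin> {x, y} \<longleftrightarrow> ind x \<and> ind y \<and> x \<noteq> y" for x y
    by auto
  have "\<tau> \<in> K2 m \<longleftrightarrow> \<tau> \<noteq> {} \<and> (\<exists>x y. (ind x \<and> ind y \<and> x \<noteq> y) \<and> \<tau> \<subseteq> star_set m x y)"
    unfolding K2_def generated_complex_def * by auto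
  then show ?thesis unfolding subset_star_set by auto
qed

lemma complex_K: "simplicial_complex (K1 m)" "simplicial_complex (K2 m)"
proof -
  have f: "finite (star_set m x y)" for x y using finite_F2 by (simp add: star_set_def)
  have "{star_set m i m |i. i \<in> {1..m - 1}} \<subseteq> Pow (F2 m)"
    "{star_set m x y |x y. x \<in> {1..m} \<and> y \<in> {1..m} \<and> x \<noteq> y \<and> m \<notin> {x, y}} \<subseteq> Pow (F2 m)"
    by (auto simp: star_set_def)
  then show "simplicial_complex (K1 m)" "simplicial_complex (K2 m)" unfolding K1_def K2_def
    using f finite_F2 by (auto intro!: complex_generated intro: finite_subset)
qed

lemma complex_overlap: "simplicial_complex overlap"
  unfolding overlap_def by (intro complex_Int complex_K)

lemma star_in_overlap:
  assumes "\<tau> \<noteq> {}" "\<tau> \<subseteq> F2 m" "ind i" "ind y" "i \<noteq> y" "\<And>u. u \<in> \<tau> \<Longrightarrow> i \<in> u \<or> u = {y, m}"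
  shows "\<tau> \<in> overlap"
proof -
  have "\<forall>u\<in>\<tau>. i \<in> u \<or> m \<in> u" "\<forall>u\<in>\<tau>. i \<in> u \<or> y \<in> u" using assms(6) by blast+
  then show ?thesis unfolding overlap_def Int_iff K1_iff K2_iff using assms(1-5) by blast
qed

lemma square_in_overlap:
  assumes "\<tau> \<noteq> {}" "distinct3 i x y" "\<tau> \<subseteq> {{i, x}, {i, y}, {x, m}, {y, m}}"
  shows "\<tau> \<in> overlap"
proof -
  have "\<tau> \<subseteq> F2 m"
    using assms(2,3) edge_F2[of i x] edge_F2[of i y] point_F2[of x] point_F2[of y] by blast
  moreover have "\<forall>u\<in>\<tau>. i \<in> u \<or> m \<in> u" "\<forall>u\<in>\<tau>. x \<in> u \<or> y \<in> u" using assms(3) by blast+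
  ultimately show ?thesis unfolding overlap_def Int_iff K1_iff K2_iff using assms(1,2) by blast
qed

text \<open>
  A facet of \<open>K1 m\<close> with index \<open>i\<close> meets a facet of \<open>K2 m\<close>
  with indices \<open>x, y\<close> in the star of \<open>i\<close> and one further point if
  \<open>i\<close> is one of \<open>x, y\<close>, and in a square otherwise.
\<close>

lemma overlap_cases:
  assumes "\<tau> \<in> overlap"
  obtains (star) i y where "ind i" "ind y" "i \<noteq> y" "\<And>u. u \<in> \<tau> \<Longrightarrow> i \<in> u \<or> u = {y, m}"
    | (square) i x y where "distinct3 i x y" "\<tau> \<subseteq> {{i, x}, {i, y}, {x, m}, {y, m}}"
proof -
  have \<tau>: "\<tau> \<subseteq> F2 m" using assms by (simp add: overlap_def K1_iff)
  obtain i where i: "ind i" "\<And>u. u \<in> \<tau> \<Longrightarrow> i \<in> u \<or> m \<in> u" using assms unfolding overlap_def Int_iff K1_iff by blast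
  obtain x y where xy: "ind x" "ind y" "x \<noteq> y" "\<And>u. u \<in> \<tau> \<Longrightarrow> x \<in> u \<or> y \<in> u"
    using assms unfolding overlap_def Int_iff K2_iff by blast
  have two: "u = {a, b}" if "u \<in> \<tau>" "a \<in> u" "b \<in> u" "a \<noteq> b" for u a b
  proof -
    have "u \<in> F2 m" using that(1) \<tau> by blast
    then obtain c d where "u = {c, d}" by (auto simp: F2_def card_2_iff)
    then show ?thesis using that(2-4) by auto
  qed
  consider "i = x" | "i = y" | "i \<noteq> x" "i \<noteq> y" by blast
  then show thesis
  proof cases
    case 1
    have "i \<in> u \<or> u = {y, m}" if "u \<in> \<tau>" for u
      using i(2)[OF that] xy(4)[OF that] two[OF that, of y m] xy 1 by auto
    then show thesis using star[of i y] i xy 1 by blast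
  next
    case 2
    have "i \<in> u \<or> u = {x, m}" if "u \<in> \<tau>" for u
      using i(2)[OF that] xy(4)[OF that] two[OF that, of x m] xy 2 by auto
    then show thesis using star[of i x] i xy 2 by blast
  next
    case 3
    have "u \<in> {{i, x}, {i, y}, {x, m}, {y, m}}" if "u \<in> \<tau>" for u
      using i(2)[OF that] xy(4)[OF that] two[OF that, of x m] two[OF that, of y m] two[OF that, of i x] two[OF that, of i y] xy 3
      by auto
    then show thesis using square[of i x y] i xy 3 by blast
  qed
qed

lemma star_edge:
  assumes "i \<in> {a, b} \<or> {a, b} = {y, m}" "ind a" "ind b"
  shows "i = a \<or> i = b"
  using assms by simp

lemma star_point:
  assumes "i \<in> {z, m} \<or> {z, m} = {y, m}" "ind i"
  shows "z = i \<or> z = y"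
  using assms by auto

lemma square_edge:
  assumes "{a, b} \<in> \<tau>" "\<tau> \<subseteq> {{i, x}, {i, y}, {x, m}, {y, m}}" "ind a" "ind b"
  shows "{a, b} = {i, x} \<or> {a, b} = {i, y}"
proof -
  have "{a, b} \<in> {{i, x}, {i, y}, {x, m}, {y, m}}" by (rule subsetD[OF assms(2,1)])
  moreover have "{a, b} \<noteq> {x, m}" "{a, b} \<noteq> {y, m}" using assms(3,4) by simp_all
  ultimately show ?thesis by (simp only: insert_iff empty_iff simp_thms)
qed

lemma square_point:
  assumes "{z, m} \<in> \<tau>" "\<tau> \<subseteq> {{i, x}, {i, y}, {x, m}, {y, m}}" "distinct3 i x y"
  shows "z = x \<or> z = y"
proof -
  have "{z, m} \<in> {{i, x}, {i, y}, {x, m}, {y, m}}" by (rule subsetD[OF assms(2,1)])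
  moreover have "{z, m} \<noteq> {i, x}" "{z, m} \<noteq> {i, y}" using assms(3) by simp_all
  ultimately show ?thesis by simp
qed

lemma same_fork:
  assumes "{i, x} = {j, s} \<or> {i, x} = {j, t}" "{i, y} = {j, s} \<or> {i, y} = {j, t}" "x \<noteq> y" "i \<noteq> x" "i \<noteq> y"
  shows "j = i \<and> (s = x \<and> t = y \<or> s = y \<and> t = x)"
proof -
  have "j \<in> {i, x}" "j \<in> {i, y}" using assms(1,2) by blast+
  then have ji: "j = i" using assms(3-5) by auto
  then have "x = s \<or> x = t" "y = s \<or> y = t" using assms(1,2) by auto
  then show ?thesis using ji assms(3) by auto
qed

text \<open>
  Two edges with common end \<open>i\<close> determine the centre \<open>i\<close> of the star or
  the square that contains them.
\<close>

lemma fork: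
  assumes "\<tau> \<in> overlap" "{i, x} \<in> \<tau>" "{i, y} \<in> \<tau>" "distinct3 i x y"
  shows "(\<exists>z. ind z \<and> z \<noteq> i \<and> (\<forall>u\<in>\<tau>. i \<in> u \<or> u = {z, m})) \<or> \<tau> \<subseteq> {{i, x}, {i, y}, {x, m}, {y, m}}"
  using assms(1)
proof (cases rule: overlap_cases)
  case (star j z)
  have "j = i \<or> j = x" "j = i \<or> j = y"
    using star_edge[OF star(4)[OF assms(2)]] star_edge[OF star(4)[OF assms(3)]] assms(4) by auto
  then have "j = i" using assms(4) by auto
  then show ?thesis using star by blast
next
  case (square j x' y')
  have "j = i \<and> (x' = x \<and> y' = y \<or> x' = y \<and> y' = x)"
    by (rule same_fork[OF square_edge[OF assms(2) square(2)] square_edge[OF assms(3) square(2)]])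
      (use assms(4) in auto)
  then show ?thesis using square(2) by blast
qed

lemma edges_meet:
  assumes "\<tau> \<in> overlap" "u \<in> \<tau>" "u' \<in> \<tau>" "m \<notin> u" "m \<notin> u'" "u \<noteq> u'"
  obtains i x y where "distinct3 i x y" "u = {i, x}" "u' = {i, y}"
proof -
  have F: "u \<in> F2 m" "u' \<in> F2 m" using assms by (auto simp: overlap_def K1_iff)
  obtain j where j: "ind j" "j \<in> u" "j \<in> u'"
    using assms(1)
  proof (cases rule: overlap_cases)
    case (star i y)
    then show ?thesis using that[of i] assms by blast
  next
    case (square i x y)
    then show ?thesis using that[of i] assms(2-5) by blast
  qed
  have ex: "\<exists>x. ind x \<and> j \<noteq> x \<and> v = {j, x}" if "v \<in> F2 m" "m \<notin> v" "j \<in> v" for v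
    using that(1) by (cases rule: F2_cases) (use that(2,3) in auto)
  obtain x y where "ind x" "j \<noteq> x" "u = {j, x}" "ind y" "j \<noteq> y" "u' = {j, y}"
    using ex[OF F(1) assms(4) j(2)] ex[OF F(2) assms(5) j(3)] by blast
  then show thesis using that[of j x y] j assms(6) by blast
qed

lemma points_le_2:
  assumes "\<tau> \<in> overlap" "{a, m} \<in> \<tau>" "{b, m} \<in> \<tau>" "{c, m} \<in> \<tau>" "a \<noteq> b" "a \<noteq> c" "b \<noteq> c"
  shows False
  using assms(1)
proof (cases rule: overlap_cases)
  case (star i y)
  have "z = i \<or> z = y" if "{z, m} \<in> \<tau>" for z
    by (rule star_point[OF star(4)[OF that] star(1)])
  then show False using assms(2-7) by metis
next
  case (square i x y)
  have "z = x \<or> z = y" if "{z, m} \<in> \<tau>" for z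
    by (rule square_point[OF that square(2,1)])
  then show False using assms(2-7) by metis
qed

lemma edge_points:
  assumes "\<tau> \<in> overlap" "{a, b} \<in> \<tau>" "{c, m} \<in> \<tau>" "{d, m} \<in> \<tau>" "ind a" "ind b" "c \<notin> {a, b}" "d \<notin> {a, b}"
  shows "c = d"
  using assms(1)
proof (cases rule: overlap_cases)
  case (star i y)
  have "i = a \<or> i = b" by (rule star_edge[OF star(4)[OF assms(2)] assms(5,6)])
  moreover have "c = i \<or> c = y" "d = i \<or> d = y"
    by (rule star_point[OF star(4)[OF assms(3)] star(1)], rule star_point[OF star(4)[OF assms(4)] star(1)])
  ultimately show ?thesis using assms(7,8) by auto
next
  case (square i x y)
  have "{a, b} = {i, x} \<or> {a, b} = {i, y}" by (rule square_edge[OF assms(2) square(2) assms(5,6)])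
  moreover have "c = x \<or> c = y" "d = x \<or> d = y"
    by (rule square_point[OF assms(3) square(2,1)], rule square_point[OF assms(4) square(2,1)])
  ultimately show ?thesis using assms(7,8) by blast
qed

lemma fork_in_overlap:
  assumes "\<tau> \<noteq> {}" "distinct3 i x y" "\<tau> \<subseteq> {{i, x}, {i, y}, {i, m}, {x, m}, {y, m}}" "\<not> {{i, m}, {x, m}, {y, m}} \<subseteq> \<tau>"
  shows "\<tau> \<in> overlap"
proof -
  have F: "\<tau> \<subseteq> F2 m"
    using assms(2,3) edge_F2[of i x] edge_F2[of i y] point_F2[of i] point_F2[of x] point_F2[of y] by blast
  consider "{i, m} \<notin> \<tau>" | "{x, m} \<notin> \<tau>" | "{y, m} \<notin> \<tau>" using assms(4) by blast
  then show ?thesis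
  proof cases
    case 1
    then show ?thesis using square_in_overlap[OF assms(1,2)] assms(3) by blast
  next
    case 2
    then show ?thesis using star_in_overlap[OF assms(1) F, of i y] assms(2,3) by blast
  next
    case 3
    then show ?thesis using star_in_overlap[OF assms(1) F, of i x] assms(2,3) by blast
  qed
qed

section \<open>Collapses of the overlap\<close>

text \<open>
  Every triple of indices spans a 3-sphere in the overlap, the join of two circles formed by its
  edges and by its points. One tetrahedron of it is set aside: it is the one that will account for a
  4-sphere.
\<close>

definition "quads = {{{a, b}, {a, c}, {b, m}, {c, m}} | a b c. 1 \<le> a \<and> a < b \<and> b < c \<and> c < m}"

definition "stage1 = overlap - quads"

text \<open>
  Two edges at \<open>i\<close>, either accompanied by a vertex outside their square or such that
  \<open>i\<close> is smaller than the other two ends. In the first case the simplex lies in a star;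
  in the second the same follows because the whole square is a removed quad. The intended apex
  \<open>{i, m}\<close> is excluded.
\<close>

definition "wide_forks = {\<sigma>. \<exists>i x y. distinct3 i x y \<and> {i, x} \<in> \<sigma> \<and> {i, y} \<in> \<sigma> \<and> {i, m} \<notin> \<sigma> \<and>
  (i < x \<and> i < y \<or> \<not> \<sigma> \<subseteq> {{i, x}, {i, y}, {x, m}, {y, m}})}"

definition "stage2 = delete_stars wide_forks stage1"

text \<open>An edge and a point off that edge that is not the smallest index of the triple.\<close>

definition "outer_points = {{{x, y}, {z, m}} | x y z. distinct3 x y z \<and> x < y \<and> x < z}"

definition "stage3 = delete_stars outer_points stage2"

text \<open>
  The forks whose centre is not the smallest of their three indices; all others have been deleted
  already.
\<close>

definition "forks = {{{i, x}, {i, y}} | i x y. distinct3 i x y \<and> x < i \<and> x < y}"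

definition "stage4 = delete_stars forks stage3"

lemma quad_maximal:
  assumes \<sigma>: "\<sigma> \<in> quads" and \<tau>: "\<tau> \<in> overlap" "\<sigma> \<subseteq> \<tau>"
  shows "\<tau> = \<sigma>"
proof -
  obtain a b c where abc: "1 \<le> a \<and> a < b \<and> b < c \<and> c < m" "\<sigma> = {{a, b}, {a, c}, {b, m}, {c, m}}"
    using \<sigma> unfolding quads_def by blast
  have "(\<exists>z. ind z \<and> z \<noteq> a \<and> (\<forall>u\<in>\<tau>. a \<in> u \<or> u = {z, m})) \<or> \<tau> \<subseteq> {{a, b}, {a, c}, {b, m}, {c, m}}"
    by (rule fork[OF \<tau>(1)]) (use \<tau> abc in auto)
  moreover have "\<not> (\<forall>u\<in>\<tau>. a \<in> u \<or> u = {z, m})" for z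
  proof
    assume *: "\<forall>u\<in>\<tau>. a \<in> u \<or> u = {z, m}"
    have "{b, m} \<in> \<tau>" "{c, m} \<in> \<tau>" using \<tau> abc by blast+
    from bspec[OF * this(1)] bspec[OF * this(2)] show False using abc(1) by simp
  qed
  ultimately show ?thesis using \<tau>(2) abc(2) by blast
qed

lemma complex_stage1: "simplicial_complex stage1"
proof (rule complexI)
  show "finite stage1" using complex_finite[OF complex_overlap] by (simp add: stage1_def)
  show "\<rho> \<in> stage1" if "\<tau> \<in> stage1" "\<rho> \<noteq> {}" "\<rho> \<subseteq> \<tau>" for \<tau> \<rho>
  proof -
    have "\<tau> \<in> overlap" "\<tau> \<notin> quads" using that(1) by (auto simp: stage1_def)
    then show ?thesis using complexD(3)[OF complex_overlap _ that(2,3)] quad_maximal[of \<rho> \<tau>] that(3)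
      unfolding stage1_def by auto
  qed
qed (use complexD(1,2)[OF complex_overlap] in \<open>auto simp: stage1_def\<close>)

lemma fork_in_stage1:
  assumes "\<tau> \<in> overlap" "{i, x} \<in> \<tau>" "{i, y} \<in> \<tau>" "distinct3 i x y" "{i, m} \<in> \<tau>"
  shows "\<tau> \<in> stage1"
proof -
  have "\<tau> \<notin> quads"
  proof
    assume "\<tau> \<in> quads"
    then obtain a b c where abc: "1 \<le> a \<and> a < b \<and> b < c \<and> c < m" "\<tau> = {{a, b}, {a, c}, {b, m}, {c, m}}"
      unfolding quads_def by blast
    then have \<tau>: "\<tau> \<subseteq> {{a, b}, {a, c}, {b, m}, {c, m}}" by simp
    have "a = i \<and> (b = x \<and> c = y \<or> b = y \<and> c = x)"
      by (rule same_fork[OF square_edge[OF assms(2) \<tau>] square_edge[OF assms(3) \<tau>]]) (use assms(4) in auto)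
    moreover have "i = b \<or> i = c" by (rule square_point[OF assms(5) \<tau>]) (use abc(1) in auto)
    ultimately show False using abc(1) by auto
  qed
  then show ?thesis using assms by (simp add: stage1_def)
qed

lemma wide_forksI:
  assumes "distinct3 i x y" "{i, x} \<in> \<sigma>" "{i, y} \<in> \<sigma>" "{i, m} \<notin> \<sigma>"
    "i < x \<and> i < y \<or> \<not> \<sigma> \<subseteq> {{i, x}, {i, y}, {x, m}, {y, m}}"
  shows "\<sigma> \<in> wide_forks"
  unfolding wide_forks_def by (rule CollectI, rule exI[of _ i], rule exI[of _ x], rule exI[of _ y]) (use assms in simp)

lemma wide_fork_star:
  assumes "\<tau> \<in> stage1" "\<sigma> \<subseteq> \<tau>" "distinct3 i x y" "{i, x} \<in> \<sigma>" "{i, y} \<in> \<sigma>"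
    "i < x \<and> i < y \<or> \<not> \<sigma> \<subseteq> {{i, x}, {i, y}, {x, m}, {y, m}}"
  shows "\<exists>z. ind z \<and> z \<noteq> i \<and> (\<forall>u\<in>\<tau>. i \<in> u \<or> u = {z, m})"
proof -
  have \<tau>: "\<tau> \<in> overlap" "\<tau> \<notin> quads" using assms(1) by (simp_all add: stage1_def)
  have d: "{i, x} \<in> \<tau>" "{i, y} \<in> \<tau>" using assms(2,4,5) by blast+
  from fork[OF \<tau>(1) d assms(3)] show ?thesis
  proof
    assume sq: "\<tau> \<subseteq> {{i, x}, {i, y}, {x, m}, {y, m}}"
    then have lt: "i < x" "i < y" using assms(2,6) by blast+
    have "\<tau> \<noteq> {{i, x}, {i, y}, {x, m}, {y, m}}"
    proof
      assume eq: "\<tau> = {{i, x}, {i, y}, {x, m}, {y, m}}"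
      have "\<exists>b c. 1 \<le> i \<and> i < b \<and> b < c \<and> c < m \<and> \<tau> = {{i, b}, {i, c}, {b, m}, {c, m}}"
      proof (cases "x < y")
        case True
        then show ?thesis using eq lt assms(3) by blast
      next
        case False
        then have "y < x" using assms(3) by auto
        moreover have "\<tau> = {{i, y}, {i, x}, {y, m}, {x, m}}" unfolding eq by blast
        ultimately show ?thesis using lt assms(3) by blast
      qed
      then show False using \<tau>(2) unfolding quads_def by blast
    qed
    then have "{x, m} \<notin> \<tau> \<or> {y, m} \<notin> \<tau>" using sq d by blast
    then show ?thesis
    proof
      assume "{x, m} \<notin> \<tau>"
      then have "\<forall>u\<in>\<tau>. i \<in> u \<or> u = {y, m}" using sq by blast
      then show ?thesis using assms(3) by blast
    next
      assume "{y, m} \<notin> \<tau>"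
      then have "\<forall>u\<in>\<tau>. i \<in> u \<or> u = {x, m}" using sq by blast
      then show ?thesis using assms(3) by blast
    qed
  qed
qed

text \<open>
  A simplex containing a wide fork at \<open>i\<close> lies in a star of \<open>i\<close>, so the
  point \<open>{i, m}\<close> may be added.
\<close>

lemma collapse_wide_forks: "collapses stage1 stage2"
  unfolding stage2_def
proof (rule collapses_delete_stars_ex[OF complex_stage1])
  show "\<sigma> \<noteq> {}" if "\<sigma> \<in> wide_forks" for \<sigma> using that unfolding wide_forks_def by blast
  fix \<sigma> assume "\<sigma> \<in> wide_forks"
  then obtain i x y where d: "distinct3 i x y" "{i, x} \<in> \<sigma>" "{i, y} \<in> \<sigma>" "{i, m} \<notin> \<sigma>"
     and \<sigma>: "i < x \<and> i < y \<or> \<not> \<sigma> \<subseteq> {{i, x}, {i, y}, {x, m}, {y, m}}"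
    unfolding wide_forks_def by blast
  show "\<exists>v. v \<notin> \<sigma> \<and> (\<forall>\<tau>\<in>stage1. \<sigma> \<subseteq> \<tau> \<longrightarrow> insert v \<tau> \<in> stage1 \<and> (\<forall>\<sigma>'\<in>wide_forks. \<sigma>' \<subseteq> insert v \<tau> \<longrightarrow> \<sigma>' \<subseteq> \<tau>))"
  proof (intro exI[of _ "{i, m}"] conjI ballI impI)
    show "{i, m} \<notin> \<sigma>" by fact
    fix \<tau> assume \<tau>: "\<tau> \<in> stage1" "\<sigma> \<subseteq> \<tau>"
    obtain z where z: "ind z" "z \<noteq> i" "\<forall>u\<in>\<tau>. i \<in> u \<or> u = {z, m}"
      using wide_fork_star[OF \<tau> d(1-3) \<sigma>] by blast
    have F: "insert {i, m} \<tau> \<subseteq> F2 m" using \<tau>(1) point_F2[of i] d(1) by (simp add: stage1_def overlap_def K1_iff)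
    have "insert {i, m} \<tau> \<in> overlap"
    proof (rule star_in_overlap[OF _ F])
      show "i \<in> u \<or> u = {z, m}" if "u \<in> insert {i, m} \<tau>" for u using that z(3) by blast
    qed (use d(1) z in auto)
    then show "insert {i, m} \<tau> \<in> stage1"
      by (rule fork_in_stage1[of _ i x y]) (use d(1-3) \<tau>(2) in blast)+
    fix \<sigma>' assume \<sigma>': "\<sigma>' \<in> wide_forks" "\<sigma>' \<subseteq> insert {i, m} \<tau>"
    show "\<sigma>' \<subseteq> \<tau>"
    proof (rule ccontr)
      assume "\<not> \<sigma>' \<subseteq> \<tau>"
      then have im: "{i, m} \<in> \<sigma>'" using \<sigma>'(2) by blast
      obtain j x' y' where j: "distinct3 j x' y'" "{j, x'} \<in> \<sigma>'" "{j, y'} \<in> \<sigma>'" "{j, m} \<notin> \<sigma>'"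
        using \<sigma>'(1) unfolding wide_forks_def by blast
      have "i = a \<or> i = b" if "{a, b} \<in> \<sigma>'" "ind a" "ind b" for a b
      proof -
        have "{a, b} \<noteq> {i, m}" using that(2,3) by simp
        then have "{a, b} \<in> \<tau>" using subsetD[OF \<sigma>'(2) that(1)] by simp
        then show ?thesis by (rule star_edge[OF bspec[OF z(3)] that(2,3)])
      qed
      then have "i = j \<or> i = x'" "i = j \<or> i = y'" using j by blast+
      then have "i = j" using j(1) by auto
      then show False using j(4) im by simp
    qed
  qed
qed

lemma fork_stage2:
  assumes "\<tau> \<in> stage2" "{i, x} \<in> \<tau>" "{i, y} \<in> \<tau>" "distinct3 i x y"
  shows "\<tau> \<subseteq> {{i, x}, {i, y}, {i, m}, {x, m}, {y, m}}" "\<not> (i < x \<and> i < y)"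
proof -
  have notin: "\<tau> - {{i, m}} \<notin> wide_forks"
  proof
    assume "\<tau> - {{i, m}} \<in> wide_forks"
    moreover have "\<tau> \<in> delete_stars wide_forks stage1" using assms(1) by (simp add: stage2_def)
    ultimately show False unfolding delete_stars_def using Diff_subset[of \<tau> "{{i, m}}"] by blast
  qed
  have mem: "{i, x} \<in> \<tau> - {{i, m}}" "{i, y} \<in> \<tau> - {{i, m}}" using assms(2-4) by simp_all
  have *: "\<not> (i < x \<and> i < y \<or> \<not> \<tau> - {{i, m}} \<subseteq> {{i, x}, {i, y}, {x, m}, {y, m}})"
  proof
    assume "i < x \<and> i < y \<or> \<not> \<tau> - {{i, m}} \<subseteq> {{i, x}, {i, y}, {x, m}, {y, m}}"
    from wide_forksI[OF assms(4) mem _ this] notin show False by simp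
  qed
  then have "\<tau> \<subseteq> {{i, m}} \<union> {{i, x}, {i, y}, {x, m}, {y, m}}" by (simp only: Diff_subset_conv de_Morgan_disj not_not)
  then show "\<tau> \<subseteq> {{i, x}, {i, y}, {i, m}, {x, m}, {y, m}}" by (rule order_trans) simp
  show "\<not> (i < x \<and> i < y)" using * by simp
qed

lemma in_stage2:
  assumes "\<tau> \<in> overlap"
    and "\<And>i x y. {i, x} \<in> \<tau> \<Longrightarrow> {i, y} \<in> \<tau> \<Longrightarrow> distinct3 i x y \<Longrightarrow>
      \<tau> \<subseteq> {{i, x}, {i, y}, {i, m}, {x, m}, {y, m}} \<and> \<not> (i < x \<and> i < y)"
  shows "\<tau> \<in> stage2"
proof -
  have "\<tau> \<notin> quads"
  proof
    assume "\<tau> \<in> quads"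
    then obtain a b c where abc: "1 \<le> a \<and> a < b \<and> b < c \<and> c < m" "\<tau> = {{a, b}, {a, c}, {b, m}, {c, m}}"
      unfolding quads_def by blast
    have "{a, b} \<in> \<tau>" "{a, c} \<in> \<tau>" "distinct3 a b c" using abc by simp_all
    then show False using assms(2)[of a b c] abc(1) by simp
  qed
  moreover have "\<not> \<sigma> \<subseteq> \<tau>" if \<sigma>: "\<sigma> \<in> wide_forks" for \<sigma>
  proof
    assume sub: "\<sigma> \<subseteq> \<tau>"
    obtain i x y where d: "distinct3 i x y" "{i, x} \<in> \<sigma>" "{i, y} \<in> \<sigma>" "{i, m} \<notin> \<sigma>"
      "i < x \<and> i < y \<or> \<not> \<sigma> \<subseteq> {{i, x}, {i, y}, {x, m}, {y, m}}"
      using \<sigma> unfolding wide_forks_def by blast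
    have "{i, x} \<in> \<tau>" "{i, y} \<in> \<tau>" using d sub by blast+
    from assms(2)[OF this d(1)] show False using d(4,5) sub by blast
  qed
  ultimately show ?thesis using assms(1) unfolding stage2_def stage1_def delete_stars_def by blast
qed

lemma fork_edge:
  assumes "{a, b} \<in> \<tau>" "\<tau> \<subseteq> {{i, x}, {i, y}, {i, m}, {x, m}, {y, m}}" "ind a" "ind b"
  shows "{a, b} = {i, x} \<or> {a, b} = {i, y}"
proof -
  have "{a, b} \<in> {{i, x}, {i, y}, {i, m}, {x, m}, {y, m}}" by (rule subsetD[OF assms(2,1)])
  moreover have "{a, b} \<noteq> {i, m}" "{a, b} \<noteq> {x, m}" "{a, b} \<noteq> {y, m}" using assms(3,4) by simp_all
  ultimately show ?thesis by (simp only: insert_iff empty_iff simp_thms)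
qed

lemma fork_point:
  assumes "{z, m} \<in> \<tau>" "\<tau> \<subseteq> {{i, x}, {i, y}, {i, m}, {x, m}, {y, m}}" "distinct3 i x y"
  shows "z = i \<or> z = x \<or> z = y"
proof -
  have "{z, m} \<in> {{i, x}, {i, y}, {i, m}, {x, m}, {y, m}}" by (rule subsetD[OF assms(2,1)])
  moreover have "{z, m} \<noteq> {i, x}" "{z, m} \<noteq> {i, y}" using assms(3) by simp_all
  ultimately show ?thesis by simp
qed

lemma fork_in_stage2:
  assumes "\<tau> \<noteq> {}" "distinct3 i x y" "\<tau> \<subseteq> {{i, x}, {i, y}, {i, m}, {x, m}, {y, m}}" "\<not> {{i, m}, {x, m}, {y, m}} \<subseteq> \<tau>"
    "\<not> (i < x \<and> i < y)"
  shows "\<tau> \<in> stage2"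
proof (rule in_stage2[OF fork_in_overlap[OF assms(1-4)]])
  fix j x' y' assume *: "{j, x'} \<in> \<tau>" "{j, y'} \<in> \<tau>" "distinct3 j x' y'"
  have "i = j \<and> (x = x' \<and> y = y' \<or> x = y' \<and> y = x')"
    by (rule same_fork[OF fork_edge[OF *(1) assms(3)] fork_edge[OF *(2) assms(3)]]) (use *(3) in auto)
  then consider "j = i" "x' = x" "y' = y" | "j = i" "x' = y" "y' = x" by auto
  then show "\<tau> \<subseteq> {{j, x'}, {j, y'}, {j, m}, {x', m}, {y', m}} \<and> \<not> (j < x' \<and> j < y')"
  proof cases
    case 2
    have "{{j, x'}, {j, y'}, {j, m}, {x', m}, {y', m}} = {{i, x}, {i, y}, {i, m}, {x, m}, {y, m}}"
      unfolding 2 by (rule swap5)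
    moreover have "\<not> (j < x' \<and> j < y')" using assms(5) unfolding 2 by blast
    ultimately show ?thesis using assms(3) by simp
  qed (use assms(3,5) in simp)
qed

lemma complex_stage2: "simplicial_complex stage2" and complex_stage3: "simplicial_complex stage3" and complex_stage4: "simplicial_complex stage4"
  unfolding stage2_def stage3_def stage4_def by (intro complex_delete_stars complex_stage1)+

lemma stage2_subset: "\<tau> \<in> stage2 \<Longrightarrow> \<tau> \<in> overlap" "\<tau> \<in> stage2 \<Longrightarrow> \<tau> \<subseteq> F2 m"
  by (simp_all add: stage2_def delete_stars_def stage1_def overlap_def K1_iff)

text \<open>
  Once the wide forks are gone, a simplex with an edge and a point off that edge involves no index
  outside this triple.
\<close>

lemma stage2_around:
  assumes "\<tau> \<in> stage2" "{x, y} \<in> \<tau>" "{z, m} \<in> \<tau>" "distinct3 x y z" "x < y" "x < z"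
  shows "\<tau> \<subseteq> {{y, x}, {y, z}, {y, m}, {x, m}, {z, m}}" "\<not> {{y, m}, {x, m}, {z, m}} \<subseteq> \<tau>"
proof -
  have \<tau>: "\<tau> \<in> overlap" "\<tau> \<subseteq> F2 m" using stage2_subset[OF assms(1)] by blast+
  show "\<not> {{y, m}, {x, m}, {z, m}} \<subseteq> \<tau>"
    using points_le_2[OF \<tau>(1), of y x z] assms(4) by blast
  show "\<tau> \<subseteq> {{y, x}, {y, z}, {y, m}, {x, m}, {z, m}}"
  proof
    fix u assume u: "u \<in> \<tau>"
    then have "u \<in> F2 m" using \<tau> by blast
    then show "u \<in> {{y, x}, {y, z}, {y, m}, {x, m}, {z, m}}"
    proof (cases rule: F2_cases)
      case (point a)
      have "z = a" if "a \<notin> {x, y}"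
        by (rule edge_points[OF \<tau>(1) assms(2,3)]) (use u point that assms(4) in auto)
      then show ?thesis using point(2) by blast
    next
      case (edge a b)
      show ?thesis
      proof (cases "u = {x, y}")
        case True
        then show ?thesis by blast
      next
        case False
        have "m \<notin> {x, y}" "m \<notin> u" "{x, y} \<noteq> u" using assms(4) edge False by auto
        then obtain i s t where ist: "distinct3 i s t" "{x, y} = {i, s}" "u = {i, t}"
          using edges_meet[OF \<tau>(1) assms(2) u] by metis
        have "{i, s} \<in> \<tau>" "{i, t} \<in> \<tau>" using ist assms(2) u by simp_all
        note f = fork_stage2[OF assms(1) this ist(1)]
        have "z = i \<or> z = s \<or> z = t" by (rule fork_point[OF assms(3) f(1) ist(1)])
        moreover have "z \<notin> {i, s}" using assms(4) ist(2)[symmetric] by auto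
        ultimately have zt: "z = t" by blast
        have "i = x \<and> s = y \<or> i = y \<and> s = x" using ist(2) by (auto simp: doubleton_eq_iff)
        then have "i = y" using f(2) zt assms(5,6) by auto
        then show ?thesis using ist(3) zt by blast
      qed
    qed
  qed
qed

text \<open>
  By \<open>stage2_around\<close> only forks at \<open>y\<close> have to be considered, and the edge
  \<open>{y, z}\<close> completes one.
\<close>

lemma collapse_outer_points: "collapses stage2 stage3"
  unfolding stage3_def
proof (rule collapses_delete_stars_ex[OF complex_stage2])
  show "\<sigma> \<noteq> {}" if "\<sigma> \<in> outer_points" for \<sigma> using that by (auto simp: outer_points_def)
  fix \<sigma> assume "\<sigma> \<in> outer_points"
  then obtain x y z where \<sigma>: "\<sigma> = {{x, y}, {z, m}}" "distinct3 x y z" "x < y" "x < z"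
    unfolding outer_points_def by blast
  show "\<exists>v. v \<notin> \<sigma> \<and> (\<forall>\<tau>\<in>stage2. \<sigma> \<subseteq> \<tau> \<longrightarrow> insert v \<tau> \<in> stage2 \<and> (\<forall>\<sigma>'\<in>outer_points. \<sigma>' \<subseteq> insert v \<tau> \<longrightarrow> \<sigma>' \<subseteq> \<tau>))"
  proof (intro exI[of _ "{y, z}"] conjI ballI impI)
    show "{y, z} \<notin> \<sigma>" using \<sigma>(1,2) by auto
    fix \<tau> assume \<tau>: "\<tau> \<in> stage2" "\<sigma> \<subseteq> \<tau>"
    have mem: "{x, y} \<in> \<tau>" "{z, m} \<in> \<tau>" using \<tau>(2) \<sigma>(1) by simp_all
    have a: "\<tau> \<subseteq> {{y, x}, {y, z}, {y, m}, {x, m}, {z, m}}" "\<not> {{y, m}, {x, m}, {z, m}} \<subseteq> \<tau>"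
      by (rule stage2_around[OF \<tau>(1) mem \<sigma>(2-4)])+
    have "{y, z} \<notin> {{y, m}, {x, m}, {z, m}}" using \<sigma>(2) by simp
    then have "\<not> {{y, m}, {x, m}, {z, m}} \<subseteq> insert {y, z} \<tau>" using a(2) by blast
    then show "insert {y, z} \<tau> \<in> stage2"
      by (intro fork_in_stage2[of "insert {y, z} \<tau>" y x z]) (use a(1) \<sigma>(2,3) in auto)
    fix \<sigma>' assume \<sigma>': "\<sigma>' \<in> outer_points" "\<sigma>' \<subseteq> insert {y, z} \<tau>"
    obtain x' y' z' where s': "\<sigma>' = {{x', y'}, {z', m}}" "distinct3 x' y' z'" "x' < y'" "x' < z'"
      using \<sigma>'(1) unfolding outer_points_def by blast
    have z': "{z', m} \<noteq> {y, z}" using \<sigma>(2) by simp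
    moreover have "{x', y'} \<noteq> {y, z}"
    proof
      assume eq: "{x', y'} = {y, z}"
      have "{z', m} \<in> \<tau>" using \<sigma>'(2) s'(1) z' by blast
      then have "z' = y \<or> z' = x \<or> z' = z" by (rule fork_point[OF _ a(1)]) (use \<sigma>(2) in auto)
      moreover have "z' \<notin> {y, z}" unfolding eq[symmetric] using s'(2) by auto
      ultimately have "z' = x" by blast
      moreover have "x' \<in> {y, z}" using eq by blast
      ultimately show False using s'(4) \<sigma>(3,4) by auto
    qed
    ultimately show "\<sigma>' \<subseteq> \<tau>" using \<sigma>'(2) s'(1) by blast
  qed
qed

lemma stage3_iff: "\<tau> \<in> stage3 \<longleftrightarrow> \<tau> \<in> stage2 \<and> (\<forall>x y z. distinct3 x y z \<longrightarrow> x < y \<longrightarrow> {x, y} \<in> \<tau> \<longrightarrow> {z, m} \<in> \<tau> \<longrightarrow> z < x)"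
proof -
  have "(\<forall>\<sigma>\<in>outer_points. \<not> \<sigma> \<subseteq> \<tau>) \<longleftrightarrow> (\<forall>x y z. distinct3 x y z \<longrightarrow> x < y \<longrightarrow> {x, y} \<in> \<tau> \<longrightarrow> {z, m} \<in> \<tau> \<longrightarrow> z < x)"
    (is "?L \<longleftrightarrow> ?R")
  proof
    assume L: ?L
    show ?R
    proof (intro allI impI)
      fix x y z assume *: "distinct3 x y z" "x < y" "{x, y} \<in> \<tau>" "{z, m} \<in> \<tau>"
      show "z < x"
      proof (rule ccontr)
        assume "\<not> z < x"
        then have "x < z" using *(1) by auto
        then have "{{x, y}, {z, m}} \<in> outer_points"
          unfolding outer_points_def by (intro CollectI exI[of _ x] exI[of _ y] exI[of _ z]) (use * in simp)
        then have "\<not> {{x, y}, {z, m}} \<subseteq> \<tau>" by (rule bspec[OF L])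
        then show False using *(3,4) by simp
      qed
    qed
  next
    assume R: ?R
    show ?L
    proof
      fix \<sigma> assume "\<sigma> \<in> outer_points"
      then obtain x y z where \<sigma>: "\<sigma> = {{x, y}, {z, m}}" "distinct3 x y z" "x < y" "x < z"
        unfolding outer_points_def by blast
      show "\<not> \<sigma> \<subseteq> \<tau>"
      proof
        assume "\<sigma> \<subseteq> \<tau>"
        then have "{x, y} \<in> \<tau>" "{z, m} \<in> \<tau>" using \<sigma>(1) by simp_all
        then have "z < x" using R[rule_format, OF \<sigma>(2,3)] by simp
        then show False using \<sigma>(4) by simp
      qed
    qed
  qed
  then show ?thesis by (simp add: stage3_def delete_stars_def)
qed

text \<open>
  After the outer points, only the point \<open>{y, m}\<close> could prevent adding \<open>{x,
  m}\<close>, and it is an outer point of the edge \<open>{i, x}\<close>.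
\<close>

lemma collapse_forks: "collapses stage3 stage4"
  unfolding stage4_def
proof (rule collapses_delete_stars_ex[OF complex_stage3])
  show "\<sigma> \<noteq> {}" if "\<sigma> \<in> forks" for \<sigma> using that by (auto simp: forks_def)
  fix \<sigma> assume "\<sigma> \<in> forks"
  then obtain i x y where \<sigma>: "\<sigma> = {{i, x}, {i, y}}" "distinct3 i x y" "x < i" "x < y"
    unfolding forks_def by blast
  show "\<exists>v. v \<notin> \<sigma> \<and> (\<forall>\<tau>\<in>stage3. \<sigma> \<subseteq> \<tau> \<longrightarrow> insert v \<tau> \<in> stage3 \<and> (\<forall>\<sigma>'\<in>forks. \<sigma>' \<subseteq> insert v \<tau> \<longrightarrow> \<sigma>' \<subseteq> \<tau>))"
  proof (intro exI[of _ "{x, m}"] conjI ballI impI)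
    show "{x, m} \<notin> \<sigma>" using \<sigma>(1,2) by simp
    fix \<tau> assume \<tau>: "\<tau> \<in> stage3" "\<sigma> \<subseteq> \<tau>"
    have 2: "\<tau> \<in> stage2" using \<tau>(1) by (simp add: stage3_iff)
    have e: "{i, x} \<in> \<tau>" "{i, y} \<in> \<tau>" using \<tau>(2) \<sigma>(1) by simp_all
    have ym: "{y, m} \<notin> \<tau>"
    proof
      assume "{y, m} \<in> \<tau>"
      moreover have "{x, i} \<in> \<tau>" using e(1) by (simp add: insert_commute)
      ultimately have "y < x" using \<tau>(1) \<sigma>(2,3) unfolding stage3_iff by metis
      then show False using \<sigma>(4) by simp
    qed
    have sub: "\<tau> \<subseteq> {{i, x}, {i, y}, {i, m}, {x, m}}"
      using fork_stage2(1)[OF 2 e \<sigma>(2)] ym by (rule subset_without5)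
    have ym': "{y, m} \<notin> insert {x, m} \<tau>" using ym \<sigma>(2) by simp
    have sub': "insert {x, m} \<tau> \<subseteq> {{i, x}, {i, y}, {i, m}, {x, m}, {y, m}}" using sub by blast
    have inC2: "insert {x, m} \<tau> \<in> stage2"
      by (rule fork_in_stage2[OF _ \<sigma>(2) sub']) (use ym' \<sigma>(3) in auto)
    have lt: "z' < x'" if z': "distinct3 x' y' z'" "x' < y'" "{x', y'} \<in> insert {x, m} \<tau>" "{z', m} \<in> insert {x, m} \<tau>" for x' y' z'
    proof -
      have e: "{x', y'} = {i, x} \<or> {x', y'} = {i, y}" by (rule fork_edge[OF z'(3) sub']) (use z'(1) in auto)
      have "z' = i \<or> z' = x \<or> z' = y" by (rule fork_point[OF z'(4) sub' \<sigma>(2)])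
      moreover have "z' \<noteq> y" using z'(4) ym' by metis
      moreover have "i \<in> {x', y'}" using e by (elim disjE; simp only: insertI1)
      then have "z' \<noteq> i" using z'(1) by auto
      ultimately have "z' = x" by metis
      moreover have "x \<notin> {x', y'}" using z'(1) \<open>z' = x\<close> by simp
      then have "{x', y'} \<noteq> {i, x}" by (metis insertCI)
      then have "{x', y'} = {i, y}" using e by simp
      then have "x' \<in> {i, y}" using insertI1[of x' "{y'}"] by simp
      ultimately show ?thesis using \<sigma>(3,4) by auto
    qed
    show "insert {x, m} \<tau> \<in> stage3" unfolding stage3_iff by (intro conjI inC2 allI impI) (rule lt)
    fix \<sigma>' assume \<sigma>': "\<sigma>' \<in> forks" "\<sigma>' \<subseteq> insert {x, m} \<tau>"
    then obtain j s t where "\<sigma>' = {{j, s}, {j, t}}" "distinct3 j s t" unfolding forks_def by blast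
    then have "{x, m} \<notin> \<sigma>'" by simp
    then show "\<sigma>' \<subseteq> \<tau>" using \<sigma>'(2) by blast
  qed
qed


section \<open>Ears and triangles\<close>

definition "ear a b c d = {{a, b}, {c, m}, {d, m :: nat}}"

text \<open>
  What remains after the three rounds: an edge with two points, the first on the edge and the second
  on or below it, and the faces of such sets.
\<close>

definition "ears = {\<tau>. \<tau> \<noteq> {} \<and> (\<exists>a b c d. ind a \<and> ind b \<and> ind d \<and> a < b \<and> (c = a \<or> c = b) \<and> c \<noteq> d \<and> (d = a \<or> d = b \<or> d < a)
   \<and> \<tau> \<subseteq> ear a b c d)}"

text \<open>The two-dimensional cells set aside; they will account for the 3-spheres.\<close>

definition "triangles = {ear a b b d | a b d. 2 \<le> d \<and> d < a \<and> a < b \<and> b < m}"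

lemma ear_edge:
  assumes "{x, y} \<in> \<tau>" "\<tau> \<subseteq> ear a b c d" "ind x" "ind y"
  shows "{x, y} = {a, b}"
  using subsetD[OF assms(2,1)] assms(3,4) by (simp add: ear_def)

lemma ear_point:
  assumes "{z, m} \<in> \<tau>" "\<tau> \<subseteq> ear a b c d" "ind a" "ind b"
  shows "z = c \<or> z = d"
  using subsetD[OF assms(2,1)] assms(3,4) by (simp add: ear_def)

lemma sorted_pair: "{x, y} = {a, b} \<Longrightarrow> x < y \<Longrightarrow> a < b \<Longrightarrow> x = a \<and> y = (b::nat)"
  by (auto simp: doubleton_eq_iff)

lemma ears_cases:
  assumes "\<tau> \<in> ears"
  obtains a b c d where "ind a" "ind b" "ind d" "a < b" "c = a \<or> c = b" "c \<noteq> d" "d = a \<or> d = b \<or> d < a" "\<tau> \<subseteq> ear a b c d"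
  using assms unfolding ears_def by blast

lemma earsI:
  assumes "\<tau> \<noteq> {}" "\<tau> \<subseteq> ear a b c d" "ind a" "ind b" "ind d" "a < b" "c = a \<or> c = b" "c \<noteq> d" "d = a \<or> d = b \<or> d < a"
  shows "\<tau> \<in> ears"
  unfolding ears_def by (intro CollectI conjI[OF assms(1)] exI[of _ a] exI[of _ b] exI[of _ c] exI[of _ d]) (use assms(2-) in simp)

lemma forks_cases:
  assumes "\<sigma> \<in> forks" "\<sigma> \<subseteq> \<tau>"
  obtains i x y where "distinct3 i x y" "x < i" "x < y" "{i, x} \<in> \<tau>" "{i, y} \<in> \<tau>"
proof -
  obtain i x y where "\<sigma> = {{i, x}, {i, y}}" "distinct3 i x y" "x < i" "x < y"
    using assms(1) unfolding forks_def by blast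
  then show thesis using that[of i x y] assms(2) by simp
qed

lemma ears_subset_stage4: "ears \<subseteq> stage4"
proof
  fix \<tau> assume "\<tau> \<in> ears"
  then have ne: "\<tau> \<noteq> {}" by (simp add: ears_def)
  from \<open>\<tau> \<in> ears\<close> obtain a b c d where
    q: "ind a" "ind b" "ind d" "a < b" "c = a \<or> c = b" "c \<noteq> d" "d = a \<or> d = b \<or> d < a" "\<tau> \<subseteq> ear a b c d"
    by (rule ears_cases)
  have c: "ind c" using q by blast
  have "ear a b c d \<subseteq> F2 m"
    using edge_F2[OF q(1,2)] point_F2[OF c] point_F2[OF q(3)] q(4) by (simp add: ear_def)
  then have F: "\<tau> \<subseteq> F2 m" using q(8) by (rule order_trans[rotated])
  have overlap: "\<tau> \<in> overlap"
  proof (rule star_in_overlap[OF ne F c q(3,6)])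
    fix u assume "u \<in> \<tau>"
    then have "u = {a, b} \<or> u = {c, m} \<or> u = {d, m}" using subsetD[OF q(8)] by (simp add: ear_def)
    then show "c \<in> u \<or> u = {d, m}" using q(5) by auto
  qed
  have nf: False if "{i, x} \<in> \<tau>" "{i, y} \<in> \<tau>" "distinct3 i x y" for i x y
  proof -
    have "{i, x} = {a, b}" "{i, y} = {a, b}"
      using ear_edge[OF that(1) q(8)] ear_edge[OF that(2) q(8)] that(3) by simp_all
    then have "{i, x} = {i, y}" by simp
    then show False using that(3) by simp
  qed
  have inC2: "\<tau> \<in> stage2" by (rule in_stage2[OF overlap]) (rule FalseE, rule nf)
  have lt: "z < x" if z: "distinct3 x y z" "x < y" "{x, y} \<in> \<tau>" "{z, m} \<in> \<tau>" for x y z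
  proof -
    have "{x, y} = {a, b}" using ear_edge[OF z(3) q(8)] z(1) by simp
    then have "x = a" "y = b" using sorted_pair[OF _ z(2) q(4)] by simp_all
    moreover have "z = c \<or> z = d" by (rule ear_point[OF z(4) q(8,1,2)])
    ultimately show ?thesis using z(1) q(5,7) by auto
  qed
  have "\<tau> \<in> stage3" unfolding stage3_iff by (intro conjI inC2 allI impI) (rule lt)
  moreover have "\<not> \<sigma> \<subseteq> \<tau>" if "\<sigma> \<in> forks" for \<sigma>
    using nf forks_cases[OF that] by metis
  ultimately show "\<tau> \<in> stage4" by (simp add: stage4_def delete_stars_def)
qed

lemma triangles_subset_stage4: "triangles \<subseteq> stage4"
proof
  fix \<tau> assume "\<tau> \<in> triangles"
  then obtain a b d where t: "2 \<le> d" "d < a" "a < b" "b < m" "\<tau> = ear a b b d" unfolding triangles_def by blast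
  have "\<tau> \<in> ears" by (rule earsI[of _ a b b d]) (use t in \<open>auto simp: ear_def\<close>)
  then show "\<tau> \<in> stage4" using ears_subset_stage4 by blast
qed

text \<open>
  Two different edges of a simplex would form a fork, and every fork has been deleted from one of
  the stages.
\<close>

lemma stage4_eq: "stage4 = ears"
proof
  show "stage4 \<subseteq> ears"
  proof
    fix \<tau> assume \<tau>: "\<tau> \<in> stage4"
    then have 3: "\<tau> \<in> stage3" by (simp add: stage4_def delete_stars_def)
    then have 2: "\<tau> \<in> stage2" by (simp add: stage3_iff)
    have overlap: "\<tau> \<in> overlap" and F: "\<tau> \<subseteq> F2 m" using stage2_subset[OF 2] by auto
    have ne: "\<tau> \<noteq> {}" by (rule complexD(2)[OF complex_overlap overlap])
    have forks: "{{i, x}, {i, y}} \<subseteq> \<tau> \<Longrightarrow> distinct3 i x y \<Longrightarrow> x < i \<Longrightarrow> x < y \<Longrightarrow> False" for i x y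
    proof -
      assume *: "{{i, x}, {i, y}} \<subseteq> \<tau>" "distinct3 i x y" "x < i" "x < y"
      have "{{i, x}, {i, y}} \<in> forks" unfolding forks_def
        by (intro CollectI exI[of _ i] exI[of _ x] exI[of _ y]) (use * in simp)
      moreover have "\<forall>\<sigma>\<in>forks. \<not> \<sigma> \<subseteq> \<tau>" using \<tau> by (simp add: stage4_def delete_stars_def)
      ultimately have "\<not> {{i, x}, {i, y}} \<subseteq> \<tau>" by (rule bspec[rotated])
      then show False using *(1) by simp
    qed
    have one: "u = u'" if u: "u \<in> \<tau>" "u' \<in> \<tau>" "m \<notin> u" "m \<notin> u'" for u u'
    proof (rule ccontr)
      assume "u \<noteq> u'"
      then obtain i x y where d: "distinct3 i x y" "u = {i, x}" "u' = {i, y}" using edges_meet[OF overlap u] by metis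
      have e: "{i, x} \<in> \<tau>" "{i, y} \<in> \<tau>" using d u by simp_all
      have "\<not> (i < x \<and> i < y)" by (rule fork_stage2(2)[OF 2 e d(1)])
      then have "x < i \<and> x < y \<or> y < i \<and> y < x" using d(1) by auto
      then show False
      proof
        assume "x < i \<and> x < y"
        then show False using forks[of i x y] e d(1) by simp
      next
        assume "y < i \<and> y < x"
        then show False using forks[of i y x] e d(1) by simp
      qed
    qed
    show "\<tau> \<in> ears"
    proof (cases "\<exists>u\<in>\<tau>. m \<notin> u")
      case True
      then obtain u where u: "u \<in> \<tau>" "m \<notin> u" by blast
      have "u \<in> F2 m" using u F by blast
      then obtain a b where ab: "ind a" "ind b" "a < b" "u = {a, b}" using u(2) by (cases rule: F2_cases) auto
      have e: "{a, b} \<in> \<tau>" using u ab by simp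
      have pts: "z = a \<or> z = b \<or> z < a" if "{z, m} \<in> \<tau>" "ind z" for z
        using 3 that e ab unfolding stage3_iff by (metis less_irrefl)
      have point: "\<exists>z. ind z \<and> v = {z, m}" if "v \<in> \<tau>" "v \<noteq> {a, b}" for v
      proof -
        have "m \<in> v" using one[OF that(1) e] that(2) ab by auto
        moreover have "v \<in> F2 m" using that F by blast
        ultimately show ?thesis by (cases rule: F2_cases[OF \<open>v \<in> F2 m\<close>]) auto
      qed
      show ?thesis
      proof (cases "\<exists>z. {z, m} \<in> \<tau> \<and> ind z \<and> z < a")
        case True
        then obtain d where d: "{d, m} \<in> \<tau>" "ind d" "d < a" by blast
        have out: "z = d" if "{z, m} \<in> \<tau>" "ind z" "z \<notin> {a, b}" for z
          by (rule edge_points[OF overlap e that(1) d(1) ab(1,2) that(3)]) (use d ab in auto)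
        have no3: "{a, m} \<notin> \<tau> \<or> {b, m} \<notin> \<tau>" using points_le_2[OF overlap, of a b d] d ab by auto
        obtain c where c: "c = a \<or> c = b" "\<And>z. z \<in> {a, b} \<Longrightarrow> {z, m} \<in> \<tau> \<Longrightarrow> z = c" using no3 by blast
        have "v \<in> ear a b c d" if v: "v \<in> \<tau>" for v
        proof (cases "v = {a, b}")
          case False
          then obtain z where z: "ind z" "v = {z, m}" using point[OF v] by blast
          then have "z = c \<or> z = d" using out[of z] c(2)[of z] v by blast
          then show ?thesis using z by (auto simp: ear_def)
        qed (simp add: ear_def)
        then have "\<tau> \<subseteq> ear a b c d" by blast
        then show ?thesis by (rule earsI[OF ne]) (use ab d c(1) in auto)
      next
        case False
        have "v \<in> ear a b a b" if v: "v \<in> \<tau>" for v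
        proof (cases "v = {a, b}")
          case False
          then obtain z where z: "ind z" "v = {z, m}" using point[OF v] by blast
          then have "z = a \<or> z = b" using pts[of z] v \<open>\<not> (\<exists>z. {z, m} \<in> \<tau> \<and> ind z \<and> z < a)\<close> by blast
          then show ?thesis using z by (auto simp: ear_def)
        qed (simp add: ear_def)
        then have "\<tau> \<subseteq> ear a b a b" by blast
        then show ?thesis by (rule earsI[OF ne]) (use ab in auto)
      qed
    next
      case False
      have point: "\<exists>z. ind z \<and> v = {z, m}" if "v \<in> \<tau>" for v
      proof -
        have "v \<in> F2 m" using that F by blast
        then show ?thesis by (cases rule: F2_cases) (use False that in auto)
      qed
      obtain u where "u \<in> \<tau>" using ne by blast
      then obtain p where p: "ind p" "{p, m} \<in> \<tau>" using point by blast
      obtain q where q: "ind q" "q \<noteq> p" "\<And>z. {z, m} \<in> \<tau> \<Longrightarrow> ind z \<Longrightarrow> z = p \<or> z = q"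
      proof (cases "\<exists>q. ind q \<and> q \<noteq> p \<and> {q, m} \<in> \<tau>")
        case True
        then obtain q where "ind q" "q \<noteq> p" "{q, m} \<in> \<tau>" by blast
        then show thesis using that[of q] points_le_2[OF overlap p(2), of q] by blast
      next
        case False
        have "ind (if p = 1 then 2 else 1)" "(if p = 1 then 2 else 1) \<noteq> p" using m3 by auto
        then show thesis using that False by blast
      qed
      have sub: "\<tau> \<subseteq> {{p, m}, {q, m}}"
      proof
        fix v assume v: "v \<in> \<tau>"
        obtain z where "ind z" "v = {z, m}" using point[OF v] by blast
        then show "v \<in> {{p, m}, {q, m}}" using q(3) v by blast
      qed
      show ?thesis
      proof (cases "p < q")
        case True
        show ?thesis by (rule earsI[OF ne, of p q p q]) (use sub p q True in \<open>auto simp: ear_def\<close>)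
      next
        case False
        show ?thesis by (rule earsI[OF ne, of q p q p]) (use sub p q False in \<open>auto simp: ear_def\<close>)
      qed
    qed
  qed
qed (rule ears_subset_stage4)

definition "open_ears = ears - triangles"

lemma ear_eq:
  assumes "\<tau> \<subseteq> ear a b c d" "ear a' b' c' d' \<subseteq> \<tau>" "ind a" "ind b" "a < b" "ind a'" "ind b'" "a' < b'"
  shows "a' = a" "b' = b" "{c', d'} \<subseteq> {c, d}"
proof -
  have "{a', b'} \<in> \<tau>" "{c', m} \<in> \<tau>" "{d', m} \<in> \<tau>" using assms(2) by (simp_all add: ear_def)
  then have "{a', b'} = {a, b}" "c' = c \<or> c' = d" "d' = c \<or> d' = d"
    using ear_edge[OF _ assms(1)] ear_point[OF _ assms(1,3,4)] assms(6,7) by simp_all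
  then show "a' = a" "b' = b" "{c', d'} \<subseteq> {c, d}" using sorted_pair[OF _ assms(8,5)] by auto
qed

lemma triangle_maximal:
  assumes "\<sigma> \<in> triangles" "\<tau> \<in> ears" "\<sigma> \<subseteq> \<tau>"
  shows "\<tau> = \<sigma>"
proof -
  obtain a b d where t: "2 \<le> d" "d < a" "a < b" "b < m" "\<sigma> = ear a b b d" using assms(1) unfolding triangles_def by blast
  obtain a' b' c' d' where q: "ind a'" "ind b'" "ind d'" "a' < b'" "c' = a' \<or> c' = b'" "c' \<noteq> d'" "d' = a' \<or> d' = b' \<or> d' < a'" "\<tau> \<subseteq> ear a' b' c' d'"
    using assms(2) by (rule ears_cases)
  have e: "a = a'" "b = b'" "{b, d} \<subseteq> {c', d'}"
    using ear_eq[OF q(8) _ q(1,2,4), of a b b d] assms(3) t by simp_all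
  have "d \<noteq> c'" using e t(2,3) q(5) by auto
  then have "d' = d" "c' = b" using e(3) t(2,3) by auto
  then have "ear a' b' c' d' = \<sigma>" using e t(5) by simp
  then show ?thesis using q(8) assms(3) by simp
qed

lemma complex_ears: "simplicial_complex ears"
  using complex_stage4 by (simp add: stage4_eq)

lemma complex_open_ears: "simplicial_complex open_ears"
proof (rule complexI)
  show "finite open_ears" using complex_finite[OF complex_ears] by (simp add: open_ears_def)
  show "\<rho> \<in> open_ears" if "\<tau> \<in> open_ears" "\<rho> \<noteq> {}" "\<rho> \<subseteq> \<tau>" for \<tau> \<rho>
  proof -
    have "\<tau> \<in> ears" "\<tau> \<notin> triangles" using that(1) by (simp_all add: open_ears_def)
    then show ?thesis using complexD(3)[OF complex_ears _ that(2,3)] triangle_maximal[of \<rho> \<tau>] that(3)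
      unfolding open_ears_def by auto
  qed
qed (use complexD(1,2)[OF complex_ears] in \<open>auto simp: open_ears_def\<close>)

text \<open>
  The ear with points \<open>{b, m}\<close>, \<open>{d, m}\<close> is one of the triangles that were
  set aside, so these pairs lie only in the ear with points \<open>{a, m}\<close>, \<open>{d,
  m}\<close>.
\<close>

definition "inner_points = {{{a, b}, {d, m}} | a b d. 2 \<le> d \<and> d < a \<and> a < b \<and> b < m}"

definition "point_pairs = {{{a, m}, {b, m}} | a b. 2 \<le> a \<and> a < b \<and> b < m}"

lemma open_earsI:
  assumes "\<tau> \<noteq> {}" "\<tau> \<subseteq> ear a b c d" "ind a" "ind b" "ind d" "a < b" "c = a \<or> c = b" "c \<noteq> d" "d = a \<or> d = b \<or> d < a"
    "d < a \<Longrightarrow> c = a \<or> d = 1"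
  shows "\<tau> \<in> open_ears"
proof -
  have "\<tau> \<notin> triangles"
  proof
    assume "\<tau> \<in> triangles"
    then obtain a' b' d' where t: "2 \<le> d'" "d' < a'" "a' < b'" "b' < m" "\<tau> = ear a' b' b' d'" unfolding triangles_def by blast
    have "a' = a" "b' = b" "{b', d'} \<subseteq> {c, d}"
      using ear_eq[OF assms(2) _ assms(3,4,6), of a' b' b' d'] t by simp_all
    then show False using t assms(7-10) by auto
  qed
  then show ?thesis using earsI[OF assms(1-9)] by (simp add: open_ears_def)
qed

lemma open_ears_inner_point:
  assumes "\<tau> \<in> open_ears" "{a, b} \<in> \<tau>" "{d, m} \<in> \<tau>" "2 \<le> d" "d < a" "a < b" "b < m"
  shows "\<tau> \<subseteq> ear a b a d"
proof -
  have \<tau>: "\<tau> \<in> ears" "\<tau> \<notin> triangles" using assms(1) by (simp_all add: open_ears_def)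
  obtain a' b' c' d' where q: "ind a'" "ind b'" "ind d'" "a' < b'" "c' = a' \<or> c' = b'" "c' \<noteq> d'" "d' = a' \<or> d' = b' \<or> d' < a'" "\<tau> \<subseteq> ear a' b' c' d'"
    using \<tau>(1) by (rule ears_cases)
  have "{a, b} = {a', b'}" using ear_edge[OF assms(2) q(8)] assms by simp
  then have ab: "a' = a" "b' = b" using sorted_pair[OF _ assms(6) q(4)] by simp_all
  have "d = c' \<or> d = d'" by (rule ear_point[OF assms(3) q(8,1,2)])
  then have d: "d' = d" using ab assms(5,6) q(5) by auto
  show ?thesis
  proof (cases "c' = a")
    case False
    then have c: "c' = b" using q(5) ab by simp
    have "{b, m} \<notin> \<tau>"
    proof
      assume "{b, m} \<in> \<tau>"
      then have "ear a b b d \<subseteq> \<tau>" using assms(2,3) by (simp add: ear_def)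
      moreover have "ear a b b d \<in> triangles" unfolding triangles_def
        by (intro CollectI exI[of _ a] exI[of _ b] exI[of _ d]) (use assms in simp)
      ultimately show False using triangle_maximal[OF _ \<tau>(1)] \<tau>(2) by metis
    qed
    then have "\<tau> \<subseteq> {{a, b}, {d, m}}" using q(8) unfolding ear_def c d ab by (auto dest!: subsetD)
    then show ?thesis by (auto simp: ear_def)
  qed (use q(8) ab d in simp)
qed

lemma collapse_inner_points: "collapses open_ears (delete_stars inner_points open_ears)"
proof (rule collapses_delete_stars_ex[OF complex_open_ears])
  show "\<sigma> \<noteq> {}" if "\<sigma> \<in> inner_points" for \<sigma> using that by (auto simp: inner_points_def)
  fix \<sigma> assume "\<sigma> \<in> inner_points"
  then obtain a b d where \<sigma>: "\<sigma> = {{a, b}, {d, m}}" "2 \<le> d" "d < a" "a < b" "b < m" unfolding inner_points_def by blast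
  show "\<exists>v. v \<notin> \<sigma> \<and> (\<forall>\<tau>\<in>open_ears. \<sigma> \<subseteq> \<tau> \<longrightarrow> insert v \<tau> \<in> open_ears \<and> (\<forall>\<sigma>'\<in>inner_points. \<sigma>' \<subseteq> insert v \<tau> \<longrightarrow> \<sigma>' \<subseteq> \<tau>))"
  proof (intro exI[of _ "{a, m}"] conjI ballI impI)
    show "{a, m} \<notin> \<sigma>" using \<sigma> by simp
    fix \<tau> assume \<tau>: "\<tau> \<in> open_ears" "\<sigma> \<subseteq> \<tau>"
    have e: "{a, b} \<in> \<tau>" "{d, m} \<in> \<tau>" using \<tau>(2) \<sigma>(1) by simp_all
    have "\<tau> \<subseteq> ear a b a d" by (rule open_ears_inner_point[OF \<tau>(1) e \<sigma>(2-5)])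
    then have sub: "insert {a, m} \<tau> \<subseteq> ear a b a d" by (simp add: ear_def)
    show "insert {a, m} \<tau> \<in> open_ears" by (rule open_earsI[OF _ sub]) (use \<sigma> in auto)
    fix \<sigma>' assume \<sigma>': "\<sigma>' \<in> inner_points" "\<sigma>' \<subseteq> insert {a, m} \<tau>"
    obtain a' b' d' where s: "\<sigma>' = {{a', b'}, {d', m}}" "2 \<le> d'" "d' < a'" "a' < b'" "b' < m"
      using \<sigma>'(1) unfolding inner_points_def by blast
    have mem: "{a', b'} \<in> insert {a, m} \<tau>" "{d', m} \<in> insert {a, m} \<tau>" using \<sigma>'(2) s(1) by simp_all
    have "{a', b'} = {a, b}" using ear_edge[OF mem(1) sub] s by simp
    then have "a' = a" "b' = b" using sorted_pair[OF _ s(4) \<sigma>(4)] by simp_all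
    moreover have "d' = a \<or> d' = d" by (rule ear_point[OF mem(2) sub]) (use \<sigma> in auto)
    ultimately have "d' = d" using s(3) by auto
    then show "\<sigma>' \<subseteq> \<tau>" using s(1) e \<open>a' = a\<close> \<open>b' = b\<close> by simp
  qed
qed

definition "stage6 = delete_stars inner_points open_ears"

lemma complex_stage6: "simplicial_complex stage6"
  unfolding stage6_def by (rule complex_delete_stars[OF complex_open_ears])

lemma stage6I:
  assumes "\<tau> \<noteq> {}" "\<tau> \<subseteq> ear a b c d" "ind a" "ind b" "ind d" "a < b" "c = a \<or> c = b" "c \<noteq> d" "d = a \<or> d = b \<or> d = 1"
  shows "\<tau> \<in> stage6"
proof -
  have "\<tau> \<in> open_ears" by (rule open_earsI[OF assms(1-8)]) (use assms in auto)
  moreover have "\<not> \<sigma> \<subseteq> \<tau>" if S: "\<sigma> \<in> inner_points" for \<sigma>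
  proof
    assume sub: "\<sigma> \<subseteq> \<tau>"
    obtain a' b' d' where s: "\<sigma> = {{a', b'}, {d', m}}" "2 \<le> d'" "d' < a'" "a' < b'" "b' < m"
      using S unfolding inner_points_def by blast
    have mem: "{a', b'} \<in> \<tau>" "{d', m} \<in> \<tau>" using sub s(1) by simp_all
    have "{a', b'} = {a, b}" using ear_edge[OF mem(1) assms(2)] s by simp
    then have "a' = a" "b' = b" using sorted_pair[OF _ s(4) assms(6)] by simp_all
    moreover have "d' = c \<or> d' = d" by (rule ear_point[OF mem(2) assms(2-4)])
    ultimately show False using s(2-4) assms(7,9) by auto
  qed
  ultimately show ?thesis by (simp add: stage6_def delete_stars_def)
qed

lemma stage6_cases:
  assumes "\<tau> \<in> stage6"
  obtains a b c d where "ind a" "ind b" "ind d" "a < b" "c = a \<or> c = b" "c \<noteq> d" "d = a \<or> d = b \<or> d = 1" "\<tau> \<subseteq> ear a b c d"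
proof -
  have \<tau>: "\<tau> \<in> open_ears" "\<tau> \<in> ears" using assms by (simp_all add: stage6_def delete_stars_def open_ears_def)
  obtain a b c d where q: "ind a" "ind b" "ind d" "a < b" "c = a \<or> c = b" "c \<noteq> d" "d = a \<or> d = b \<or> d < a" "\<tau> \<subseteq> ear a b c d"
    using \<tau>(2) by (rule ears_cases)
  show thesis
  proof (cases "d = a \<or> d = b \<or> d = 1")
    case True
    then show thesis using that[of a b d c] q by blast
  next
    case False
    then have d: "2 \<le> d" "d < a" using q by auto
    have "{a, b} \<notin> \<tau> \<or> {d, m} \<notin> \<tau>"
    proof (rule ccontr)
      assume neg: "\<not> ?thesis"
      have "{{a, b}, {d, m}} \<in> inner_points" unfolding inner_points_def
        by (intro CollectI exI[of _ a] exI[of _ b] exI[of _ d]) (use d q in simp)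
      moreover have "\<forall>\<sigma>\<in>inner_points. \<not> \<sigma> \<subseteq> \<tau>" using assms by (simp add: stage6_def delete_stars_def)
      ultimately have "\<not> {{a, b}, {d, m}} \<subseteq> \<tau>" by (rule bspec[rotated])
      then show False using neg by simp
    qed
    then show thesis
    proof
      assume n: "{a, b} \<notin> \<tau>"
      have "v \<in> ear d c d c" if v: "v \<in> \<tau>" for v
      proof -
        have "v \<noteq> {a, b}" using n v by blast
        then show ?thesis using subsetD[OF q(8) v] by (auto simp: ear_def)
      qed
      then have "\<tau> \<subseteq> ear d c d c" by blast
      then show thesis using that[of d c c d] q d by auto
    next
      assume n: "{d, m} \<notin> \<tau>"
      have "v \<in> ear a b a b" if v: "v \<in> \<tau>" for v
      proof -
        have "v \<noteq> {d, m}" using n v by blast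
        then show ?thesis using subsetD[OF q(8) v] q(5) by (auto simp: ear_def)
      qed
      then have "\<tau> \<subseteq> ear a b a b" by blast
      then show thesis using that[of a b b a] q by auto
    qed
  qed
qed

lemma stage6_two_points:
  assumes "\<tau> \<in> stage6" "{a, m} \<in> \<tau>" "{b, m} \<in> \<tau>" "2 \<le> a" "a < b" "b < m"
  shows "\<tau> \<subseteq> ear a b a b"
proof -
  obtain a' b' c' d' where q: "ind a'" "ind b'" "ind d'" "a' < b'" "c' = a' \<or> c' = b'" "c' \<noteq> d'" "d' = a' \<or> d' = b' \<or> d' = 1" "\<tau> \<subseteq> ear a' b' c' d'"
    using assms(1) by (rule stage6_cases)
  have "a = c' \<or> a = d'" by (rule ear_point[OF assms(2) q(8,1,2)])
  moreover have "b = c' \<or> b = d'" by (rule ear_point[OF assms(3) q(8,1,2)])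
  ultimately have *: "a = c' \<and> b = d' \<or> a = d' \<and> b = c'" using assms(5) by auto
  then have "a' = a" "b' = b" using q(4,5,7) assms(4,5) by auto
  then have "ear a' b' c' d' = ear a b a b" using * by (auto simp: ear_def)
  then show ?thesis using q(8) by simp
qed

lemma collapse_point_pairs: "collapses stage6 (delete_stars point_pairs stage6)"
proof (rule collapses_delete_stars_ex[OF complex_stage6])
  show "\<sigma> \<noteq> {}" if "\<sigma> \<in> point_pairs" for \<sigma> using that by (auto simp: point_pairs_def)
  fix \<sigma> assume "\<sigma> \<in> point_pairs"
  then obtain a b where \<sigma>: "\<sigma> = {{a, m}, {b, m}}" "2 \<le> a" "a < b" "b < m" unfolding point_pairs_def by blast
  show "\<exists>v. v \<notin> \<sigma> \<and> (\<forall>\<tau>\<in>stage6. \<sigma> \<subseteq> \<tau> \<longrightarrow> insert v \<tau> \<in> stage6 \<and> (\<forall>\<sigma>'\<in>point_pairs. \<sigma>' \<subseteq> insert v \<tau> \<longrightarrow> \<sigma>' \<subseteq> \<tau>))"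
  proof (intro exI[of _ "{a, b}"] conjI ballI impI)
    show "{a, b} \<notin> \<sigma>" using \<sigma> by simp
    fix \<tau> assume \<tau>: "\<tau> \<in> stage6" "\<sigma> \<subseteq> \<tau>"
    have e: "{a, m} \<in> \<tau>" "{b, m} \<in> \<tau>" using \<tau>(2) \<sigma>(1) by simp_all
    have "\<tau> \<subseteq> ear a b a b" by (rule stage6_two_points[OF \<tau>(1) e \<sigma>(2-4)])
    then have sub: "insert {a, b} \<tau> \<subseteq> ear a b a b" by (simp add: ear_def)
    show "insert {a, b} \<tau> \<in> stage6" by (rule stage6I[OF _ sub]) (use \<sigma> in auto)
    fix \<sigma>' assume \<sigma>': "\<sigma>' \<in> point_pairs" "\<sigma>' \<subseteq> insert {a, b} \<tau>"
    obtain a' b' where s: "\<sigma>' = {{a', m}, {b', m}}" using \<sigma>'(1) unfolding point_pairs_def by blast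
    have "{a, b} \<notin> \<sigma>'" using \<sigma> unfolding s by simp
    then show "\<sigma>' \<subseteq> \<tau>" using \<sigma>'(2) by (simp add: subset_insert)
  qed
qed

text \<open>
  Two points other than \<open>{1, m}\<close> no longer occur together, so \<open>{1, m}\<close> may
  always be added.
\<close>

lemma collapse_rest: "collapses (delete_stars point_pairs stage6) {{{1, m}}}"
proof (rule collapses_to_apex)
  show "simplicial_complex (delete_stars point_pairs stage6)" by (rule complex_delete_stars[OF complex_stage6])
  have point_pairs: "\<not> \<sigma> \<subseteq> insert {1, m} \<tau>" if S: "\<sigma> \<in> point_pairs" "\<not> \<sigma> \<subseteq> \<tau>" for \<sigma> \<tau>
  proof -
    obtain a b where s: "\<sigma> = {{a, m}, {b, m}}" "2 \<le> a" "a < b" using S(1) unfolding point_pairs_def by blast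
    then have "{1, m} \<notin> \<sigma>" by simp
    then show ?thesis using S(2) by (simp add: subset_insert)
  qed
  have "{{1, m}} \<in> stage6" by (rule stage6I[of _ 1 2 1 2]) (use m3 in \<open>auto simp: ear_def\<close>)
  moreover have "\<not> \<sigma> \<subseteq> {{1, m}}" if "\<sigma> \<in> point_pairs" for \<sigma>
    by (rule point_pairs[OF that]) (use that in \<open>auto simp: point_pairs_def\<close>)
  ultimately show "{{1, m}} \<in> delete_stars point_pairs stage6" by (simp add: delete_stars_def)
  fix \<tau> assume \<tau>: "\<tau> \<in> delete_stars point_pairs stage6"
  then have "\<tau> \<in> stage6" by (simp add: delete_stars_def)
  then obtain a b c d where q: "ind a" "ind b" "ind d" "a < b" "c = a \<or> c = b" "c \<noteq> d" "d = a \<or> d = b \<or> d = 1" "\<tau> \<subseteq> ear a b c d"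
    by (rule stage6_cases)
  have "insert {1, m} \<tau> \<in> stage6"
  proof (cases "c = 1 \<or> d = 1")
    case True
    then have "insert {1, m} \<tau> \<subseteq> ear a b c d" using q(8) by (auto simp: ear_def)
    then show ?thesis by (rule stage6I[OF _ _ q(1-7), rotated]) simp
  next
    case False
    then have cd: "c = a \<and> d = b \<or> c = b \<and> d = a" using q by auto
    then have ea: "ear a b c d = ear a b a b" by (auto simp: ear_def)
    have "2 \<le> a" using False cd q(1) by auto
    then have "{{a, m}, {b, m}} \<in> point_pairs" unfolding point_pairs_def
      by (intro CollectI exI[of _ a] exI[of _ b]) (use q in simp)
    moreover have "\<forall>\<sigma>\<in>point_pairs. \<not> \<sigma> \<subseteq> \<tau>" using \<tau> by (simp add: delete_stars_def)
    ultimately have "\<not> {{a, m}, {b, m}} \<subseteq> \<tau>" by (rule bspec[rotated])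
    then obtain e where e: "e = a \<or> e = b" "{e, m} \<notin> \<tau>" by auto
    define e' where "e' = (if e = a then b else a)"
    have "v \<in> ear a b e' 1" if v: "v \<in> insert {1, m} \<tau>" for v
    proof (cases "v = {1, m}")
      case False
      then have "v \<in> \<tau>" using v by simp
      then have "v \<noteq> {e, m}" using e(2) by blast
      then show ?thesis using subsetD[OF q(8) \<open>v \<in> \<tau>\<close>] e(1) unfolding ea by (auto simp: ear_def e'_def)
    qed (simp add: ear_def)
    then have "insert {1, m} \<tau> \<subseteq> ear a b e' 1" by blast
    then show ?thesis
      by (rule stage6I[rotated]) (use q \<open>2 \<le> a\<close> in \<open>auto simp: e'_def\<close>)
  qed
  then show "insert {1, m} \<tau> \<in> delete_stars point_pairs stage6"
    using point_pairs \<tau> by (simp add: delete_stars_def)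
qed

lemma collapse_open_ears: "collapses open_ears {{{1, m}}}"
  using collapse_inner_points collapse_point_pairs collapse_rest unfolding stage6_def[symmetric] by (meson collapses_trans)

lemma collapse_stage1: "collapses stage1 ears"
  using collapse_wide_forks collapse_outer_points collapse_forks unfolding stage4_eq by (meson collapses_trans)

end

section \<open>Counting the cells\<close>

text \<open>
  The map \<open>g\<close> recovers the set of indices, so the family corresponds to the 3-subsets
  of \<open>{l..<m}\<close>.
\<close>

lemma card_sorted_triples:
  fixes f :: "nat \<Rightarrow> nat \<Rightarrow> nat \<Rightarrow> 'c" and g :: "'c \<Rightarrow> nat set"
  assumes g: "\<And>a b c. l \<le> a \<Longrightarrow> a < b \<Longrightarrow> b < c \<Longrightarrow> c < m \<Longrightarrow> g (f a b c) = {a, b, c}"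
  shows "card {f a b c | a b c. l \<le> a \<and> a < b \<and> b < c \<and> c < m} = (m - l) choose 3"
    "finite {f a b c | a b c. l \<le> a \<and> a < b \<and> b < c \<and> c < m}"
proof -
  let ?F = "{f a b c | a b c. l \<le> a \<and> a < b \<and> b < c \<and> c < m}"
  let ?T = "{T. T \<subseteq> {l..<m} \<and> card T = 3}"
  have inj: "inj_on g ?F"
  proof (rule inj_onI)
    fix s t assume "s \<in> ?F" "t \<in> ?F" and eq: "g s = g t"
    then obtain a b c a' b' c' where s: "s = f a b c" "l \<le> a" "a < b" "b < c" "c < m"
      and t: "t = f a' b' c'" "l \<le> a'" "a' < b'" "b' < c'" "c' < m" by blast
    have eq': "{a, b, c} = {a', b', c'}" using eq g[OF s(2-5)] g[OF t(2-5)] s(1) t(1) by simp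
    have "Min {a, b, c} = a" "Max {a, b, c} = c" "Min {a', b', c'} = a'" "Max {a', b', c'} = c'"
      using s t by auto
    then have "a = a'" "c = c'" using eq' by simp_all
    have "{b} = {a, b, c} - {a, c}" using s by auto
    also have "\<dots> = {a', b', c'} - {a', c'}" using eq' \<open>a = a'\<close> \<open>c = c'\<close> by simp
    also have "\<dots> = {b'}" using t by auto
    finally have "b = b'" by simp
    then show "s = t" using s t \<open>a = a'\<close> \<open>c = c'\<close> by simp
  qed
  have im: "g ` ?F = ?T"
  proof
    show "g ` ?F \<subseteq> ?T" using g by auto
    show "?T \<subseteq> g ` ?F"
    proof
      fix T assume T: "T \<in> ?T"
      then have fin: "finite T" "T \<subseteq> {l..<m}" "card T = 3" by (auto simp: finite_subset[of T "{l..<m}"])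
      define a where "a = Min T"
      define c where "c = Max T"
      have ne: "T \<noteq> {}" using fin by auto
      have ac: "a \<in> T" "c \<in> T" "\<And>x. x \<in> T \<Longrightarrow> a \<le> x \<and> x \<le> c" using fin ne by (auto simp: a_def c_def)
      have "card {a, c} \<le> 2" by (simp add: card_insert_if)
      then have "T - {a, c} \<noteq> {}" using fin card_mono[of "{a, c}" T] by fastforce
      then obtain b where b: "b \<in> T" "b \<noteq> a" "b \<noteq> c" by blast
      have lt: "a < b" "b < c" using ac(3)[OF b(1)] b by auto
      have "{a, b, c} = T" using fin ac b lt by (intro card_subset_eq) auto
      moreover have "l \<le> a" "c < m" using ac(1,2) fin(2) by auto
      ultimately have "T = g (f a b c)" "f a b c \<in> ?F" using g[of a b c] lt by auto
      then show "T \<in> g ` ?F" by blast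
    qed
  qed
  have "card ?F = card ?T" using card_image[OF inj] im by simp
  also have "\<dots> = (m - l) choose 3" using n_subsets[of "{l..<m}" 3] by simp
  finally show "card ?F = (m - l) choose 3" .
  have "finite (g ` ?F)" unfolding im by (rule finite_subset[of _ "Pow {l..<m}"]) auto
  then show "finite ?F" using inj finite_image_iff by blast
qed

text \<open>
  The 3-sphere that is the join of the boundaries of the triangles \<open>x, y, z\<close> and
  \<open>a, b, c\<close>, without the tetrahedron \<open>x, y, b, c\<close>.
\<close>

definition punctured_join :: "'a \<Rightarrow> 'a \<Rightarrow> 'a \<Rightarrow> 'a \<Rightarrow> 'a \<Rightarrow> 'a \<Rightarrow> 'a set set" where
  "punctured_join x y z a b c = {\<tau>. \<tau> \<noteq> {} \<and> \<tau> \<subseteq> {x, y, z, a, b, c} \<and> \<not> {x, y, z} \<subseteq> \<tau> \<and>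
     \<not> {a, b, c} \<subseteq> \<tau> \<and> \<not> {x, y, b, c} \<subseteq> \<tau>}"

text \<open>
  Without the tetrahedron, the link of \<open>x, y\<close> is a path with middle vertex
  \<open>a\<close>; deleting it leaves a cone with apex \<open>z\<close>.
\<close>

lemma punctured_join:
  assumes d: "distinct [x, y, z, a, b, c]"
  shows "simplicial_complex (punctured_join x y z a b c)"
    "collapses (punctured_join x y z a b c) {{z}}"
    "boundary {x, y, b, c} \<subseteq> punctured_join x y z a b c"
proof -
  let ?U = "punctured_join x y z a b c"
  show U: "simplicial_complex ?U"
  proof (rule complexI)
    have "?U \<subseteq> Pow {x, y, z, a, b, c}" unfolding punctured_join_def by blast
    then show "finite ?U" by (rule finite_subset) simp
    show "finite \<tau>" if "\<tau> \<in> ?U" for \<tau>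
      using that finite_subset[of \<tau> "{x, y, z, a, b, c}"] by (simp add: punctured_join_def)
    show "\<rho> \<in> ?U" if "\<tau> \<in> ?U" "\<rho> \<noteq> {}" "\<rho> \<subseteq> \<tau>" for \<tau> \<rho>
      using that unfolding punctured_join_def mem_Collect_eq by (meson subset_trans)
  qed (simp add: punctured_join_def)
  show "boundary {x, y, b, c} \<subseteq> ?U"
  proof
    fix \<tau> assume "\<tau> \<in> boundary {x, y, b, c}"
    then have \<tau>: "\<tau> \<noteq> {}" "\<tau> \<subseteq> {x, y, b, c}" "\<tau> \<noteq> {x, y, b, c}" by (auto simp: boundary_def)
    have "z \<notin> \<tau>" "a \<notin> \<tau>" using \<tau>(2) d by auto
    moreover have "\<tau> \<subseteq> {x, y, z, a, b, c}" using \<tau>(2) by blast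
    moreover have "\<not> {x, y, b, c} \<subseteq> \<tau>" using \<tau>(2,3) by blast
    ultimately show "\<tau> \<in> ?U" using \<tau>(1) by (simp add: punctured_join_def)
  qed
  define V where "V = delete_star {x, y} ?U"
  have "collapses ?U V" unfolding V_def
  proof (rule collapses.delete[OF collapses.none, of _ _ a])
    show "{x, y} \<in> ?U" "a \<notin> {x, y}" using d by (auto simp: punctured_join_def)
    show "insert a \<tau> \<in> ?U" if "\<tau> \<in> ?U" "{x, y} \<subseteq> \<tau>" for \<tau>
      using that d by (auto simp: punctured_join_def)
  qed
  moreover have "collapses V {{z}}"
  proof (rule collapses_to_apex)
    show "simplicial_complex V" unfolding V_def by (rule complex_delete_star[OF U])
    show "{z} \<in> V" using d by (auto simp: V_def delete_star_def punctured_join_def)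
    show "insert z \<tau> \<in> V" if "\<tau> \<in> V" for \<tau>
      using that d by (auto simp: V_def delete_star_def punctured_join_def)
  qed
  ultimately show "collapses ?U {{z}}" by (meson collapses_trans)
qed

lemma drop_edge:
  assumes "\<tau> \<subseteq> {x, y, z, a, b, c}"
  shows "x \<notin> \<tau> \<Longrightarrow> \<tau> \<subseteq> {y, z, c, a, b}" "y \<notin> \<tau> \<Longrightarrow> \<tau> \<subseteq> {x, z, b, a, c}" "z \<notin> \<tau> \<Longrightarrow> \<tau> \<subseteq> {x, y, a, b, c}"
  using assms by blast+

context two_subsets
begin

lemma card_quads: "card quads = (m - 1) choose 3" and finite_quads: "finite quads"
proof -
  have g: "\<Union>{{a, b}, {a, c}, {b, m}, {c, m}} - {m} = {a, b, c}" if "1 \<le> a" "a < b" "b < c" "c < m" for a b c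
    using that by auto
  show "card quads = (m - 1) choose 3" "finite quads"
    unfolding quads_def using card_sorted_triples[where g = "\<lambda>\<sigma>. \<Union>\<sigma> - {m}" and f = "\<lambda>a b c. {{a, b}, {a, c}, {b, m}, {c, m}}", OF g]
    by blast+
qed

lemma card_triangles: "card triangles = (m - 2) choose 3" and finite_triangles: "finite triangles"
proof -
  have eq: "triangles = {ear b c c a | a b c. 2 \<le> a \<and> a < b \<and> b < c \<and> c < m}"
    unfolding triangles_def by blast
  have g: "\<Union>(ear b c c a) - {m} = {a, b, c}" if "2 \<le> a" "a < b" "b < c" "c < m" for a b c
    using that by (auto simp: ear_def)
  show "card triangles = (m - 2) choose 3" "finite triangles"
    unfolding eq using card_sorted_triples[where g = "\<lambda>\<sigma>. \<Union>\<sigma> - {m}" and f = "\<lambda>a b c. ear b c c a", OF g]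
    by blast+
qed

lemma card_quad: "\<sigma> \<in> quads \<Longrightarrow> card \<sigma> = 4"
proof -
  assume "\<sigma> \<in> quads"
  then obtain a b c where "1 \<le> a \<and> a < b \<and> b < c \<and> c < m" "\<sigma> = {{a, b}, {a, c}, {b, m}, {c, m}}"
    unfolding quads_def by blast
  then show ?thesis by simp
qed

lemma card_triangle: "\<sigma> \<in> triangles \<Longrightarrow> card \<sigma> = 3"
proof -
  assume "\<sigma> \<in> triangles"
  then obtain a b d where "2 \<le> d" "d < a" "a < b" "b < m" "\<sigma> = ear a b b d"
    unfolding triangles_def by blast
  then show ?thesis by (simp add: ear_def)
qed

lemma quads_subset_overlap: "quads \<subseteq> overlap"
proof
  fix \<sigma> assume "\<sigma> \<in> quads"
  then obtain a b c where "1 \<le> a \<and> a < b \<and> b < c \<and> c < m" "\<sigma> = {{a, b}, {a, c}, {b, m}, {c, m}}"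
    unfolding quads_def by blast
  then show "\<sigma> \<in> overlap" using square_in_overlap[of \<sigma> a b c] by simp
qed

lemma triangles_subset_ears: "triangles \<subseteq> ears"
  using triangles_subset_stage4 by (simp add: stage4_eq)

text \<open>
  The 3-sphere of the triple, punctured at the quad, is collapsible and contains no other quad.
\<close>

lemma boundary_quad:
  assumes "\<sigma> \<in> quads"
  obtains a where "homotopic_with_canon (\<lambda>_. True) (points (boundary \<sigma>)) (points stage1) (\<lambda>x. x) (\<lambda>_. a)"
proof -
  obtain a b c where abc: "1 \<le> a \<and> a < b \<and> b < c \<and> c < m" and \<sigma>: "\<sigma> = {{a, b}, {a, c}, {b, m}, {c, m}}"
    using assms unfolding quads_def by blast
  let ?ab = "{a, b}" and ?ac = "{a, c}" and ?bc = "{b, c}" and ?a = "{a, m}" and ?b = "{b, m}" and ?c = "{c, m}"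
  have d: "distinct [?ab, ?ac, ?bc, ?a, ?b, ?c]"
    using abc by simp
  let ?U = "punctured_join ?ab ?ac ?bc ?a ?b ?c"
  have UC: "?U \<subseteq> stage1"
  proof
    fix \<tau> assume \<tau>: "\<tau> \<in> ?U"
    then have t: "\<tau> \<noteq> {}" "\<tau> \<subseteq> {?ab, ?ac, ?bc, ?a, ?b, ?c}" "\<not> {?a, ?b, ?c} \<subseteq> \<tau>"
      "?ab \<notin> \<tau> \<or> ?ac \<notin> \<tau> \<or> ?bc \<notin> \<tau>" by (simp_all add: punctured_join_def)
    have p3: "\<not> {?c, ?a, ?b} \<subseteq> \<tau>" "\<not> {?b, ?a, ?c} \<subseteq> \<tau>" using t(3) by auto
    have "\<tau> \<in> overlap"
      using t(4)
    proof (elim disjE)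
      assume n: "?ab \<notin> \<tau>"
      then have sub: "\<tau> \<subseteq> {{c, a}, {c, b}, ?c, ?a, ?b}"
        using drop_edge(1)[OF t(2) n] by (simp only: insert_commute[of c a] insert_commute[of c b])
      show ?thesis by (rule fork_in_overlap[OF t(1) _ sub p3(1)]) (use abc in auto)
    next
      assume n: "?ac \<notin> \<tau>"
      then have sub: "\<tau> \<subseteq> {{b, a}, {b, c}, ?b, ?a, ?c}"
        using drop_edge(2)[OF t(2) n] by (simp only: insert_commute[of b a])
      show ?thesis by (rule fork_in_overlap[OF t(1) _ sub p3(2)]) (use abc in auto)
    next
      assume n: "?bc \<notin> \<tau>"
      then have sub: "\<tau> \<subseteq> {?ab, ?ac, ?a, ?b, ?c}" using drop_edge(3)[OF t(2) n] by simp
      show ?thesis by (rule fork_in_overlap[OF t(1) _ sub t(3)]) (use abc in auto)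
    qed
    moreover have "\<tau> \<notin> quads"
    proof
      assume "\<tau> \<in> quads"
      then obtain a' b' c' where q: "1 \<le> a' \<and> a' < b' \<and> b' < c' \<and> c' < m" "\<tau> = {{a', b'}, {a', c'}, {b', m}, {c', m}}"
        unfolding quads_def by blast
      have pts: "z = a \<or> z = b \<or> z = c" if "{z, m} \<in> \<tau>" for z
        using subsetD[OF t(2) that] abc by simp
      have edg: "{x, y} = ?ab \<or> {x, y} = ?ac \<or> {x, y} = ?bc" if "{x, y} \<in> \<tau>" "x < m" "y < m" for x y
        using subsetD[OF t(2) that(1)] that(2,3) by simp
      have "b' = a \<or> b' = b \<or> b' = c" "c' = a \<or> c' = b \<or> c' = c" using pts[of b'] pts[of c'] q(2) by simp_all
      moreover have "{a', b'} = ?ab \<or> {a', b'} = ?ac \<or> {a', b'} = ?bc" by (rule edg) (use q in simp_all)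
      then have "a' \<in> ?ab \<or> a' \<in> ?ac \<or> a' \<in> ?bc" using insertI1[of a' "{b'}"] by metis
      then have "a' = a \<or> a' = b \<or> a' = c" by blast
      ultimately have "a' = a \<and> b' = b \<and> c' = c" using q(1) abc by auto
      then show False using \<tau> q(2) by (simp add: punctured_join_def)
    qed
    ultimately show "\<tau> \<in> stage1" by (simp add: stage1_def)
  qed
  have "boundary \<sigma> \<subseteq> ?U" unfolding \<sigma> by (rule punctured_join(3)[OF d])
  from boundary_null_of_collapsible[OF punctured_join(1,2)[OF d] this UC] that show thesis by blast
qed

lemma boundary_of_maximal:
  assumes "simplicial_complex K" "\<sigma> \<in> F" "F \<subseteq> K" "\<And>\<sigma>'. \<sigma>' \<in> F \<Longrightarrow> card \<sigma>' = card \<sigma>"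
  shows "boundary \<sigma> \<subseteq> K - F"
proof
  fix \<tau> assume "\<tau> \<in> boundary \<sigma>"
  then have \<tau>: "\<tau> \<noteq> {}" "\<tau> \<subset> \<sigma>" by (simp_all add: boundary_def)
  have \<sigma>: "\<sigma> \<in> K" using assms by blast
  have "card \<tau> < card \<sigma>" by (rule psubset_card_mono[OF complexD(1)[OF assms(1) \<sigma>] \<tau>(2)])
  then have "\<tau> \<notin> F" using assms(4) by force
  then show "\<tau> \<in> K - F" using complexD(3)[OF assms(1) \<sigma> \<tau>(1)] \<tau>(2) by auto
qed

lemma boundary_triangle:
  assumes "\<sigma> \<in> triangles"
  obtains a where "homotopic_with_canon (\<lambda>_. True) (points (boundary \<sigma>)) (points open_ears) (\<lambda>x. x) (\<lambda>_. a)"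
proof -
  have "boundary \<sigma> \<subseteq> open_ears" unfolding open_ears_def
    by (rule boundary_of_maximal[OF complex_ears assms triangles_subset_ears]) (simp add: card_triangle assms)
  from boundary_null_of_collapsible[OF complex_open_ears collapse_open_ears this order_refl] that show thesis by blast
qed

text \<open>
  A facet of \<open>K2 m\<close> that contains the point \<open>{x, m}\<close> contains every edge
  at \<open>x\<close>.
\<close>

lemma K2_collapse: "collapses (K2 m) (K1 (m - 1) \<union> K2 (m - 1))"
proof -
  let ?S = "{{{x, m}} | x. ind x}"
  have "collapses (K2 m) (delete_stars ?S (K2 m))"
  proof (rule collapses_delete_stars_ex[OF complex_K(2)])
    fix \<sigma> assume "\<sigma> \<in> ?S"
    then obtain x where x: "ind x" "\<sigma> = {{x, m}}" by blast
    define x' where "x' = (if x = 1 then 2 else 1 :: nat)"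
    have x': "ind x'" "x' \<noteq> x" using m3 by (auto simp: x'_def)
    show "\<exists>v. v \<notin> \<sigma> \<and> (\<forall>\<tau>\<in>K2 m. \<sigma> \<subseteq> \<tau> \<longrightarrow> insert v \<tau> \<in> K2 m \<and> (\<forall>\<sigma>'\<in>?S. \<sigma>' \<subseteq> insert v \<tau> \<longrightarrow> \<sigma>' \<subseteq> \<tau>))"
    proof (intro exI[of _ "{x, x'}"] conjI ballI impI)
      show "{x, x'} \<notin> \<sigma>" using x x' by simp
      fix \<tau> assume \<tau>: "\<tau> \<in> K2 m" "\<sigma> \<subseteq> \<tau>"
      obtain s t where st: "ind s" "ind t" "s \<noteq> t" "\<forall>u\<in>\<tau>. s \<in> u \<or> t \<in> u" using \<tau>(1) unfolding K2_iff by blast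
      have "s \<in> {x, m} \<or> t \<in> {x, m}" using bspec[OF st(4), of "{x, m}"] \<tau>(2) x(2) by simp
      then have "x = s \<or> x = t" using st by auto
      then have "\<forall>u\<in>insert {x, x'} \<tau>. s \<in> u \<or> t \<in> u" using st(4) by auto
      moreover have "insert {x, x'} \<tau> \<subseteq> F2 m" using \<tau>(1) edge_F2[of x x'] x x' by (simp add: K2_iff)
      ultimately show "insert {x, x'} \<tau> \<in> K2 m" unfolding K2_iff using st(1-3) by blast
      fix \<sigma>' assume "\<sigma>' \<in> ?S" "\<sigma>' \<subseteq> insert {x, x'} \<tau>"
      moreover have "{x, x'} \<noteq> {y, m}" for y using x x' by simp
      ultimately show "\<sigma>' \<subseteq> \<tau>" by auto
    qed
  qed auto
  moreover have "delete_stars ?S (K2 m) = K1 (m - 1) \<union> K2 (m - 1)"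
  proof (intro set_eqI)
    fix \<tau>
    have F: "\<tau> \<subseteq> F2 m \<and> (\<forall>x. ind x \<longrightarrow> {x, m} \<notin> \<tau>) \<longleftrightarrow> \<tau> \<subseteq> F2 (m - 1)"
    proof
      assume L: "\<tau> \<subseteq> F2 m \<and> (\<forall>x. ind x \<longrightarrow> {x, m} \<notin> \<tau>)"
      show "\<tau> \<subseteq> F2 (m - 1)"
      proof
        fix u assume u: "u \<in> \<tau>"
        then have "u \<in> F2 m" using L by blast
        then show "u \<in> F2 (m - 1)"
          by (cases rule: F2_cases) (use L u in \<open>auto simp: F2_def\<close>)
      qed
    next
      assume R: "\<tau> \<subseteq> F2 (m - 1)"
      have "u \<in> F2 m \<and> m \<notin> u" if u: "u \<in> F2 (m - 1)" for u
      proof -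
        have "u \<subseteq> {1..m - 1}" "card u = 2" using u by (simp_all add: F2_def)
        moreover have "{1..m - 1} \<subseteq> {1..m}" "m \<notin> {1..m - 1}" using m3 by auto
        ultimately show ?thesis by (auto simp only: F2_def)
      qed
      then show "\<tau> \<subseteq> F2 m \<and> (\<forall>x. ind x \<longrightarrow> {x, m} \<notin> \<tau>)" using R by blast
    qed
    have "\<tau> \<in> delete_stars ?S (K2 m) \<longleftrightarrow> \<tau> \<in> K2 m \<and> (\<forall>x. ind x \<longrightarrow> {x, m} \<notin> \<tau>)"
      by (auto simp: delete_stars_def)
    also have "\<dots> \<longleftrightarrow> \<tau> \<noteq> {} \<and> \<tau> \<subseteq> F2 (m - 1) \<and> (\<exists>x y. ind x \<and> ind y \<and> x \<noteq> y \<and> (\<forall>u\<in>\<tau>. x \<in> u \<or> y \<in> u))"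
      unfolding K2_iff using F by blast
    also have "\<dots> \<longleftrightarrow> \<tau> \<in> generated_complex {star_set (m - 1) x y | x y. ind x \<and> ind y \<and> x \<noteq> y}"
      unfolding generated_complex_def by (auto simp: star_set_def)
    also have "generated_complex {star_set (m - 1) x y | x y. ind x \<and> ind y \<and> x \<noteq> y} = K1 (m - 1) \<union> K2 (m - 1)"
    proof -
      have comm: "star_set (m - 1) x y = star_set (m - 1) y x" for x y by (simp add: star_set_def insert_commute)
      have "{star_set (m - 1) x y | x y. ind x \<and> ind y \<and> x \<noteq> y} =
        {star_set (m - 1) i (m - 1) | i. i \<in> {1..m - 1 - 1}} \<union>
        {star_set (m - 1) x y | x y. x \<in> {1..m - 1} \<and> y \<in> {1..m - 1} \<and> x \<noteq> y \<and> m - 1 \<notin> {x, y}}" (is "?A = ?B \<union> ?D")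
      proof
        show "?A \<subseteq> ?B \<union> ?D"
        proof
          fix s assume "s \<in> ?A"
          then obtain x y where xy: "ind x" "ind y" "x \<noteq> y" "s = star_set (m - 1) x y" by blast
          consider "x = m - 1" | "y = m - 1" | "m - 1 \<notin> {x, y}" by blast
          then show "s \<in> ?B \<union> ?D"
          proof cases
            case 1
            then have "y \<in> {1..m - 1 - 1}" "s = star_set (m - 1) y (m - 1)" using xy comm by auto
            then show ?thesis by blast
          next
            case 2
            then have "x \<in> {1..m - 1 - 1}" "s = star_set (m - 1) x (m - 1)" using xy by auto
            then show ?thesis by blast
          next
            case 3
            have "x \<in> {1..m - 1}" "y \<in> {1..m - 1}" using xy by auto
            then show ?thesis using xy(3,4) 3 by blast
          qed
        qed
        show "?B \<union> ?D \<subseteq> ?A"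
        proof
          fix s assume "s \<in> ?B \<union> ?D"
          then show "s \<in> ?A"
          proof
            assume "s \<in> ?B"
            then obtain i where i: "i \<in> {1..m - 1 - 1}" "s = star_set (m - 1) i (m - 1)" by blast
            then have "ind i" "ind (m - 1)" "i \<noteq> m - 1" using m3 by auto
            then show ?thesis using i(2) by blast
          next
            assume "s \<in> ?D"
            then obtain x y where xy: "x \<in> {1..m - 1}" "y \<in> {1..m - 1}" "x \<noteq> y" "s = star_set (m - 1) x y" by blast
            then have "ind x" "ind y" using m3 by auto
            then show ?thesis using xy(3,4) by blast
          qed
        qed
      qed
      moreover have "generated_complex (B \<union> D) = generated_complex B \<union> generated_complex D" for B D :: "nat set set set"
        by (auto simp: generated_complex_def)
      ultimately show ?thesis by (simp only: K1_def K2_def)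
    qed
    finally show "\<tau> \<in> delete_stars ?S (K2 m) \<longleftrightarrow> \<tau> \<in> K1 (m - 1) \<union> K2 (m - 1)" .
  qed
  ultimately show ?thesis by simp
qed

end

section \<open>Induction on the ground set\<close>

text \<open>
  The element 0 keeps these sets apart from \<open>F2 m\<close> and from the empty set, which serves
  as apex of the cones.
\<close>

definition fresh :: "nat \<times> nat \<times> nat \<Rightarrow> nat set" where
  "fresh = (\<lambda>(d, j, k). {0, Suc (prod_encode (d, prod_encode (j, k)))})"

lemma inj_fresh: "inj fresh"
  by (rule injI) (simp add: fresh_def case_prod_unfold prod_eq_iff)

lemma fresh_0: "u \<in> range fresh \<Longrightarrow> 0 \<in> u"
  by (auto simp: fresh_def)

abbreviation "base \<equiv> {1, 2 :: nat}"

lemma F2_fresh: "u \<in> F2 m \<Longrightarrow> u \<notin> range fresh"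
  using fresh_0 by (fastforce simp: F2_def)

context two_subsets
begin

lemma base_in: "{base} \<in> open_ears" "{base} \<in> stage1" "{base} \<in> K2 m" "{base} \<in> K1 (m - 1) \<union> K2 (m - 1)"
proof -
  show q': "{base} \<in> open_ears" by (rule open_earsI[of _ 1 2 1 2]) (use m3 in \<open>auto simp: ear_def\<close>)
  show c1: "{base} \<in> stage1"
    using q' ears_subset_stage4 collapses_subset[OF collapse_stage1] by (auto simp: open_ears_def)
  show "{base} \<in> K2 m" using c1 by (auto simp: stage1_def overlap_def)
  have "star_set (m - 1) 1 (m - 1) \<in> {star_set (m - 1) i (m - 1) | i. i \<in> {1..m - 1 - 1}}"
    using m3 by force
  moreover have "base \<in> star_set (m - 1) 1 (m - 1)" using m3 by (auto simp: star_set_def F2_def)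
  ultimately show "{base} \<in> K1 (m - 1) \<union> K2 (m - 1)"
    unfolding K1_def generated_complex_def by blast
qed

text \<open>
  One step of the induction: \<open>K1 m\<close> is replaced by a cone over the overlap, the quads
  and triangles of the overlap are traded for spheres of dimension 4 and 3, and the rest of the cone
  collapses.
\<close>

lemma cech_step:
  assumes "null_homotopic (realization (K1 m \<inter> K2 m)) (realization (K2 m)) (\<lambda>x. x)"
  shows "realization (K1 m \<union> K2 m \<union> bouquet fresh base (sphere_labels a b)) homotopy_equivalent_space
    realization (K1 (m - 1) \<union> K2 (m - 1) \<union>
      bouquet fresh base (sphere_labels (a + ((m - 2) choose 3)) (b + ((m - 1) choose 3))))"
proof -
  obtain c where c: "homotopic_with_canon (\<lambda>_. True) (points overlap) (points (K2 m)) (\<lambda>x. x) (\<lambda>_. c)"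
    using assms unfolding null_homotopic_def realization_eq overlap_def by blast
  have vert: "u \<in> F2 m" if "u \<in> \<Union>(K1 m) \<union> \<Union>(K2 m)" for u
    using that by (auto simp: K1_iff K2_iff)
  have ne: "{} \<notin> F2 m" by (simp add: F2_def)
  interpret cc: coned_complex overlap "K2 m" "{}" base fresh c
  proof
    show "\<Union>(K2 m) \<inter> range fresh = {}" using vert F2_fresh by blast
    show "{} \<notin> \<Union>(K2 m)" using vert ne by blast
    show "{} \<notin> range fresh" using fresh_0 by blast
  qed (simp_all add: complex_overlap complex_K inj_fresh c, simp add: overlap_def)
  let ?N3 = "(m - 2) choose 3" and ?N4 = "(m - 1) choose 3"
  let ?B = "\<lambda>a b. bouquet fresh base (sphere_labels a b)"
  have fin: "finite (sphere_labels a b)" for a b by (simp add: sphere_labels_def)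
  have p: "{1, m} \<in> F2 m" using point_F2[of 1] m3 by simp
  have pK: "{{1, m}} \<in> K2 m" "{{1, m}} \<in> K1 m"
  proof -
    have "\<exists>x y. ind x \<and> ind y \<and> x \<noteq> y \<and> (\<forall>u\<in>{{1, m}}. x \<in> u \<or> y \<in> u)"
      by (rule exI[of _ "1 :: nat"], rule exI[of _ "2 :: nat"]) (use m3 in simp)
    moreover have "\<exists>i. ind i \<and> (\<forall>u\<in>{{1, m}}. i \<in> u \<or> m \<in> u)"
      by (rule exI[of _ "1 :: nat"]) (use m3 in simp)
    ultimately show "{{1, m}} \<in> K2 m" "{{1, m}} \<in> K1 m"
      unfolding K2_iff K1_iff using p by simp_all
  qed
  have 1: "realization (K1 m \<union> K2 m \<union> ?B a b) homotopy_equivalent_space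
      realization (K2 m \<union> cone {} overlap \<union> ?B a b)"
  proof (rule cc.replace_cone[OF complex_K(1) _ pK(2) _ _ _ base_in(3) fin])
    show "K1 m \<inter> K2 m = overlap" by (simp add: overlap_def)
    show "insert {1, m} \<tau> \<in> K1 m" if "\<tau> \<in> K1 m" for \<tau>
      using that point_F2[of 1] m3 unfolding K1_iff by auto
    show "{} \<notin> \<Union>(K1 m)" using vert ne by blast
    show "\<Union>(K1 m) \<inter> range fresh = {}" using vert F2_fresh by blast
  qed
  have CQ: "stage1 \<union> quads = overlap" using quads_subset_overlap by (auto simp: stage1_def)
  have "realization (K2 m \<union> cone {} (stage1 \<union> quads) \<union> ?B a b) homotopy_equivalent_space
      realization (K2 m \<union> cone {} stage1 \<union> bouquet fresh base (sphere_labels a b \<union> {4} \<times> {b..<b + card quads}))"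
  proof (rule cc.cone_cells_to_spheres[OF finite_quads complex_stage1])
    show "stage1 \<subseteq> overlap" "stage1 \<inter> quads = {}" by (auto simp: stage1_def)
    show "{base} \<in> stage1" by (rule base_in)
    show "\<sigma> \<in> overlap \<and> boundary \<sigma> \<subseteq> stage1 \<and> card \<sigma> = 4" if "\<sigma> \<in> quads" for \<sigma>
      using boundary_of_maximal[OF complex_overlap that quads_subset_overlap] that card_quad quads_subset_overlap
      by (auto simp: stage1_def)
    show "\<exists>a. homotopic_with_canon (\<lambda>_. True) (points (boundary \<sigma>)) (points stage1) (\<lambda>x. x) (\<lambda>_. a)" if "\<sigma> \<in> quads" for \<sigma>
      using boundary_quad[OF that] by blast
    show "sphere_labels a b \<inter> {4} \<times> {b..} = {}" by (auto simp: sphere_labels_def)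
  qed (simp_all add: fin)
  moreover have "sphere_labels a b \<union> {4} \<times> {b..<b + card quads} = sphere_labels a (b + ?N4)"
    by (auto simp: sphere_labels_def card_quads)
  ultimately have 2: "realization (K2 m \<union> cone {} overlap \<union> ?B a b) homotopy_equivalent_space
      realization (K2 m \<union> cone {} stage1 \<union> ?B a (b + ?N4))" by (simp only: CQ)
  have QC: "ears \<subseteq> overlap" using collapses_subset[OF collapse_stage1] by (auto simp: stage1_def)
  have 3: "realization (K2 m \<union> cone {} stage1 \<union> ?B a (b + ?N4)) homotopy_equivalent_space
      realization (K2 m \<union> cone {} ears \<union> ?B a (b + ?N4))"
    by (rule cc.cone_collapse[OF collapse_stage1 complex_stage1 _ base_in(3) fin]) (simp add: stage1_def)
  have QQ: "open_ears \<union> triangles = ears" using triangles_subset_ears by (auto simp: open_ears_def)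
  have "realization (K2 m \<union> cone {} (open_ears \<union> triangles) \<union> ?B a (b + ?N4)) homotopy_equivalent_space
      realization (K2 m \<union> cone {} open_ears \<union> bouquet fresh base (sphere_labels a (b + ?N4) \<union> {3} \<times> {a..<a + card triangles}))"
  proof (rule cc.cone_cells_to_spheres[OF finite_triangles complex_open_ears])
    show "open_ears \<subseteq> overlap" "open_ears \<inter> triangles = {}" using QC by (auto simp: open_ears_def)
    show "{base} \<in> open_ears" by (rule base_in)
    show "\<sigma> \<in> overlap \<and> boundary \<sigma> \<subseteq> open_ears \<and> card \<sigma> = 3" if "\<sigma> \<in> triangles" for \<sigma>
      using boundary_of_maximal[OF complex_ears that triangles_subset_ears] that card_triangle triangles_subset_ears QC
      by (auto simp: open_ears_def)
    show "\<exists>a. homotopic_with_canon (\<lambda>_. True) (points (boundary \<sigma>)) (points open_ears) (\<lambda>x. x) (\<lambda>_. a)" if "\<sigma> \<in> triangles" for \<sigma>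
      using boundary_triangle[OF that] by blast
    show "sphere_labels a (b + ?N4) \<inter> {3} \<times> {a..} = {}" by (auto simp: sphere_labels_def)
  qed (simp_all add: fin)
  moreover have "sphere_labels a (b + ?N4) \<union> {3} \<times> {a..<a + card triangles} = sphere_labels (a + ?N3) (b + ?N4)"
    by (auto simp: sphere_labels_def card_triangles)
  ultimately have 4: "realization (K2 m \<union> cone {} ears \<union> ?B a (b + ?N4)) homotopy_equivalent_space
      realization (K2 m \<union> cone {} open_ears \<union> ?B (a + ?N3) (b + ?N4))" by (simp only: QQ)
  have 5: "realization (K2 m \<union> cone {} open_ears \<union> ?B (a + ?N3) (b + ?N4)) homotopy_equivalent_space
      realization (K2 m \<union> cone {} {{{1, m}}} \<union> ?B (a + ?N3) (b + ?N4))"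
    by (rule cc.cone_collapse[OF collapse_open_ears complex_open_ears _ base_in(3) fin]) (use QC in \<open>auto simp: open_ears_def\<close>)
  have 6: "realization (K2 m \<union> cone {} {{{1, m}}} \<union> ?B (a + ?N3) (b + ?N4)) homotopy_equivalent_space
      realization (K2 m \<union> ?B (a + ?N3) (b + ?N4))"
    by (rule cc.cone_collapse_point[OF pK(1) base_in(3) fin])
  have 7: "realization (K2 m \<union> ?B (a + ?N3) (b + ?N4)) homotopy_equivalent_space
      realization (K1 (m - 1) \<union> K2 (m - 1) \<union> ?B (a + ?N3) (b + ?N4))"
    by (rule collapses_bouquet[OF K2_collapse complex_K(2) base_in(4) cc.\<nu>(2) fin])
  note 1
  also note 2
  also note 3
  also note 4
  also note 5
  also note 6
  also note 7
  finally show ?thesis .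
qed

end

lemma base_case: "K1 2 \<union> K2 2 = {{base}}"
proof -
  have "u \<in> F2 2 \<longleftrightarrow> u = base" for u
  proof
    assume u: "u \<in> F2 2"
    have "u = {1..2}" using u by (intro card_subset_eq) (auto simp: F2_def)
    then show "u = base" by auto
  qed (auto simp: F2_def)
  then have F: "F2 2 = {base}" by blast
  then have "star_set 2 x y \<subseteq> {base}" for x y by (auto simp: star_set_def)
  moreover have "star_set 2 1 2 = {base}" unfolding star_set_def F by auto
  ultimately have "K1 2 = {{base}}" unfolding K1_def generated_complex_def
    by (auto simp: subset_singleton_iff)
  moreover have "K2 2 = {}" unfolding K2_def generated_complex_def by auto
  ultimately show ?thesis by simp
qed

text \<open>
  Pascal's rule adds up the numbers of cells. The spheres already split off are carried along as
  \<open>a\<close> and \<open>b\<close>.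
\<close>

lemma cech_induction:
  assumes "\<forall>m\<ge>3. null_homotopic (realization (K1 m \<inter> K2 m)) (realization (K2 m)) (\<lambda>x. x)" "2 \<le> m"
  shows "realization (K1 m \<union> K2 m \<union> bouquet fresh base (sphere_labels a b)) homotopy_equivalent_space
    realization (bouquet fresh base (sphere_labels (a + ((m - 1) choose 4)) (b + (m choose 4))))"
  using assms(2)
proof (induction m arbitrary: a b rule: nat_induct_at_least)
  case base
  have "{{{1, 2 :: nat}}} \<union> bouquet fresh {1, 2} (sphere_labels a b) = bouquet fresh {1, 2} (sphere_labels a b)"
    by (auto simp: bouquet_def)
  then show ?case by (simp add: base_case homotopy_equivalent_space_refl binomial_eq_0)
next
  case (Suc n)
  interpret two_subsets "Suc n" using Suc.hyps by unfold_locales simp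
  have p: "(n choose 3) + (n choose 4) = Suc n choose 4" by (simp add: numeral_eq_Suc)
  obtain k where k: "n = Suc k" using Suc.hyps by (cases n) auto
  have q: "(k choose 3) + (k choose 4) = n choose 4" unfolding k by (simp add: numeral_eq_Suc)
  have "realization (K1 (Suc n) \<union> K2 (Suc n) \<union> bouquet fresh {1, 2} (sphere_labels a b)) homotopy_equivalent_space
    realization (K1 n \<union> K2 n \<union> bouquet fresh {1, 2} (sphere_labels (a + (k choose 3)) (b + (n choose 3))))"
    using cech_step[of a b] assms(1) Suc.hyps by (simp add: k)
  also have "\<dots> homotopy_equivalent_space
    realization (bouquet fresh {1, 2} (sphere_labels (a + (k choose 3) + ((n - 1) choose 4)) (b + (n choose 3) + (n choose 4))))"
    by (rule Suc.IH)
  finally show ?case using p q by (simp add: k add.assoc)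
qed

theorem mainTheorem2:
  assumes "\<forall>m\<ge>3. null_homotopic (realization (K1 m \<inter> K2 m)) (realization (K2 m)) (\<lambda>x. x)"
  shows "\<forall>m\<ge>3. \<forall>r::real. 4 \<le> r \<and> r < 8 \<longrightarrow>
    realization (cech_complex (F2 m) symdiff_dist r) homotopy_equivalent_space
      wedge2 (sphere_wedge 3 ((m - 1) choose 4)) None (sphere_wedge 4 (m choose 4)) None"
proof (intro allI impI)
  fix m :: nat and r :: real assume m: "3 \<le> m" and r: "4 \<le> r \<and> r < 8"
  let ?L = "sphere_labels ((m - 1) choose 4) (m choose 4)"
  have empty: "bouquet fresh base (sphere_labels 0 0) = {{base}}" by (simp add: bouquet_def sphere_labels_def)
  interpret two_subsets m using m by unfold_locales
  have "K1 m \<union> K2 m \<union> bouquet fresh base (sphere_labels 0 0) = K1 m \<union> K2 m"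
    unfolding empty using base_in(3) by blast
  then have "realization (cech_complex (F2 m) symdiff_dist r) =
      realization (K1 m \<union> K2 m \<union> bouquet fresh base (sphere_labels 0 0))"
    using r by (simp only: cech_complex_F2)
  also have "\<dots> homotopy_equivalent_space realization (bouquet fresh base ?L)"
    using cech_induction[OF assms, of m 0 0] m by simp
  also have "realization (bouquet fresh base ?L) homotopy_equivalent_space
      wedge2 (sphere_wedge 3 ((m - 1) choose 4)) None (sphere_wedge 4 (m choose 4)) None"
  proof -
    have "base \<notin> range fresh" using fresh_0 by force
    from bouquet_homeomorphic_wedge[OF inj_fresh this] show ?thesis
      by (metis homeomorphic_imp_homotopy_equivalent_space homotopy_equivalent_space_sym)
  qed
  finally show "realization (cech_complex (F2 m) symdiff_dist r) homotopy_equivalent_space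
      wedge2 (sphere_wedge 3 ((m - 1) choose 4)) None (sphere_wedge 4 (m choose 4)) None" .
qed

end
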